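(* Let $m\in\{1,2,4\}$. As $r\to+\infty$ in $\mathbb{R}$, the following estimates hold (for each choice of sign $\pm$): \[ \log L^{1,\pm r}\left(\tfrac12,1;\mathrm{St},\mathrm{Sym}^m\right)=\mathrm{Sym}^m_{\pm}\,r\log_2 r+\mathrm{Sym}^{m,1}_{\pm}\,r+O_m\left(\frac{r}{\log r}\right) \] and \[ \log L^{1,\pm r}\left(1,1;\mathrm{Sym}^2,\mathrm{Sym}^m\right)=\mathrm{Sym}^m_{\pm}\,r\log_2 r+\mathrm{Sym}^{m,1}_{\pm}\,r+O_m\left(\frac{r}{\log r}\right). \]
   Context: $\log_2=\log\circ\log$. $\mathrm{St}$ is the standard representation of $\mathrm{SU}(2)$ on $\mathbb{C}^2$, $\mathrm{Sym}^m$ its $m$-th symmetric power, $\chi_{\mathrm{Sym}^m}$ its character; $D(X,\rho,g)=\det[I-X\rho(g)]^{-1}$ (positive real for $\rho=\mathrm{Sym}^m$ and $X\in[0,1)$). $dg$ is the probability Haar measure on $\mathrm{SU}(2)$. For $z\in\mathbb{C}$, \[L^{1,z}\left(\tfrac12,1;\mathrm{St},\mathrm{Sym}^m\right)=\prod_{p}\int_{\mathrm{SU}(2)}D(p^{-1/2},\mathrm{St},g)D(p^{-1},\mathrm{Sym}^m,g)^z\,dg,\] \[L^{1,z}\left(1,1;\mathrm{Sym}^2,\mathrm{Sym}^m\right)=\prod_{p}\int_{\mathrm{SU}(2)}D(p^{-1},\mathrm{Sym}^2,g)D(p^{-1},\mathrm{Sym}^m,g)^z\,dg,\] products over all primes $p$.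 The constants are \[\mathrm{Sym}^m_{\pm}=\max_{g\in\mathrm{SU}(2)}\pm\chi_{\mathrm{Sym}^m}(g),\] \[\mathrm{Sym}^{m,1}_{\pm}=\gamma^*\,\mathrm{Sym}^m_{\pm}+\sum_{p}\left\{\pm\log\left(\pm\max_{g\in\mathrm{SU}(2)}\pm D(p^{-1},\mathrm{Sym}^m,g)\right)-\frac{\mathrm{Sym}^m_{\pm}}{p}\right\},\] where $\gamma^*$ is the constant determined by $\sum_{p\le x}\frac1p=\log_2x+\gamma^*+O(1/\log x)$ for $x\ge2$. *)

theory Defs
  imports
    "Jordan_Normal_Form.Determinant"
    "HOL-Probability.Probability"
    "HOL-Library.Landau_Symbols"
    "HOL-Computational_Algebra.Primes"
begin

no_notation vec_index (infixl \<open>$\<close> 100)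

definition SU2 :: "(complex^2^2) set" where
  "SU2 = {g. g ** (\<chi> i j. cnj (g $ j $ i)) = Finite_Cartesian_Product.mat 1
             \<and> Determinants.det g = 1}"

text \<open>On the compact group \<^term>\<open>SU2\<close> a left-invariant Borel probability measure exists, is
  unique, and is automatically right-invariant and regular.\<close>

definition is_haar_prob_SU2 :: "(complex^2^2) measure \<Rightarrow> bool" where
  "is_haar_prob_SU2 \<mu> \<longleftrightarrow> prob_space \<mu> \<and> sets \<mu> = sets (restrict_space borel SU2)
     \<and> (\<forall>h\<in>SU2. distr \<mu> \<mu> (\<lambda>g. h ** g) = \<mu>)"

text \<open>The type \<^typ>\<open>complex^2^2\<close> carries the topology of the group, while representations take
  values in \<^typ>\<open>complex mat\<close>, whose dimension is a number and not a type.\<close>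

definition std_rep :: "complex^2^2 \<Rightarrow> complex mat" where
  "std_rep g = mat_of_rows_list 2 [[g $ 1 $ 1, g $ 1 $ 2], [g $ 2 $ 1, g $ 2 $ 2]]"

text \<open>The matrix of the action of \<open>g\<close> on the \<open>m\<close>-th symmetric power of the standard
  representation, in the basis \<open>e\<^sub>1^(m-i) e\<^sub>2^i\<close> for \<open>i = 0, ..., m\<close>. The \<open>j\<close>-th basis vector is
  sent to \<open>(a e\<^sub>1 + c e\<^sub>2)^(m-j) (b e\<^sub>1 + d e\<^sub>2)^j\<close>, where \<open>(a, c)\<close> and \<open>(b, d)\<close> are the columns
  of \<open>g\<close>; setting \<open>e\<^sub>1 = 1\<close>, the entry in row \<open>i\<close> is the coefficient of the \<open>i\<close>-th power of \<open>e\<^sub>2\<close>.\<close>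

definition sym_rep :: "nat \<Rightarrow> complex^2^2 \<Rightarrow> complex mat" where
  "sym_rep m g = Matrix.mat (m + 1) (m + 1) (\<lambda>(i, j).
     coeff ([:g $ 1 $ 1, g $ 2 $ 1:] ^ (m - j) * [:g $ 1 $ 2, g $ 2 $ 2:] ^ j) i)"

definition character :: "(complex^2^2 \<Rightarrow> complex mat) \<Rightarrow> complex^2^2 \<Rightarrow> complex" where
  "character \<rho> g = (\<Sum>i<dim_row (\<rho> g). \<rho> g $$ (i, i))"

definition D_fac :: "complex \<Rightarrow> (complex^2^2 \<Rightarrow> complex mat) \<Rightarrow> complex^2^2 \<Rightarrow> complex" where
  "D_fac X \<rho> g = inverse (Determinant.det (1\<^sub>m (dim_row (\<rho> g)) - X \<cdot>\<^sub>m \<rho> g))"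

text \<open>The Euler product \<open>L^{1,z}(s,t;\<rho>\<^sub>1,\<rho>\<^sub>2)\<close>, taken over the primes in increasing order. The
  complex power uses the principal branch of the logarithm; its base is a positive real number
  when \<open>\<rho>\<^sub>2\<close> is a symmetric power and \<open>t > 0\<close>.\<close>

definition L_moment ::
  "(complex^2^2) measure \<Rightarrow> complex \<Rightarrow> real \<Rightarrow> real \<Rightarrow>
    (complex^2^2 \<Rightarrow> complex mat) \<Rightarrow> (complex^2^2 \<Rightarrow> complex mat) \<Rightarrow> complex" where
  "L_moment \<mu> z s t \<rho>\<^sub>1 \<rho>\<^sub>2 = prodinf (\<lambda>p. if prime p
     then LINT g|\<mu>. D_fac (of_real (real p powr - s)) \<rho>\<^sub>1 g
                    * D_fac (of_real (real p powr - t)) \<rho>\<^sub>2 g powr z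
     else 1)"

definition mertens_const :: real where
  "mertens_const = (THE c. \<exists>C. \<forall>x\<ge>2.
     \<bar>(\<Sum>p | prime p \<and> real p \<le> x. 1 / real p) - ln (ln x) - c\<bar> \<le> C / ln x)"

text \<open>Below \<open>\<sigma> \<in> {1, -1}\<close> is the sign. For symmetric powers and real \<open>X\<close>, the values of
  \<^const>\<open>character\<close> and \<^const>\<open>D_fac\<close> are real, so \<^const>\<open>Re\<close> merely changes the type;
  \<open>GREATEST\<close> denotes the maximum, which is attained because \<^term>\<open>SU2\<close> is compact.\<close>

definition Sym_const :: "real \<Rightarrow> nat \<Rightarrow> real" where
  "Sym_const \<sigma> m = (GREATEST v. v \<in> (\<lambda>g. \<sigma> * Re (character (sym_rep m) g)) ` SU2)"

definition Sym1_const :: "real \<Rightarrow> nat \<Rightarrow> real" where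
  "Sym1_const \<sigma> m = mertens_const * Sym_const \<sigma> m +
     (\<Sum>p. if prime p
        then \<sigma> * ln (\<sigma> * (GREATEST v. v \<in> (\<lambda>g. \<sigma> * Re (D_fac (1 / of_nat p) (sym_rep m) g)) ` SU2))
               - Sym_const \<sigma> m / real p
        else 0)"

end

theory Submission
  imports Defs "HOL-Number_Theory.Prime_Powers" "HOL-Real_Asymp.Real_Asymp"
begin

text \<open>On \<^term>\<open>SU2\<close> the function \<open>D(X, Sym\<^sup>m, g)\<close> depends only on \<open>x = Re g\<^sub>1\<^sub>1 = cos \<theta>\<close>, where
  \<open>e\<^sup>\<plusminus>\<^sup>i\<^sup>\<theta>\<close> are the eigenvalues of \<open>g\<close>, and is positive. Its logarithm \<open>sym_log m X x\<close> is
  \<open>X \<chi>(x) + O(X\<^sup>2)\<close> with \<open>\<chi>\<close> the character, and it is Lipschitz in \<open>x\<close> with constant \<open>O(X)\<close>. The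
  local factor at \<open>p\<close> is therefore \<open>I\<^sub>p(r) = \<integral> W\<^sub>p exp(\<sigma> r sym_log m (1/p))\<close> with a weight \<open>W\<^sub>p\<close> that
  is bounded, is \<open>1 + O(p\<^sup>-\<^sup>1\<^sup>/\<^sup>2)\<close> pointwise, and is \<open>1 + O(p\<^sup>-\<^sup>3\<^sup>/\<^sup>2)\<close> on average because
  non-trivial irreducible characters integrate to zero.

  The sum of the \<open>log I\<^sub>p(r)\<close> is cut at \<open>p \<approx> K r\<close> for a constant \<open>K\<close>.

  For \<open>p \<le> K r\<close> the integral concentrates where \<open>\<sigma> sym_log m (1/p)\<close> is maximal; call the maximum
  \<open>\<lambda>\<^sub>p\<close>. Trivially \<open>I\<^sub>p(r) = O(exp(r \<lambda>\<^sub>p))\<close>. Conversely the exponent is within \<open>O(1)\<close> of its maximum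
  on a ball of radius \<open>p / (K r)\<close>, and a ball of radius \<open>\<delta>\<close> has Haar measure at least a constant
  times \<open>\<delta>\<^sup>4\<close>; this crude bound suffices, since it only enters through its logarithm. Hence
  \<open>log I\<^sub>p(r) = r \<lambda>\<^sub>p + O(1 + log(K r / p))\<close>, and Chebyshev's bound makes the errors add up to
  \<open>O(r / log r)\<close>.

  For \<open>p > K r\<close> the exponent is small and a second order expansion, in which the linear term
  cancels by orthogonality, gives \<open>log I\<^sub>p(r) = O(r p\<^sup>-\<^sup>3\<^sup>/\<^sup>2 + r\<^sup>2 p\<^sup>-\<^sup>2)\<close>, which is again
  \<open>O(r / log r)\<close> in total. This bound also yields the convergence of the product.

  Finally \<open>\<lambda>\<^sub>p = Sym\<^sup>m\<^sub>\<plusminus> / p + O(p\<^sup>-\<^sup>2)\<close>, so the main term \<open>r \<Sum>\<^bsub>p \<le> K r\<^esub> \<lambda>\<^sub>p\<close> is evaluated by Mertens' second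
  theorem. The lemmas that carry this are
  \<open>mertens_const_spec\<close>, \<open>D_fac_sym_rep_SU2\<close>, \<open>integral_sym_char_eq_0\<close>, \<open>measure_near_point\<close>,
  \<open>moment_small_prime\<close>, \<open>moment_large_prime\<close> and \<open>euler_sum_asymptotics\<close>.\<close>

section \<open>Sums over primes: Chebyshev and Mertens\<close>

text \<open>Boundary terms are placed at \<open>N + 1\<close> and \<open>M + 1\<close> rather than at \<open>N\<close> and \<open>M\<close>, so that both
  ends of the summation range are treated alike and \<open>M = N\<close> needs no exception.\<close>

lemma abel_summation:
  fixes a f :: "nat \<Rightarrow> real"
  assumes "M \<le> N"
  shows "(\<Sum>k\<in>{M<..N}. a k * f k) = (\<Sum>k\<le>N. a k) * f (Suc N) - (\<Sum>k\<le>M. a k) * f (Suc M)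
           + (\<Sum>n\<in>{M<..N}. (\<Sum>k\<le>n. a k) * (f n - f (Suc n)))"
  using assms
proof (induction N rule: dec_induct)
  case base
  then show ?case by simp
next
  case (step N)
  have "{M<..Suc N} = insert (Suc N) {M<..N}"
    using step by auto
  then show ?case
    using step by (simp add: algebra_simps)
qed

text \<open>How Chebyshev's bound is used: since only upper bounds on the partial sums enter, weights
  with partial sums below \<open>C n\<close> may be replaced by the constant weight \<open>C\<close> against any decreasing
  function. Summation by parts is applied once to \<open>a\<close> and once, backwards, to the constant weight.\<close>

lemma sum_le_of_linear_partial_sums:
  fixes a f :: "nat \<Rightarrow> real"
  assumes "M \<le> N" and A: "\<And>n. (\<Sum>k\<le>n. a k) \<le> C * n" and A0: "(\<Sum>k\<le>M. a k) \<ge> 0"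
    and f: "\<And>n. n > M \<Longrightarrow> n \<le> N \<Longrightarrow> f (Suc n) \<le> f n" "f (Suc N) \<ge> 0" "f (Suc M) \<ge> 0"
  shows "(\<Sum>k\<in>{M<..N}. a k * f k) \<le> C * (M * f (Suc M) + (\<Sum>n\<in>{M<..N}. f n))"
proof -
  have "(\<Sum>k\<in>{M<..N}. a k * f k) \<le> C * N * f (Suc N) - 0
           + (\<Sum>n\<in>{M<..N}. (C * n) * (f n - f (Suc n)))"
  proof (subst abel_summation[OF \<open>M \<le> N\<close>], rule add_mono[OF diff_mono sum_mono])
    show "(\<Sum>k\<le>N. a k) * f (Suc N) \<le> C * N * f (Suc N)"
      using A f(2) by (rule mult_right_mono)
    show "0 \<le> (\<Sum>k\<le>M. a k) * f (Suc M)"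
      using A0 f(3) by (rule mult_nonneg_nonneg)
    show "(\<Sum>k\<le>n. a k) * (f n - f (Suc n)) \<le> (C * n) * (f n - f (Suc n))" if "n \<in> {M<..N}" for n
      using f(1)[of n] that by (intro mult_right_mono A) auto
  qed
  also have "\<dots> = C * (N * f (Suc N) + (\<Sum>n\<in>{M<..N}. n * (f n - f (Suc n))))"
    by (simp add: distrib_left sum_distrib_left mult.assoc)
  also have "N * f (Suc N) + (\<Sum>n\<in>{M<..N}. n * (f n - f (Suc n))) = M * f (Suc M) + (\<Sum>n\<in>{M<..N}. f n)"
  proof -
    have c: "(\<Sum>k\<le>n. if k = 0 then 0 else 1 :: real) = n" for n :: nat
      by (induction n) auto
    have "(\<Sum>n\<in>{M<..N}. f n) = (\<Sum>n\<in>{M<..N}. (if n = 0 then 0 else 1) * f n)"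
      by (intro sum.cong) auto
    also have "\<dots> = N * f (Suc N) - M * f (Suc M) + (\<Sum>n\<in>{M<..N}. n * (f n - f (Suc n)))"
      by (subst abel_summation[OF \<open>M \<le> N\<close>]) (simp only: c)
    finally show ?thesis by simp
  qed
  finally show ?thesis .
qed

text \<open>Summing \<open>ln n = \<Sum>\<^bsub>d | n\<^esub> \<Lambda>(d)\<close> over \<open>n \<le> N\<close> counts each \<open>d\<close> once per multiple. This identity is
  the common source of Chebyshev's and Mertens' estimates.\<close>

lemma ln_fact_eq_sum_mangoldt:
  "ln (fact N) = (\<Sum>d=1..N. mangoldt d * real (N div d))"
proof (induction N)
  case 0
  then show ?case by simp
next
  case (Suc N)
  have "(\<Sum>d=1..Suc N. mangoldt d * real (Suc N div d))
      = (\<Sum>d=1..Suc N. mangoldt d * real (N div d) + (if d dvd Suc N then mangoldt d else 0))"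
    by (intro sum.cong) (auto simp: div_Suc dvd_eq_mod_eq_0 algebra_simps)
  also have "\<dots> = (\<Sum>d=1..N. mangoldt d * real (N div d)) + (\<Sum>d\<in>{d\<in>{1..Suc N}. d dvd Suc N}. mangoldt d)"
    by (subst sum.inter_filter) (simp_all add: sum.distrib)
  also have "{d\<in>{1..Suc N}. d dvd Suc N} = {d. d dvd Suc N}"
    by (auto dest: dvd_imp_le intro: Nat.gr0I simp: Suc_le_eq)
  also have "(\<Sum>d\<in>{d. d dvd Suc N}. mangoldt d) = ln (real (Suc N))"
    using mangoldt_sum[of "Suc N", where 'a = real] by simp
  finally show ?case
    using Suc by (simp add: ln_mult)
qed

text \<open>Chebyshev's argument: the identity for \<open>ln (2N)! - 2 ln N!\<close> has nonnegative coefficients, equal to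
  one for \<open>N < d \<le> 2N\<close>, while the left-hand side is the logarithm of a binomial coefficient.\<close>

lemma sum_mangoldt_double:
  "(\<Sum>d=1..2*N. mangoldt d :: real) \<le> (\<Sum>d=1..N. mangoldt d) + 2 * N * ln 2"
proof -
  have dm: "2 * (N div d) \<le> 2 * N div d" for d :: nat
    by (metis div_mult1_eq le_add1)
  have "(\<Sum>d=1..2*N. mangoldt d :: real) - (\<Sum>d=1..N. mangoldt d) = (\<Sum>d\<in>{N<..2*N}. mangoldt d)"
    by (subst sum_diff[symmetric]) (auto intro!: sum.cong)
  also have "\<dots> \<le> (\<Sum>d\<in>{N<..2*N}. mangoldt d * (real (2 * N div d) - 2 * real (N div d)))"
  proof (intro sum_mono)
    fix d assume d: "d \<in> {N<..2*N}"
    have "2 * N div d \<ge> 1" using d by (simp add: Suc_le_eq div_greater_zero_iff)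
    then show "(mangoldt d :: real) \<le> mangoldt d * (real (2 * N div d) - 2 * real (N div d))"
      using d mangoldt_nonneg[of d] by (simp add: mult_le_cancel_left1)
  qed
  also have "\<dots> \<le> (\<Sum>d=1..2*N. mangoldt d * (real (2 * N div d) - 2 * real (N div d)))"
  proof (intro sum_mono2)
    fix d assume "d \<in> {1..2*N} - {N<..2*N}"
    have "real (2 * (N div d)) \<le> real (2 * N div d)"
      using dm by (intro of_nat_mono)
    then show "(0::real) \<le> mangoldt d * (real (2 * N div d) - 2 * real (N div d))"
      by (intro mult_nonneg_nonneg mangoldt_nonneg) simp
  qed auto
  also have "\<dots> = ln (fact (2 * N)) - 2 * (\<Sum>d=1..2*N. mangoldt d * real (N div d))"
    by (simp add: ln_fact_eq_sum_mangoldt right_diff_distrib sum_subtractf sum_distrib_left algebra_simps)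
  also have "(\<Sum>d=1..2*N. mangoldt d * real (N div d)) = (\<Sum>d=1..N. mangoldt d * real (N div d))"
    by (intro sum.mono_neutral_right) auto
  also have "\<dots> = ln (fact N)"
    by (simp add: ln_fact_eq_sum_mangoldt)
  also have "ln (fact (2 * N)) - 2 * ln (fact N) = ln (real (2 * N choose N))"
    by (simp add: binomial_fact ln_div ln_mult)
  also have "\<dots> \<le> ln (2 ^ (2 * N))"
  proof -
    have "2 * N choose N \<le> 2 ^ (2 * N)" by (rule binomial_le_pow2)
    then have "real (2 * N choose N) \<le> 2 ^ (2 * N)"
      by (metis of_nat_le_iff of_nat_numeral of_nat_power)
    then show ?thesis by (subst ln_le_cancel_iff) auto
  qed
  finally show ?thesis by (simp add: ln_realpow)
qed

lemma sum_mangoldt_le: "(\<Sum>d=1..n. mangoldt d :: real) \<le> 6 * n"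
proof (induction n rule: less_induct)
  case (less n)
  show ?case
  proof (cases "n \<le> 1")
    case True
    then have "n = 0 \<or> n = 1" by auto
    then show ?thesis by auto
  next
    case False
    define M where "M = (n + 1) div 2"
    have M: "n \<le> 2 * M" "2 * M \<le> n + 1" "M < n" using False by (auto simp: M_def)
    have M': "2 * real M \<le> n + 1" using M(2) by linarith
    have ln2: "ln 2 \<le> (1::real)" using ln_le_minus_one[of "2::real"] by simp
    have "(\<Sum>d=1..n. mangoldt d :: real) \<le> (\<Sum>d=1..2*M. mangoldt d)"
      using M by (intro sum_mono2 mangoldt_nonneg) auto
    also have "\<dots> \<le> 6 * real M + 2 * real M * ln 2"
      using sum_mangoldt_double[of M] less[OF M(3)] by linarith
    also have "\<dots> \<le> 6 * real M + 2 * real M * 1"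
      using ln2 by (intro add_left_mono mult_left_mono) auto
    also have "\<dots> \<le> 6 * n"
      using M' False by linarith
    finally show ?thesis .
  qed
qed

lemma ln_fact_bounds: "ln (fact N) \<le> N * ln N" "ln (fact N) \<ge> N * ln N - N"
proof -
  show "ln (fact N) \<le> N * ln N"
  proof (cases "N = 0")
    case False
    have "fact N \<le> real N ^ N" using fact_le_power[of N, where 'a = real] by simp
    then have "ln (fact N) \<le> ln (real N ^ N)" using False by (subst ln_le_cancel_iff) auto
    then show ?thesis using False by (simp add: ln_realpow)
  qed auto
  show "ln (fact N) \<ge> N * ln N - N"
  proof (induction N)
    case (Suc N)
    have "N * (ln (Suc N) - ln N) \<le> 1"
    proof (cases "N = 0")
      case False
      have "ln (Suc N) - ln N = ln (1 + 1 / N)"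
        using False by (subst ln_divide_pos[symmetric]) (auto simp: field_simps)
      also have "\<dots> \<le> 1 / N" by (rule ln_add_one_self_le_self) auto
      finally show ?thesis using False by (simp add: field_simps)
    qed auto
    moreover have "ln (fact (Suc N)) = ln (real (Suc N)) + ln (fact N)"
      by (simp only: fact_Suc of_nat_mult) (simp add: ln_mult)
    ultimately show ?case using Suc by (simp add: algebra_simps)
  qed auto
qed

text \<open>Replacing \<open>\<lfloor>N/d\<rfloor>\<close> by \<open>N/d\<close> in the formula for \<open>ln N!\<close> costs at most the Chebyshev sum, which
  is \<open>O(N)\<close>; Stirling's leading terms then give the value.\<close>

lemma mertens_first_mangoldt:
  assumes "N \<ge> 1"
  shows "\<bar>(\<Sum>d=1..N. mangoldt d / d) - ln (real N)\<bar> \<le> 6"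
proof -
  let ?S = "\<Sum>d=1..N. mangoldt d / d :: real"
  have up: "ln (fact N) \<le> N * ?S"
    unfolding ln_fact_eq_sum_mangoldt sum_distrib_left
  proof (intro sum_mono)
    fix d assume "d \<in> {1..N}"
    have "real (N div d) \<le> real N / real d" by (rule of_nat_div_le_of_nat)
    then have "mangoldt d * real (N div d) \<le> mangoldt d * (real N / real d)"
      by (intro mult_left_mono mangoldt_nonneg)
    then show "mangoldt d * real (N div d) \<le> real N * (mangoldt d / d)"
      by (simp add: mult.commute)
  qed
  have "N * ?S \<le> ln (fact N) + (\<Sum>d=1..N. mangoldt d)"
    unfolding ln_fact_eq_sum_mangoldt sum_distrib_left sum.distrib[symmetric]
  proof (intro sum_mono)
    fix d assume "d \<in> {1..N}"
    have "real N / real d \<le> real (N div d) + 1"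
      using floor_divide_of_nat_eq[of N d, where ?'a = real] by linarith
    then have "mangoldt d * (real N / real d) \<le> mangoldt d * (real (N div d) + 1)"
      by (intro mult_left_mono mangoldt_nonneg)
    then show "real N * (mangoldt d / d) \<le> mangoldt d * real (N div d) + mangoldt d"
      by (simp add: algebra_simps)
  qed
  then have "N * ?S \<le> N * (ln N + 6)"
    using sum_mangoldt_le[of N] ln_fact_bounds(1)[of N] by (simp add: algebra_simps)
  moreover have "N * (ln N - 1) \<le> N * ?S"
    using up ln_fact_bounds(2)[of N] by (simp add: algebra_simps)
  ultimately have "?S \<le> ln N + 6" "ln N - 1 \<le> ?S"
    using assms by (simp_all add: mult_le_cancel_left)
  then show ?thesis by linarith
qed


lemma chebyshev_theta_le: "(\<Sum>k\<le>n. if prime k then ln (real k) else 0) \<le> 6 * real n"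
proof -
  have "(\<Sum>k\<le>n. if prime k then ln (real k) else 0) = (\<Sum>k=1..n. if prime k then ln (real k) else 0)"
    by (intro sum.mono_neutral_right) (auto simp: Suc_le_eq)
  also have "\<dots> \<le> (\<Sum>k=1..n. mangoldt k)"
    by (intro sum_mono) (auto simp: mangoldt_nonneg)
  finally show ?thesis
    using sum_mangoldt_le[of n] by linarith
qed

text \<open>Comparison with the telescoping sum of \<open>2/\<surd>(n-1) - 2/\<surd>n\<close>.\<close>

lemma sum_inverse_three_halves_le:
  assumes "1 \<le> M" "M \<le> N"
  shows "(\<Sum>n\<in>{M<..N}. 1 / (real n * sqrt (real n))) \<le> 2 / sqrt (real M) - 2 / sqrt (real N)"
  using assms(2)
proof (induction N rule: dec_induct)
  case base
  then show ?case by simp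
next
  case (step N)
  define a b where "a = sqrt (real N)" and "b = sqrt (real (Suc N))"
  have ab: "0 < a" "a \<le> b" "b * b - a * a = 1" "real (Suc N) = b * b"
    using step assms by (auto simp: a_def b_def)
  have "(b - a) * (a + b) = 1" using ab(3) by (simp add: algebra_simps)
  then have ba: "b - a = 1 / (a + b)"
    using ab(1,2) by (simp add: eq_divide_eq)
  have "2 / a - 2 / b = 2 * (b - a) / (a * b)"
    using ab(1,2) by (simp add: diff_frac_eq right_diff_distrib)
  also have "\<dots> = 2 / (a * b * (a + b))"
    unfolding ba using ab(1,2) by simp
  finally have *: "2 / a - 2 / b = 2 / (a * b * (a + b))" .
  have "2 / a - 2 / b \<ge> 2 / (b * b * (b + b))"
    unfolding * using ab(1,2) by (intro divide_left_mono mult_mono) (auto intro!: mult_pos_pos)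
  also have "2 / (b * b * (b + b)) = 1 / (real (Suc N) * b)"
    unfolding ab(4) by (simp add: field_simps)
  finally have "1 / (real (Suc N) * b) \<le> 2 / a - 2 / b" .
  moreover have "{M<..Suc N} = insert (Suc N) {M<..N}"
    using step by auto
  ultimately show ?case
    using step.IH unfolding a_def b_def by simp
qed

lemma sum_inverse_squares_le:
  assumes "1 \<le> M" "M \<le> N"
  shows "(\<Sum>n\<in>{M<..N}. 1 / (real n)^2) \<le> 1 / real M - 1 / real N"
  using assms(2)
proof (induction N rule: dec_induct)
  case base
  then show ?case by simp
next
  case (step N)
  have "1 / (real (Suc N))^2 \<le> 1 / (real N * real (Suc N))"
    unfolding power2_eq_square using step assms by (intro divide_left_mono mult_right_mono) auto
  also have "\<dots> = 1 / real N - 1 / real (Suc N)"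
    using step assms by (simp add: field_simps)
  finally have "1 / (real (Suc N))^2 \<le> 1 / real N - 1 / real (Suc N)" .
  moreover have "{M<..Suc N} = insert (Suc N) {M<..N}"
    using step by auto
  ultimately show ?case
    using step.IH by simp
qed

lemma ln_le_two_sqrt: "x > 0 \<Longrightarrow> ln x \<le> 2 * sqrt x"
  using ln_le_minus_one[of "sqrt x"] by (simp add: ln_sqrt)

text \<open>This is the total error made at the primes below the cutoff. The weighted sum
  \<open>\<Sum> ln p \<cdot> ln (N/p)\<close> is \<open>O(N)\<close>, because against Chebyshev's bound it compares with
  \<open>\<Sum> ln (N/n) = N ln N - ln N!\<close>; removing the weight \<open>ln p\<close> gains the factor \<open>1 / ln N\<close>.\<close>

lemma sum_primes_one_plus_ln_le:
  assumes "N \<ge> 2"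
  shows "(\<Sum>p | prime p \<and> p \<le> N. 1 + ln (real N / real p)) \<le> 42 * real N / ln (real N)"
proof -
  let ?P = "{p. prime p \<and> p \<le> N}"
  let ?w = "\<lambda>p. 1 + ln (real N / real p)"
  let ?L = "ln (real N)"
  have fin: "finite ?P" by simp
  have L: "?L > 0" using assms by simp
  have lnN: "?L \<le> 4 * sqrt (sqrt N)" "?L \<le> 2 * sqrt N"
    using ln_le_two_sqrt[of "sqrt N"] ln_le_two_sqrt[of N] assms by (auto simp: ln_sqrt)
  have "?L * ?L \<le> (4 * sqrt (sqrt N)) * (4 * sqrt (sqrt N))"
    using lnN(1) L by (intro mult_mono) auto
  then have sq: "(1 + ?L) * ?L \<le> 18 * sqrt N"
    using lnN(2) by (simp add: algebra_simps flip: power2_eq_square)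
  have w: "0 \<le> ln (real N / real p)" "ln (real N / real p) \<le> ?L" if "p \<in> ?P" for p
    using that prime_gt_0_nat[of p] by (auto simp: ln_div)
  \<comment> \<open>Below \<open>\<surd>N\<close> the trivial bound suffices; above it \<open>1 \<le> 2 ln p / ln N\<close> brings in the weight \<open>ln p\<close>.\<close>
  have pw: "?w p \<le> (if real p \<le> sqrt N then 1 + ?L else 0) + 2 / ?L * (ln p * ?w p)" if "p \<in> ?P" for p
  proof (cases "real p \<le> sqrt N")
    case True
    then show ?thesis
      using w[OF that] that L prime_gt_0_nat[of p] by (auto intro!: add_increasing2 mult_nonneg_nonneg)
  next
    case False
    then have "ln (sqrt N) \<le> ln p"
      using assms that by (subst ln_le_cancel_iff) (auto dest: prime_gt_0_nat)
    then have "1 \<le> 2 / ?L * ln p"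
      using assms L by (simp add: ln_sqrt field_simps)
    then have "1 * ?w p \<le> (2 / ?L * ln p) * ?w p"
      using w[OF that] by (intro mult_right_mono) auto
    then show ?thesis using False by simp
  qed
  have small: "(\<Sum>p\<in>?P. if real p \<le> sqrt N then 1 + ?L else 0) \<le> sqrt N * (1 + ?L)"
  proof -
    have "(\<Sum>p\<in>?P. if real p \<le> sqrt N then 1 + ?L else 0) = (\<Sum>p\<in>{p\<in>?P. real p \<le> sqrt N}. 1 + ?L)"
      using fin by (rule sum.inter_filter[symmetric])
    also have "\<dots> = real (card {p\<in>?P. real p \<le> sqrt N}) * (1 + ?L)"
      by simp
    also have "card {p\<in>?P. real p \<le> sqrt N} \<le> card {1..nat \<lfloor>sqrt N\<rfloor>}"
      by (intro card_mono) (auto simp: le_nat_floor Suc_le_eq prime_gt_0_nat)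
    then have "real (card {p\<in>?P. real p \<le> sqrt N}) \<le> real (nat \<lfloor>sqrt N\<rfloor>)"
      by (simp only: of_nat_le_iff card_atLeastAtMost diff_Suc_1)
    also have "\<dots> \<le> sqrt N"
      by (intro of_nat_floor) simp
    finally show ?thesis
      using L by (simp add: mult_right_mono)
  qed
  have large: "(\<Sum>p\<in>?P. ln p * ?w p) \<le> 12 * N"
  proof -
    let ?a = "\<lambda>k. if prime k then ln (real k) else 0"
    let ?f = "\<lambda>n. if n \<le> N then ln (real N / real n) else 0"
    have "(\<Sum>p\<in>?P. ln p * ln (N / p)) = (\<Sum>k\<in>{0<..N}. ?a k * ?f k)"
      by (rule sum.mono_neutral_cong_left) (auto simp: prime_gt_0_nat)
    also have "\<dots> \<le> 6 * (real 0 * ?f (Suc 0) + (\<Sum>n\<in>{0<..N}. ?f n))"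
      by (rule sum_le_of_linear_partial_sums)
         (use chebyshev_theta_le in \<open>auto simp: divide_left_mono\<close>)
    also have "(\<Sum>n\<in>{0<..N}. ?f n) = (\<Sum>n\<in>{0<..N}. ln N - ln n)"
      by (intro sum.cong) (auto simp: ln_div)
    also have "\<dots> = N * ln N - ln (fact N)"
    proof -
      have "ln (fact N :: real) = (\<Sum>n\<in>{1..N}. ln (real n))"
        unfolding fact_prod of_nat_prod by (rule ln_prod) auto
      also have "{1..N} = {0<..N}" by auto
      finally show ?thesis by (simp add: sum_subtractf)
    qed
    also have "\<dots> \<le> N"
      using ln_fact_bounds(2)[of N] by linarith
    finally have "(\<Sum>p\<in>?P. ln p * ln (N / p)) \<le> 6 * N" by simp
    moreover have "(\<Sum>p\<in>?P. ln p) \<le> 6 * N"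
    proof -
      have "(\<Sum>p\<in>?P. ln p) = (\<Sum>k\<le>N. ?a k)"
        by (rule sum.mono_neutral_cong_left) auto
      then show ?thesis using chebyshev_theta_le[of N] by linarith
    qed
    ultimately show ?thesis
      by (simp add: distrib_left sum.distrib)
  qed
  have "(\<Sum>p\<in>?P. ?w p) \<le> (\<Sum>p\<in>?P. (if real p \<le> sqrt N then 1 + ?L else 0) + 2 / ?L * (ln p * ?w p))"
    by (intro sum_mono pw)
  also have "\<dots> \<le> sqrt N * (1 + ?L) + 2 / ?L * (12 * N)"
    unfolding sum.distrib sum_distrib_left[symmetric]
    using small large L by (intro add_mono mult_left_mono) auto
  also have "sqrt N * (1 + ?L) \<le> 18 * N / ?L"
  proof -
    have "sqrt N * ((1 + ?L) * ?L) \<le> sqrt N * (18 * sqrt N)"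
      using sq by (intro mult_left_mono) auto
    then have "sqrt N * (1 + ?L) * ?L \<le> 18 * (sqrt N * sqrt N)"
      by (simp only: mult.assoc mult.left_commute)
    then show ?thesis using L by (simp add: le_divide_eq)
  qed
  finally show ?thesis by (simp add: field_simps)
qed

lemma sum_primes_inverse_squares_le:
  assumes "N \<ge> 2" "N \<le> N'"
  shows "(\<Sum>p | prime p \<and> N < p \<and> p \<le> N'. 1 / (real p)^2) \<le> 12 / (real N * ln (real N))"
proof -
  let ?P = "{p. prime p \<and> N < p \<and> p \<le> N'}"
  let ?a = "\<lambda>k. if prime k then ln (real k) else 0"
  let ?f = "\<lambda>n. 1 / (real n)^2"
  have L: "ln (real N) > 0" using assms by simp
  have "ln N * (\<Sum>p\<in>?P. ?f p) \<le> (\<Sum>p\<in>?P. ln p * ?f p)"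
    unfolding sum_distrib_left using assms by (intro sum_mono mult_right_mono) auto
  also have "(\<Sum>p\<in>?P. ln p * ?f p) = (\<Sum>k\<in>{N<..N'}. ?a k * ?f k)"
    by (rule sum.mono_neutral_cong_left) auto
  also have "\<dots> \<le> 6 * (real N * ?f (Suc N) + (\<Sum>n\<in>{N<..N'}. ?f n))"
  proof (rule sum_le_of_linear_partial_sums[OF assms(2) chebyshev_theta_le])
    show "0 \<le> (\<Sum>k\<le>N. ?a k)" by (intro sum_nonneg) (auto dest: prime_gt_0_nat)
  qed (auto intro!: divide_left_mono power_mono)
  also have "\<dots> \<le> 6 * (1 / N + 1 / N)"
  proof (intro mult_left_mono add_mono)
    have "real N * ?f (Suc N) \<le> real N * ?f N"
      using assms by (intro mult_left_mono divide_left_mono power_mono) auto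
    then show "real N * ?f (Suc N) \<le> 1 / N"
      using assms by (simp add: power2_eq_square)
    show "(\<Sum>n\<in>{N<..N'}. ?f n) \<le> 1 / N"
      using sum_inverse_squares_le[of N N'] assms by (intro order.trans[OF sum_inverse_squares_le]) auto
  qed auto
  finally show ?thesis
    using L assms by (simp add: field_simps)
qed

text \<open>Passing from prime powers to primes loses only the convergent sum of \<open>ln p / p\<^sup>k\<close> over
  \<open>k \<ge> 2\<close>.\<close>

lemma mertens_first:
  assumes "N \<ge> 1"
  shows "\<bar>(\<Sum>k\<le>N. if prime k then ln (real k) / real k else 0) - ln (real N)\<bar> \<le> 14"
proof -
  let ?a = "\<lambda>k. if prime k then ln (real k) / real k else 0"
  let ?Q = "{d\<in>{1..N}. primepow d \<and> \<not> prime d}"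
  let ?PP = "{p. prime p \<and> p \<le> N} \<times> {2..N}"
  have "(\<Sum>k\<le>N. ?a k) = (\<Sum>k=1..N. ?a k)"
    by (intro sum.mono_neutral_right) (auto simp: Suc_le_eq)
  moreover have "(\<Sum>d=1..N. mangoldt d / d) = (\<Sum>k=1..N. ?a k + (if primepow k \<and> \<not> prime k then mangoldt k / k else 0))"
    by (intro sum.cong) (auto, simp add: mangoldt_def)
  moreover have "\<dots> = (\<Sum>k=1..N. ?a k) + (\<Sum>d\<in>?Q. mangoldt d / d)"
    by (simp only: sum.distrib sum.inter_filter finite_atLeastAtMost)
  moreover have "(\<Sum>d\<in>?Q. mangoldt d / d :: real) \<ge> 0"
    by (intro sum_nonneg) (simp add: mangoldt_nonneg)
  moreover have "(\<Sum>d\<in>?Q. mangoldt d / d :: real) \<le> 8"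
  proof -
    have Q: "?Q \<subseteq> (\<lambda>(p, k). p ^ k) ` ?PP"
    proof
      fix d assume d: "d \<in> ?Q"
      then obtain p k where pk: "prime p" "k > 0" "d = p ^ k"
        by (auto simp: primepow_def)
      have "k \<noteq> 1" using d pk by auto
      have p2: "p \<ge> 2" using pk(1) by (rule prime_ge_2_nat)
      have "k < 2 ^ k" by simp
      also have "2 ^ k \<le> p ^ k" using p2 by (rule power_mono) simp
      finally have "k \<le> N" using d pk by auto
      moreover have "p ^ 1 \<le> p ^ k" using p2 pk(2) by (intro power_increasing) auto
      then have "p \<le> N" using d pk by auto
      ultimately show "d \<in> (\<lambda>(p, k). p ^ k) ` ?PP"
        using pk \<open>k \<noteq> 1\<close> by (auto intro!: image_eqI[of _ _ "(p, k)"])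
    qed
    have geo: "(\<Sum>k=2..N. x ^ k) \<le> 2 * x\<^sup>2" if "0 \<le> x" "x \<le> 1/2" for x :: real
    proof -
      have "(\<Sum>k=2..N. x ^ k) + 2 * x ^ Suc N \<le> 2 * x\<^sup>2" using \<open>N \<ge> 1\<close>
      proof (induction N rule: dec_induct)
        case base
        then show ?case by (simp add: power2_eq_square)
      next
        case (step n)
        have "2 * x * x ^ Suc n \<le> 1 * x ^ Suc n" using that by (intro mult_right_mono) auto
        moreover have "{2..Suc n} = insert (Suc n) {2..n}" using step by auto
        ultimately show ?case using step by simp
      qed
      moreover have "0 \<le> 2 * x ^ Suc N" using that by simp
      ultimately show ?thesis by linarith
    qed
    have "(\<Sum>d\<in>?Q. mangoldt d / d :: real) \<le> (\<Sum>d\<in>(\<lambda>(p, k). p ^ k) ` ?PP. mangoldt d / d)"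
      using Q by (intro sum_mono2) (auto simp: mangoldt_nonneg)
    also have "\<dots> \<le> (\<Sum>x\<in>?PP. ((\<lambda>d. mangoldt d / d) \<circ> (\<lambda>(p, k). p ^ k)) x)"
      by (intro sum_image_le) (auto simp: mangoldt_nonneg)
    also have "\<dots> = (\<Sum>(p, k)\<in>?PP. ln (real p) * (1 / real p) ^ k)"
      by (intro sum.cong) (auto simp: power_divide)
    also have "\<dots> = (\<Sum>p | prime p \<and> p \<le> N. ln (real p) * (\<Sum>k=2..N. (1 / real p) ^ k))"
      by (simp only: sum.cartesian_product[symmetric] sum_distrib_left)
    also have "\<dots> \<le> (\<Sum>p | prime p \<and> p \<le> N. 4 * (1 / (real p * sqrt (real p))))"
    proof (intro sum_mono)
      fix p assume p: "p \<in> {p. prime p \<and> p \<le> N}"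
      then have p2: "p \<ge> 2" by (auto dest: prime_ge_2_nat)
      have "ln (real p) * (\<Sum>k=2..N. (1 / real p) ^ k) \<le> (2 * sqrt (real p)) * (2 * (1 / real p)\<^sup>2)"
        using p2 by (intro mult_mono geo ln_le_two_sqrt sum_nonneg) auto
      also have "(1 / real p)\<^sup>2 = 1 / (real p * (sqrt (real p) * sqrt (real p)))"
        by (simp add: power2_eq_square)
      also have "(2 * sqrt (real p)) * (2 * \<dots>) = 4 * (1 / (real p * sqrt (real p)))"
      proof -
        have "sqrt (real p) > 0" using p2 by simp
        then show ?thesis by (simp add: field_simps del: real_sqrt_mult_self)
      qed
      finally show "ln (real p) * (\<Sum>k=2..N. (1 / real p) ^ k) \<le> 4 * (1 / (real p * sqrt (real p)))" .
    qed
    also have "\<dots> \<le> (\<Sum>n\<in>{1<..N}. 4 * (1 / (real n * sqrt (real n))))"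
      by (intro sum_mono2) (auto dest: prime_gt_1_nat)
    also have "\<dots> \<le> 4 * (2 / sqrt (real 1) - 2 / sqrt N)"
      unfolding sum_distrib_left[symmetric]
      using sum_inverse_three_halves_le[of 1 N] \<open>N \<ge> 1\<close> by (intro mult_left_mono) auto
    also have "\<dots> \<le> 8" by simp
    finally show ?thesis .
  qed
  ultimately show ?thesis
    using mertens_first_mangoldt[OF assms] by linarith
qed


text \<open>With \<open>u = ln n\<close> and \<open>v = ln (n + 1)\<close> all error terms of the partial summation are
  bounded by multiples of \<open>1/u - 1/v\<close>, which telescopes to a tail of size \<open>1 / ln N\<close>.\<close>

lemma ln_Suc_bounds:
  assumes "n \<ge> 2"
  shows "0 < ln (real n)" "ln (real n) < ln (real (Suc n))" "ln (real (Suc n)) - ln (real n) \<le> 1"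
    "ln (real (Suc n)) \<le> 2 * ln (real n)"
proof -
  show pos: "0 < ln (real n)" "ln (real n) < ln (real (Suc n))" using assms by auto
  have "ln (real (Suc n)) - ln (real n) = ln (1 + 1 / real n)"
    using assms by (subst ln_divide_pos[symmetric]) (auto simp: field_simps)
  also have "\<dots> \<le> 1 / real n" by (rule ln_add_one_self_le_self) auto
  also have "\<dots> \<le> 1" using assms by simp
  finally show "ln (real (Suc n)) - ln (real n) \<le> 1" .
  have "Suc n \<le> n * n" using assms mult_le_mono1[of 2 n n] by linarith
  then have "real (Suc n) \<le> real n * real n" by (metis of_nat_le_iff of_nat_mult)
  then have "ln (real (Suc n)) \<le> ln (real n * real n)" using assms by (subst ln_le_cancel_iff) auto
  then show "ln (real (Suc n)) \<le> 2 * ln (real n)" using assms by (simp add: ln_mult)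
qed

text \<open>Partial summation of \<open>1/p = (ln p / p) \<cdot> (1 / ln p)\<close> against Mertens' first theorem. The main
  part of each summand is \<open>ln ln (n + 1) - ln ln n\<close>, so the constant \<open>c\<close> is explicit up to the
  convergent series of the remainders \<open>e n\<close>.\<close>

lemma mertens_second_nat:
  "\<exists>c C. \<forall>N\<ge>2. \<bar>(\<Sum>p | prime p \<and> p \<le> N. 1 / real p) - ln (ln (real (Suc N))) - c\<bar> \<le> C / ln (real (Suc N))"
proof -
  define a where "a = (\<lambda>k. if prime k then ln (real k) / real k else 0)"
  define A where "A = (\<lambda>n. \<Sum>k\<le>n. a k)"
  define L where "L = (\<lambda>n. ln (real n))"
  define t where "t = (\<lambda>n. 1 / L n - 1 / L (Suc n))"
  define e where "e = (\<lambda>n. A n * t n - (ln (L (Suc n)) - ln (L n)))"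
  have A: "\<bar>A n - L n\<bar> \<le> 14" if "n \<ge> 2" for n
    using mertens_first[of n] that by (simp add: A_def a_def L_def)
  have Lp: "0 < L n" "L n < L (Suc n)" "L (Suc n) - L n \<le> 1" if "n \<ge> 2" for n
    using ln_Suc_bounds[OF that] by (auto simp: L_def)
  have t0: "0 \<le> t n" if "n \<ge> 2" for n
    using Lp[OF that] by (auto simp: t_def intro!: divide_left_mono)
  have e: "\<bar>e n\<bar> \<le> 15 * t n" if n: "n \<ge> 2" for n
  proof -
    define u v where "u = L n" and "v = L (Suc n)"
    have uv: "0 < u" "u < v" "v - u \<le> 1" using Lp[OF n] by (auto simp: u_def v_def)
    have tn: "t n = 1 / u - 1 / v" by (simp add: t_def u_def v_def)
    have "e n = (A n - u) * t n + ((v - u) / v - ln (v / u))"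
      using uv by (simp add: e_def tn ln_divide_pos field_simps flip: u_def v_def)
    moreover have "\<bar>(A n - u) * t n\<bar> \<le> 14 * t n"
      unfolding abs_mult using A[OF n] t0[OF n] by (auto simp: u_def intro: mult_right_mono)
    moreover have "ln (v / u) \<le> v / u - 1" using uv by (intro ln_le_minus_one) auto
    moreover have "ln (u / v) \<le> u / v - 1" using uv by (intro ln_le_minus_one) auto
    then have "(v - u) / v - ln (v / u) \<le> 0" using uv by (simp add: ln_divide_pos diff_divide_distrib)
    moreover have "(v / u - 1) - (v - u) / v \<le> t n"
    proof -
      have "(v / u - 1) - (v - u) / v = (v - u) * t n" using uv by (simp add: tn field_simps)
      also have "\<dots> \<le> 1 * t n" using uv t0[OF n] by (intro mult_right_mono) auto
      finally show ?thesis by simp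
    qed
    ultimately show ?thesis by linarith
  qed
  have tsum: "(\<lambda>k. t (k + N)) sums (1 / L N)" for N
  proof -
    have "(\<lambda>k. 1 / L (k + N)) \<longlonglongrightarrow> 0"
      unfolding L_def by real_asymp
    then have "(\<lambda>k. 1 / L (k + N) - 1 / L (Suc k + N)) sums (1 / L (0 + N) - 0)"
      by (rule telescope_sums')
    then show ?thesis by (simp add: t_def)
  qed
  have esum: "summable (\<lambda>k. e (k + N))" if "N \<ge> 2" for N
    by (rule summable_comparison_test'[OF summable_mult[OF sums_summable[OF tsum[of N]], of 15]])
       (use e that in auto)
  have etail: "\<bar>\<Sum>k. e (k + N)\<bar> \<le> 15 / L N" if "N \<ge> 2" for N
  proof -
    have s: "summable (\<lambda>k. 15 * t (k + N))"
      by (intro summable_mult sums_summable[OF tsum])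
    have s': "summable (\<lambda>k. \<bar>e (k + N)\<bar>)"
      by (rule summable_comparison_test'[OF s]) (use e that in auto)
    have "\<bar>\<Sum>k. e (k + N)\<bar> \<le> (\<Sum>k. \<bar>e (k + N)\<bar>)"
      by (rule summable_rabs[OF s'])
    also have "\<dots> \<le> (\<Sum>k. 15 * t (k + N))"
      by (rule suminf_le[OF _ s' s]) (use e that in auto)
    also have "\<dots> = 15 * (1 / L N)"
      using sums_unique[OF sums_mult[OF tsum[of N], of 15]] by simp
    finally show ?thesis by simp
  qed
  define c where "c = 1 - ln (L 2) + (\<Sum>k. e (k + 2))"
  have "\<bar>(\<Sum>p | prime p \<and> p \<le> N. 1 / real p) - ln (L (Suc N)) - c\<bar> \<le> 30 / L (Suc N)"
    if N: "N \<ge> 2" for N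
  proof -
    have LS: "L (Suc N) > 0" using Lp[of "Suc N"] N by simp
    have A1: "A (Suc 0) = 0" by (simp add: A_def a_def)
    have "ln (real p) \<noteq> 0" if "prime p" for p :: nat
      using prime_gt_1_nat[OF that] by simp
    then have "(\<Sum>p | prime p \<and> p \<le> N. 1 / real p) = (\<Sum>k\<in>{1<..N}. a k * (1 / L k))"
      by (intro sum.mono_neutral_cong_left) (auto simp: a_def L_def prime_gt_Suc_0_nat)
    also have "\<dots> = A N * (1 / L (Suc N)) - A 1 * (1 / L (Suc 1)) + (\<Sum>n\<in>{1<..N}. A n * t n)"
      unfolding A_def t_def using N by (intro abel_summation) simp
    also have "{1<..N} = {2..N}" by auto
    also have "(\<Sum>n\<in>{2..N}. A n * t n) = (\<Sum>n\<in>{2..N}. e n) + (\<Sum>n\<in>{2..N}. ln (L (Suc n)) - ln (L n))"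
      by (simp add: e_def flip: sum.distrib)
    also have "(\<Sum>n\<in>{2..N}. ln (L (Suc n)) - ln (L n)) = ln (L (Suc N)) - ln (L 2)"
      using N by (intro sum_Suc_diff) simp
    also have "(\<Sum>n\<in>{2..N}. e n) = (\<Sum>k. e (k + 2)) - (\<Sum>k. e (k + Suc N))"
    proof -
      have "(\<Sum>k. e (k + 2)) = (\<Sum>k. e (k + (N - 1) + 2)) + (\<Sum>k<N - 1. e (k + 2))"
        using suminf_split_initial_segment[OF esum[of 2], of "N - 1"] by simp
      moreover have "k + (N - 1) + 2 = k + Suc N" for k using N by simp
      moreover have "(\<Sum>k<N - 1. e (k + 2)) = (\<Sum>n\<in>{2..N}. e n)"
        using N by (intro sum.reindex_bij_witness[of _ "\<lambda>n. n - 2" "\<lambda>k. k + 2"]) auto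
      ultimately show ?thesis by simp
    qed
    finally have "(\<Sum>p | prime p \<and> p \<le> N. 1 / real p) - ln (L (Suc N)) - c
        = (A N / L (Suc N) - 1) - (\<Sum>k. e (k + Suc N))"
      by (simp add: c_def A1)
    moreover have "\<bar>A N / L (Suc N) - 1\<bar> \<le> 15 / L (Suc N)"
    proof -
      have "\<bar>A N - L (Suc N)\<bar> \<le> 15" using A[OF N] Lp[OF N] by linarith
      then have "\<bar>(A N - L (Suc N)) / L (Suc N)\<bar> \<le> 15 / L (Suc N)"
        using LS by (simp add: divide_right_mono)
      then show ?thesis using LS by (simp add: diff_divide_distrib)
    qed
    ultimately show ?thesis using etail[of "Suc N"] N by simp
  qed
  then show ?thesis unfolding L_def by blast
qed

text \<open>The defining description of the constant determines it, because \<open>C / ln x\<close> tends to zero;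
  existence passes from integers to real \<open>x\<close> since \<open>ln ln\<close> varies by at most \<open>1 / ln x\<close> between
  consecutive integers.\<close>

lemma mertens_const_spec:
  "\<exists>C. \<forall>x\<ge>2. \<bar>(\<Sum>p | prime p \<and> real p \<le> x. 1 / real p) - ln (ln x) - mertens_const\<bar> \<le> C / ln x"
proof -
  obtain c C where C: "\<And>N. N \<ge> 2 \<Longrightarrow>
      \<bar>(\<Sum>p | prime p \<and> p \<le> N. 1 / real p) - ln (ln (real (Suc N))) - c\<bar> \<le> C / ln (real (Suc N))"
    using mertens_second_nat by blast
  let ?S = "\<lambda>x. \<Sum>p | prime p \<and> real p \<le> x. 1 / real p"
  have ex: "\<bar>?S x - ln (ln x) - c\<bar> \<le> (\<bar>C\<bar> + 2) / ln x" if x: "x \<ge> 2" for x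
  proof -
    define N where "N = nat \<lfloor>x\<rfloor>"
    have N: "N \<ge> 2" "real N \<le> x" "x \<le> real (Suc N)" "\<And>p. real p \<le> x \<longleftrightarrow> p \<le> N"
      using x by (auto simp: N_def le_nat_floor le_nat_iff le_floor_iff) linarith+
    define u v where "u = ln (real N)" and "v = ln (real (Suc N))"
    have uv: "0 < u" "u < v" "v - u \<le> 1" "v \<le> 2 * u"
      using ln_Suc_bounds[OF N(1)] by (auto simp: u_def v_def)
    have y: "u \<le> ln x" "ln x \<le> v"
      using N x by (auto simp: u_def v_def intro!: ln_le_cancel_iff[THEN iffD2])
    have "ln (v / ln x) \<le> v / ln x - 1" using uv y by (intro ln_le_minus_one) auto
    also have "\<dots> = (v - ln x) / ln x" using uv y by (simp add: diff_divide_distrib)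
    also have "\<dots> \<le> 1 / ln x" using uv y by (intro divide_right_mono) auto
    finally have "ln v - ln (ln x) \<le> 1 / ln x" "0 \<le> ln v - ln (ln x)"
      using uv y by (auto simp: ln_divide_pos)
    moreover have "\<bar>?S x - ln v - c\<bar> \<le> C / v"
      using C[OF N(1)] by (simp add: v_def N(4))
    moreover have "C / v \<le> \<bar>C\<bar> / ln x"
    proof -
      have "C / v \<le> \<bar>C\<bar> / v" using uv by (intro divide_right_mono) auto
      also have "\<dots> \<le> \<bar>C\<bar> / ln x" using uv y by (intro divide_left_mono) auto
      finally show ?thesis .
    qed
    moreover have "1 / ln x > 0" using uv y by auto
    ultimately show ?thesis unfolding add_divide_distrib by linarith
  qed
  show ?thesis
    unfolding mertens_const_def
  proof (rule theI2[where a = c])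
    show "\<exists>C. \<forall>x\<ge>2. \<bar>?S x - ln (ln x) - c\<bar> \<le> C / ln x"
      using ex by blast
  next
    fix c' assume "\<exists>C. \<forall>x\<ge>2. \<bar>?S x - ln (ln x) - c'\<bar> \<le> C / ln x"
    then obtain C' where C': "\<And>x. x \<ge> 2 \<Longrightarrow> \<bar>?S x - ln (ln x) - c'\<bar> \<le> C' / ln x"
      by blast
    have "\<bar>c' - c\<bar> \<le> (\<bar>C\<bar> + 2 + C') / ln x" if "x \<ge> 2" for x
      using ex[OF that] C'[OF that] unfolding add_divide_distrib by linarith
    then have "eventually (\<lambda>x. \<bar>c' - c\<bar> \<le> (\<bar>C\<bar> + 2 + C') / ln x) at_top"
      by (auto simp: eventually_at_top_linorder)
    moreover have "((\<lambda>x. (\<bar>C\<bar> + 2 + C') / ln x) \<longlongrightarrow> 0) at_top"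
      by real_asymp
    ultimately have "\<bar>c' - c\<bar> \<le> 0"
      by (intro tendsto_lowerbound) auto
    then show "c' = c" by simp
  qed
qed



section \<open>Diagonalising the symmetric powers\<close>

text \<open>The value at \<open>(u, v)\<close> of the binary form of degree \<open>n\<close> whose dehomogenisation is \<open>p\<close>. Taking
  for \<open>u\<close> and \<open>v\<close> the linear polynomials given by the columns of a matrix, this is the action of the
  matrix on the \<open>n\<close>-th symmetric power.\<close>

definition hom_eval :: "nat \<Rightarrow> complex poly \<Rightarrow> complex poly \<Rightarrow> complex poly \<Rightarrow> complex poly" where
  "hom_eval n p u v = (\<Sum>i\<le>n. smult (coeff p i) (u ^ (n - i) * v ^ i))"

lemma hom_eval_linear_mult:
  assumes "degree p \<le> n"
  shows "hom_eval (Suc n) ([:\<alpha>, \<beta>:] * p) u v = (smult \<alpha> u + smult \<beta> v) * hom_eval n p u v"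
proof -
  have c: "coeff ([:\<alpha>, \<beta>:] * p) i = \<alpha> * coeff p i + (case i of 0 \<Rightarrow> 0 | Suc k \<Rightarrow> \<beta> * coeff p k)" for i
    by (simp add: coeff_pCons split: nat.split)
  have "(\<Sum>i\<le>Suc n. smult (\<alpha> * coeff p i) (u ^ (Suc n - i) * v ^ i))
      = (\<Sum>i\<le>n. smult (\<alpha> * coeff p i) (u ^ (Suc n - i) * v ^ i))"
    using assms by (simp add: coeff_eq_0)
  also have "\<dots> = smult \<alpha> u * hom_eval n p u v"
    unfolding hom_eval_def sum_distrib_left
    by (intro sum.cong) (auto simp: Suc_diff_le mult_ac)
  finally have 1: "(\<Sum>i\<le>Suc n. smult (\<alpha> * coeff p i) (u ^ (Suc n - i) * v ^ i)) = smult \<alpha> u * hom_eval n p u v" .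
  have 2: "(\<Sum>i\<le>Suc n. smult (case i of 0 \<Rightarrow> 0 | Suc k \<Rightarrow> \<beta> * coeff p k) (u ^ (Suc n - i) * v ^ i))
      = smult \<beta> v * hom_eval n p u v"
    unfolding hom_eval_def sum_distrib_left
    by (subst sum.atMost_Suc_shift) (auto intro!: sum.cong simp: mult_ac)
  show ?thesis
    unfolding hom_eval_def[of "Suc n"] c smult_add_left sum.distrib 1 2 by (simp add: distrib_right)
qed

text \<open>Homogeneous evaluation is multiplicative; products of linear forms are all that occurs in the
  columns of \<^const>\<open>sym_rep\<close>.\<close>

lemma hom_eval_power_mult:
  "hom_eval (k + j) ([:\<alpha>, \<beta>:] ^ k * [:\<gamma>, \<delta>:] ^ j) u v
     = (smult \<alpha> u + smult \<beta> v) ^ k * (smult \<gamma> u + smult \<delta> v) ^ j"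
proof -
  have deg: "degree ([:\<alpha>, \<beta>:] ^ k * [:\<gamma>, \<delta>:] ^ j) \<le> k + j" for k j
  proof (rule order.trans[OF degree_mult_le add_mono])
    have "degree ([:x, y:] ^ i) \<le> i" for x y :: complex and i
    proof (rule order.trans[OF degree_power_le])
      have "degree [:x, y:] \<le> 1" by simp
      then show "degree [:x, y:] * i \<le> i" using mult_le_mono1 by fastforce
    qed
    then show "degree ([:\<alpha>, \<beta>:] ^ k) \<le> k" "degree ([:\<gamma>, \<delta>:] ^ j) \<le> j" by auto
  qed
  have base: "hom_eval (0 + j) ([:\<alpha>, \<beta>:] ^ 0 * [:\<gamma>, \<delta>:] ^ j) u v = (smult \<gamma> u + smult \<delta> v) ^ j"
  proof (induction j)
    case 0
    then show ?case by (simp add: hom_eval_def)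
  next
    case (Suc j)
    then show ?case
      using hom_eval_linear_mult[of "[:\<gamma>, \<delta>:] ^ j" j \<gamma> \<delta> u v] deg[of 0 j] by simp
  qed
  show ?thesis
  proof (induction k)
    case 0
    then show ?case using base by simp
  next
    case (Suc k)
    then show ?case
      using hom_eval_linear_mult[of "[:\<alpha>, \<beta>:] ^ k * [:\<gamma>, \<delta>:] ^ j" "k + j" \<alpha> \<beta> u v] deg[of k j]
      by (simp only: add_Suc power_Suc mult.assoc)
  qed
qed

lemma dim_sym_rep [simp]: "dim_row (sym_rep m g) = m + 1" "dim_col (sym_rep m g) = m + 1"
  by (simp_all add: sym_rep_def)

lemma sym_rep_carrier [simp]: "sym_rep m g \<in> carrier_mat (m + 1) (m + 1)"
  by (simp add: sym_rep_def)

lemma sym_rep_index: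
  "i \<le> m \<Longrightarrow> j \<le> m \<Longrightarrow> sym_rep m g $$ (i, j) =
     coeff ([:g $ 1 $ 1, g $ 2 $ 1:] ^ (m - j) * [:g $ 1 $ 2, g $ 2 $ 2:] ^ j) i"
  by (simp add: sym_rep_def)

lemma sym_rep_mult: "sym_rep m (g ** h) = sym_rep m g * sym_rep m h"
proof (rule eq_matI)
  fix i j assume "i < dim_row (sym_rep m g * sym_rep m h)" "j < dim_col (sym_rep m g * sym_rep m h)"
  then have ij: "i \<le> m" "j \<le> m" by auto
  let ?u = "[:g $ 1 $ 1, g $ 2 $ 1:]" and ?v = "[:g $ 1 $ 2, g $ 2 $ 2:]"
  let ?p = "[:h $ 1 $ 1, h $ 2 $ 1:] ^ (m - j) * [:h $ 1 $ 2, h $ 2 $ 2:] ^ j"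
  have "(sym_rep m g * sym_rep m h) $$ (i, j) = (\<Sum>k\<le>m. sym_rep m g $$ (i, k) * sym_rep m h $$ (k, j))"
    using ij by (simp add: scalar_prod_def atLeast0LessThan lessThan_Suc_atMost)
  also have "\<dots> = (\<Sum>k\<le>m. coeff ?p k * coeff (?u ^ (m - k) * ?v ^ k) i)"
    using ij by (intro sum.cong) (auto simp: sym_rep_index mult.commute)
  also have "\<dots> = coeff (hom_eval ((m - j) + j) ?p ?u ?v) i"
    using ij by (simp add: hom_eval_def coeff_sum)
  also have "\<dots> = coeff ((smult (h $ 1 $ 1) ?u + smult (h $ 2 $ 1) ?v) ^ (m - j)
                        * (smult (h $ 1 $ 2) ?u + smult (h $ 2 $ 2) ?v) ^ j) i"
    by (simp only: hom_eval_power_mult)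
  also have "\<dots> = sym_rep m (g ** h) $$ (i, j)"
    using ij by (simp add: sym_rep_index matrix_matrix_mult_def sum_2 mult.commute)
  finally show "sym_rep m (g ** h) $$ (i, j) = (sym_rep m g * sym_rep m h) $$ (i, j)" ..
qed auto

lemma sym_rep_diagonal:
  assumes "g $ 1 $ 2 = 0" "g $ 2 $ 1 = 0" "i \<le> m" "j \<le> m"
  shows "sym_rep m g $$ (i, j) = (if i = j then (g $ 1 $ 1) ^ (m - j) * (g $ 2 $ 2) ^ j else 0)"
proof -
  have "[:0, d:] ^ j = monom (d ^ j) j" for d :: complex
    by (metis monom_0 monom_Suc monom_power power_one_right mult_1 pCons_0_0 One_nat_def)
  moreover have "[:a:] ^ k = [:a ^ k:]" for a :: complex and k
    by (induction k) (auto simp: mult.commute)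
  ultimately show ?thesis
    using assms by (simp add: sym_rep_index)
qed

lemma sym_rep_id: "sym_rep m (Finite_Cartesian_Product.mat 1) = 1\<^sub>m (m + 1)"
  by (rule eq_matI)
     (auto simp: sym_rep_diagonal Finite_Cartesian_Product.mat_def)

text \<open>Conjugation by the invertible matrix \<open>sym_rep m p\<close> turns \<open>1 - X sym_rep m g\<close> into a diagonal
  matrix. The right inverse of \<open>p\<close> ensures that the determinant of \<open>sym_rep m p\<close> is nonzero, so that
  it cancels.\<close>

lemma det_one_minus_sym_rep:
  fixes g p p' d :: "complex^2^2"
  assumes gp: "g ** p = p ** d" and p: "p ** p' = Finite_Cartesian_Product.mat 1"
    and d: "d $ 1 $ 2 = 0" "d $ 2 $ 1 = 0"
  shows "Determinant.det (1\<^sub>m (m + 1) - X \<cdot>\<^sub>m sym_rep m g)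
     = (\<Prod>j\<le>m. 1 - X * ((d $ 1 $ 1) ^ (m - j) * (d $ 2 $ 2) ^ j))"
proof -
  let ?n = "m + 1"
  let ?D = "1\<^sub>m ?n - X \<cdot>\<^sub>m sym_rep m d"
  note [simp del] = sym_rep_carrier
  have C: "sym_rep m g \<in> carrier_mat ?n ?n" for g by (rule sym_rep_carrier)
  have pp: "Determinant.det (sym_rep m p) * Determinant.det (sym_rep m p') = 1"
    using det_mult[OF C[of p] C[of p']] by (simp add: p sym_rep_id flip: sym_rep_mult)
  have "(1\<^sub>m ?n - X \<cdot>\<^sub>m sym_rep m g) * sym_rep m p = sym_rep m p - X \<cdot>\<^sub>m (sym_rep m (g ** p))"
    by (simp only: minus_mult_distrib_mat[OF one_carrier_mat smult_carrier_mat[OF C] C]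
          mult_smult_assoc_mat[OF C C] left_mult_one_mat[OF C] sym_rep_mult)
  also have "\<dots> = sym_rep m p * ?D"
    by (simp only: gp sym_rep_mult mult_minus_distrib_mat[OF C one_carrier_mat smult_carrier_mat[OF C]]
          mult_smult_distrib[OF C C] right_mult_one_mat[OF C])
  finally have "Determinant.det (1\<^sub>m ?n - X \<cdot>\<^sub>m sym_rep m g) * Determinant.det (sym_rep m p)
     = Determinant.det (sym_rep m p) * Determinant.det ?D"
    using det_mult[of "1\<^sub>m ?n - X \<cdot>\<^sub>m sym_rep m g" ?n "sym_rep m p"] det_mult[of "sym_rep m p" ?n ?D] C
    by (metis minus_carrier_mat smult_carrier_mat)
  then have "Determinant.det (1\<^sub>m ?n - X \<cdot>\<^sub>m sym_rep m g) = Determinant.det ?D"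
    using pp by (metis mult.commute mult_cancel_left mult_zero_left zero_neq_one)
  also have "\<dots> = prod_list (diag_mat ?D)"
    by (rule det_upper_triangular[of _ ?n]) (auto simp: sym_rep_diagonal[OF d] C)
  also have "\<dots> = (\<Prod>j\<le>m. 1 - X * ((d $ 1 $ 1) ^ (m - j) * (d $ 2 $ 2) ^ j))"
    by (simp add: prod_list_diag_prod sym_rep_diagonal[OF d] atLeast0LessThan lessThan_Suc_atMost
             del: prod.lessThan_Suc prod.atMost_Suc)
  finally show ?thesis .
qed

lemma character_sym_rep:
  fixes g p p' d :: "complex^2^2"
  assumes gp: "g ** p = p ** d" and p: "p ** p' = Finite_Cartesian_Product.mat 1"
    and d: "d $ 1 $ 2 = 0" "d $ 2 $ 1 = 0"
  shows "character (sym_rep m) g = (\<Sum>j\<le>m. (d $ 1 $ 1) ^ (m - j) * (d $ 2 $ 2) ^ j)"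
proof -
  have p': "p' ** p = Finite_Cartesian_Product.mat 1"
    using p matrix_left_right_inverse by blast
  have mult: "(sym_rep m a * sym_rep m b) $$ (i, i) = (\<Sum>k\<le>m. sym_rep m a $$ (i, k) * sym_rep m b $$ (k, i))"
    if "i \<le> m" for a b i
    using that by (simp add: scalar_prod_def atLeast0LessThan lessThan_Suc_atMost)
  have ch: "character (sym_rep m) a = (\<Sum>i\<le>m. sym_rep m a $$ (i, i))" for a
    by (simp add: character_def lessThan_Suc_atMost)
  have comm: "character (sym_rep m) (a ** b) = character (sym_rep m) (b ** a)" for a b
  proof -
    have "character (sym_rep m) (a ** b) = (\<Sum>i\<le>m. \<Sum>k\<le>m. sym_rep m a $$ (i, k) * sym_rep m b $$ (k, i))"
      unfolding ch sym_rep_mult by (intro sum.cong refl mult) auto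
    also have "\<dots> = (\<Sum>k\<le>m. \<Sum>i\<le>m. sym_rep m b $$ (k, i) * sym_rep m a $$ (i, k))"
      by (subst sum.swap) (simp add: mult.commute)
    also have "\<dots> = character (sym_rep m) (b ** a)"
      unfolding ch sym_rep_mult by (intro sum.cong refl mult[symmetric]) auto
    finally show ?thesis .
  qed
  have "g = (p ** d) ** p'"
    using gp p by (metis matrix_mul_assoc matrix_mul_rid)
  then have "character (sym_rep m) g = character (sym_rep m) (p' ** (p ** d))"
    using comm by metis
  also have "p' ** (p ** d) = d"
    using p' by (metis matrix_mul_assoc matrix_mul_lid)
  finally show ?thesis
    by (simp add: ch sym_rep_diagonal[OF d])
qed


text \<open>The group is the 3-sphere: this is the chart by the first column.\<close>

definition su2 :: "complex \<Rightarrow> complex \<Rightarrow> complex^2^2" where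
  "su2 a c = (\<chi> i j. if i = 1 then (if j = 1 then a else - cnj c) else (if j = 1 then c else cnj a))"

lemma su2_nth [simp]:
  "su2 a c $ 1 $ 1 = a" "su2 a c $ 1 $ 2 = - cnj c" "su2 a c $ 2 $ 1 = c" "su2 a c $ 2 $ 2 = cnj a"
  by (simp_all add: su2_def)

lemma mat2_eqI:
  fixes g h :: "complex^2^2"
  assumes "g $ 1 $ 1 = h $ 1 $ 1" "g $ 1 $ 2 = h $ 1 $ 2" "g $ 2 $ 1 = h $ 2 $ 1" "g $ 2 $ 2 = h $ 2 $ 2"
  shows "g = h"
  using assms by (simp add: Finite_Cartesian_Product.vec_eq_iff forall_2)

lemma su2_in_SU2:
  assumes "(cmod a)\<^sup>2 + (cmod c)\<^sup>2 = 1"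
  shows "su2 a c \<in> SU2"
proof -
  have ac: "a * cnj a + c * cnj c = 1"
    using assms by (metis complex_norm_square of_real_1 of_real_add)
  show ?thesis
    unfolding SU2_def mem_Collect_eq
  proof (intro conjI mat2_eqI)
    show "Determinants.det (su2 a c) = 1"
      using ac by (simp add: det_2 mult.commute)
  qed (use ac in \<open>auto simp: matrix_matrix_mult_def sum_2 Finite_Cartesian_Product.mat_def algebra_simps\<close>)
qed

lemma SU2_eq_su2:
  assumes "g \<in> SU2"
  shows "g = su2 (g $ 1 $ 1) (g $ 2 $ 1)" "(cmod (g $ 1 $ 1))\<^sup>2 + (cmod (g $ 2 $ 1))\<^sup>2 = 1"
proof -
  let ?a = "g $ 1 $ 1" and ?b = "g $ 1 $ 2" and ?c = "g $ 2 $ 1" and ?d = "g $ 2 $ 2"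
  have "g ** (\<chi> i j. cnj (g $ j $ i)) = Finite_Cartesian_Product.mat 1"
    and det: "?a * ?d - ?b * ?c = 1"
    using assms by (auto simp: SU2_def det_2)
  then have "\<forall>i j. (g ** (\<chi> i j. cnj (g $ j $ i))) $ i $ j = (Finite_Cartesian_Product.mat 1 :: complex^2^2) $ i $ j"
    by simp
  then have e: "?a * cnj ?c + ?b * cnj ?d = 0" "?c * cnj ?c + ?d * cnj ?d = 1"
    by (auto simp: matrix_matrix_mult_def sum_2 Finite_Cartesian_Product.mat_def forall_2)
  \<comment> \<open>Both entries of the second column are recovered by multiplying the determinant relation by
    the conjugates of the entries of the second row.\<close>
  have "cnj ?d = cnj ?d * (?a * ?d - ?b * ?c) - ?c * (- (?a * cnj ?c + ?b * cnj ?d)) - 0"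
    using det e(1) by simp
  also have "\<dots> = ?a * (?c * cnj ?c + ?d * cnj ?d)"
    by (simp add: algebra_simps)
  finally have d: "?a = cnj ?d" using e(2) by simp
  have "cnj ?c = cnj ?c * (?a * ?d - ?b * ?c) - ?d * (?a * cnj ?c + ?b * cnj ?d)"
    using det e(1) by simp
  also have "\<dots> = - ?b * (?c * cnj ?c + ?d * cnj ?d)"
    by (simp add: algebra_simps)
  finally have c: "cnj ?c = - ?b" using e(2) by simp
  show "g = su2 ?a ?c"
    using c d by (intro mat2_eqI) auto
  have "complex_of_real ((cmod ?a)\<^sup>2 + (cmod ?c)\<^sup>2) = ?a * cnj ?a + ?c * cnj ?c"
    by (simp only: of_real_add complex_norm_square)
  also have "\<dots> = 1"
    using e(2) by (simp add: d mult.commute add.commute)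
  finally have "complex_of_real ((cmod ?a)\<^sup>2 + (cmod ?c)\<^sup>2) = 1" .
  then show "(cmod ?a)\<^sup>2 + (cmod ?c)\<^sup>2 = 1"
    using of_real_eq_1_iff by blast
qed

lemma SU2_Re_bound: "g \<in> SU2 \<Longrightarrow> \<bar>Re (g $ 1 $ 1)\<bar> \<le> 1"
  using SU2_eq_su2(2)[of g] abs_Re_le_cmod[of "g $ 1 $ 1"] abs_square_le_1[of "cmod (g $ 1 $ 1)"]
  by (smt (verit) norm_ge_zero zero_le_power2)

lemma su2_mult: "su2 a c ** su2 a' c' = su2 (a * a' - cnj c * c') (c * a' + cnj a * c')"
  by (rule mat2_eqI) (auto simp: matrix_matrix_mult_def sum_2 algebra_simps)

lemma SU2_mult_closed: "g \<in> SU2 \<Longrightarrow> h \<in> SU2 \<Longrightarrow> g ** h \<in> SU2"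
proof -
  assume g: "g \<in> SU2" and h: "h \<in> SU2"
  define a c a' c' where "a = g $ 1 $ 1" and "c = g $ 2 $ 1" and "a' = h $ 1 $ 1" and "c' = h $ 2 $ 1"
  have e: "g = su2 a c" "h = su2 a' c'"
    using SU2_eq_su2[OF g] SU2_eq_su2[OF h] by (auto simp: a_def c_def a'_def c'_def)
  have "complex_of_real ((cmod (a * a' - cnj c * c'))\<^sup>2 + (cmod (c * a' + cnj a * c'))\<^sup>2)
      = of_real (((cmod a)\<^sup>2 + (cmod c)\<^sup>2) * ((cmod a')\<^sup>2 + (cmod c')\<^sup>2))"
    unfolding of_real_add of_real_mult complex_norm_square by (simp add: algebra_simps)
  then have "(cmod (a * a' - cnj c * c'))\<^sup>2 + (cmod (c * a' + cnj a * c'))\<^sup>2 = 1"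
    unfolding of_real_eq_iff using SU2_eq_su2(2)[OF g] SU2_eq_su2(2)[OF h]
    by (simp add: a_def c_def a'_def c'_def)
  then show ?thesis
    unfolding e su2_mult by (rule su2_in_SU2)
qed

lemma SU2_eq_image: "SU2 = (\<lambda>(a, c). su2 a c) ` sphere 0 1"
proof (intro equalityI subsetI)
  fix g assume g: "g \<in> SU2"
  have "(g $ 1 $ 1, g $ 2 $ 1) \<in> sphere 0 1"
    using SU2_eq_su2(2)[OF g] by (simp add: norm_Pair)
  then show "g \<in> (\<lambda>(a, c). su2 a c) ` sphere 0 1"
    using SU2_eq_su2(1)[OF g] by (metis (mono_tags, lifting) case_prod_conv image_eqI)
next
  fix g assume "g \<in> (\<lambda>(a, c). su2 a c) ` sphere 0 1"
  then show "g \<in> SU2"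
    by (auto simp: norm_Pair intro!: su2_in_SU2)
qed

lemma compact_SU2: "compact SU2"
  unfolding SU2_eq_image
proof (intro compact_continuous_image compact_sphere)
  have "continuous_on UNIV (\<lambda>p. if i = 1 then (if j = 1 then fst p else - cnj (snd p))
          else (if j = 1 then snd p else cnj (fst p)))" for i j :: 2
    by (cases "i = 1"; cases "j = 1") (auto intro!: continuous_intros)
  then show "continuous_on (sphere 0 1) (\<lambda>(a, c). su2 a c)"
    unfolding su2_def case_prod_unfold
    by (intro continuous_on_vec_lambda) (blast intro: continuous_on_subset)
qed

text \<open>The eigenvalues are the roots of \<open>\<lambda>\<^sup>2 - 2 Re(a) \<lambda> + 1\<close>, and if \<open>c \<noteq> 0\<close> then \<open>(\<lambda> - cnj a, c)\<close> is an
  eigenvector for \<open>\<lambda>\<close>. If \<open>c = 0\<close> the matrix is diagonal already, but its entries may come in either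
  order, whence the sign of \<open>\<phi>\<close>; the functions considered below are even in \<open>\<phi>\<close>.\<close>

lemma SU2_diagonalization:
  assumes g: "g \<in> SU2"
  defines "\<theta> \<equiv> arccos (Re (g $ 1 $ 1))"
  obtains \<phi> and p p' :: "complex^2^2" where "g ** p = p ** su2 (cis \<phi>) 0"
    "p ** p' = Finite_Cartesian_Product.mat 1" "\<phi> = \<theta> \<or> \<phi> = - \<theta>"
proof -
  define a c where "a = g $ 1 $ 1" and "c = g $ 2 $ 1"
  have ge: "g = su2 a c" and nrm: "(cmod a)\<^sup>2 + (cmod c)\<^sup>2 = 1"
    using SU2_eq_su2[OF g] by (auto simp: a_def c_def)
  have cos: "cos \<theta> = Re a" and th: "0 \<le> \<theta>" "\<theta> \<le> pi"
    using SU2_Re_bound[OF g] by (auto simp: \<theta>_def a_def cos_arccos_abs intro: arccos_lbound arccos_ubound)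
  have sin: "(sin \<theta>)\<^sup>2 = (Im a)\<^sup>2 + (cmod c)\<^sup>2"
    using nrm sin_squared_eq[of \<theta>] by (simp add: cos cmod_power2)
  show thesis
  proof (cases "c = 0")
    case True
    then have "sin \<theta> = Im a \<or> sin \<theta> = - Im a"
      using sin by (simp add: power2_eq_iff)
    then have "a = cis \<theta> \<or> a = cis (- \<theta>)"
      using cos by (auto simp: complex_eq_iff)
    then have "g = su2 (cis \<theta>) 0 \<or> g = su2 (cis (- \<theta>)) 0"
      using True by (auto simp: ge)
    then show thesis
      using that[of "Finite_Cartesian_Product.mat 1" _ "Finite_Cartesian_Product.mat 1"] by auto
  next
    case False
    let ?l = "cis \<theta>"
    define p :: "complex^2^2" where
      "p = (\<chi> i j. if i = 1 then (if j = 1 then ?l - cnj a else cnj ?l - cnj a) else c)"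
    have pn: "p $ 1 $ 1 = ?l - cnj a" "p $ 1 $ 2 = cnj ?l - cnj a" "p $ 2 $ 1 = c" "p $ 2 $ 2 = c"
      by (auto simp: p_def)
    have "sin \<theta> \<noteq> 0" using sin False by (auto simp: power2_eq_square add_nonneg_eq_0_iff)
    then have "Determinants.det p \<noteq> 0"
      using False by (auto simp: det_2 pn complex_eq_iff algebra_simps)
    then obtain p' where p': "p ** p' = Finite_Cartesian_Product.mat 1"
      using invertible_det_nz[of p] by (auto simp: invertible_def)
    have ac: "a * cnj a + c * cnj c = 1"
      using nrm by (metis complex_norm_square of_real_1 of_real_add)
    have tr: "?l + cnj ?l = a + cnj a" using cos by (simp add: complex_eq_iff)
    have ll: "?l * cnj ?l = 1" by (simp flip: complex_norm_square)
    have "g ** p = p ** su2 ?l 0"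
    proof (rule mat2_eqI)
      have "a * (?l - cnj a) - cnj c * c = (a + cnj a) * ?l - (a * cnj a + c * cnj c) - ?l * cnj a"
        by (simp add: algebra_simps)
      also have "\<dots> = (?l + cnj ?l) * ?l - ?l * cnj ?l - ?l * cnj a"
        by (simp only: tr ac ll)
      finally show "(g ** p) $ 1 $ 1 = (p ** su2 ?l 0) $ 1 $ 1"
        by (simp add: ge matrix_matrix_mult_def sum_2 pn algebra_simps)
      have "a * (cnj ?l - cnj a) - cnj c * c = (a + cnj a) * cnj ?l - (a * cnj a + c * cnj c) - cnj ?l * cnj a"
        by (simp add: algebra_simps)
      also have "\<dots> = (?l + cnj ?l) * cnj ?l - ?l * cnj ?l - cnj ?l * cnj a"
        by (simp only: tr ac ll)
      finally show "(g ** p) $ 1 $ 2 = (p ** su2 ?l 0) $ 1 $ 2"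
        by (simp add: ge matrix_matrix_mult_def sum_2 pn algebra_simps)
    qed (auto simp: ge matrix_matrix_mult_def sum_2 pn algebra_simps)
    then show thesis using p' that by blast
  qed
qed



section \<open>The character and the Euler factor as functions of the trace\<close>

definition sym_char :: "nat \<Rightarrow> real \<Rightarrow> real" where
  "sym_char m x = (\<Sum>j\<le>m. cos ((real m - 2 * real j) * arccos x))"

text \<open>The logarithm of \<open>D(X, Sym\<^sup>m, g)\<close> as a function of \<open>x = Re g\<^sub>1\<^sub>1\<close>. The factor \<open>1/2\<close> appears
  because the weights \<open>m - 2j\<close> come in pairs of opposite sign, and \<open>1 - 2X cos t + X\<^sup>2\<close> is the squared
  modulus of \<open>1 - X e\<^sup>i\<^sup>t\<close>.\<close>

definition sym_log :: "nat \<Rightarrow> real \<Rightarrow> real \<Rightarrow> real" where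
  "sym_log m X x = - (\<Sum>j\<le>m. ln (1 - 2 * X * cos ((real m - 2 * real j) * arccos x) + X\<^sup>2)) / 2"

lemma sum_reflect_weights:
  fixes f :: "real \<Rightarrow> 'a::comm_monoid_add"
  shows "(\<Sum>j\<le>m. f (real m - 2 * real j)) = (\<Sum>j\<le>m. f (- (real m - 2 * real j)))"
  by (rule sum.reindex_bij_witness[of _ "\<lambda>j. m - j" "\<lambda>j. m - j"]) (auto simp: of_nat_diff algebra_simps)

lemma cis_weight: "j \<le> m \<Longrightarrow> cis \<phi> ^ (m - j) * cnj (cis \<phi>) ^ j = cis ((real m - 2 * real j) * \<phi>)"
  by (simp add: cis_cnj Complex.DeMoivre cis_mult of_nat_diff algebra_simps)

lemma character_sym_rep_SU2:
  assumes "g \<in> SU2"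
  shows "character (sym_rep m) g = of_real (sym_char m (Re (g $ 1 $ 1)))"
proof -
  let ?\<theta> = "arccos (Re (g $ 1 $ 1))"
  let ?w = "\<lambda>j. real m - 2 * real j"
  obtain \<phi> and p p' :: "complex^2^2" where p: "g ** p = p ** su2 (cis \<phi>) 0"
    "p ** p' = Finite_Cartesian_Product.mat 1" "\<phi> = ?\<theta> \<or> \<phi> = - ?\<theta>"
    using SU2_diagonalization[OF assms] .
  have "character (sym_rep m) g = (\<Sum>j\<le>m. cis (?w j * \<phi>))"
    by (subst character_sym_rep[OF p(1,2)]) (auto intro!: sum.cong cis_weight)
  moreover have "(\<Sum>j\<le>m. sin (?w j * \<phi>)) = 0"
    using sum_reflect_weights[of "\<lambda>w. sin (w * \<phi>)" m]
    by (simp add: sum_negf del: minus_diff_eq)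
  moreover have "cos (?w j * \<phi>) = cos (?w j * ?\<theta>)" for j
    using p(3) by auto
  ultimately show ?thesis
    by (simp add: complex_eq_iff sym_char_def)
qed

lemma cmod_one_minus_cis: "(cmod (1 - of_real X * cis t))\<^sup>2 = 1 - 2 * X * cos t + X\<^sup>2"
proof -
  have "(cmod (1 - of_real X * cis t))\<^sup>2 = 1 - 2 * X * cos t + X\<^sup>2 * ((cos t)\<^sup>2 + (sin t)\<^sup>2)"
    unfolding cmod_power2 distrib_left by (simp add: power2_eq_square algebra_simps)
  then show ?thesis by simp
qed

text \<open>The logarithm of the determinant is the sum of the logarithms of \<open>1 - X e\<^sup>i\<^sup>w\<^sup>\<phi>\<close> over the weights \<open>w\<close>.
  All of these have positive real part, so the principal branch commutes with conjugation, and the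
  symmetry \<open>w \<mapsto> - w\<close> makes the sum real. This is why \<open>D\<close> is not only real but positive.\<close>

lemma D_fac_sym_rep_SU2:
  assumes g: "g \<in> SU2" and X: "0 \<le> X" "X < 1"
  shows "D_fac (of_real X) (sym_rep m) g = of_real (exp (sym_log m X (Re (g $ 1 $ 1))))"
proof -
  let ?\<theta> = "arccos (Re (g $ 1 $ 1))"
  let ?w = "\<lambda>j. real m - 2 * real j"
  obtain \<phi> and p p' :: "complex^2^2" where p: "g ** p = p ** su2 (cis \<phi>) 0"
    "p ** p' = Finite_Cartesian_Product.mat 1" "\<phi> = ?\<theta> \<or> \<phi> = - ?\<theta>"
    using SU2_diagonalization[OF g] .
  let ?z = "\<lambda>w. 1 - of_real X * cis (w * \<phi>)"
  have re: "Re (?z w) > 0" for w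
  proof -
    have "X * cos (w * \<phi>) \<le> X * 1" using X by (intro mult_left_mono) auto
    then show ?thesis using X by simp
  qed
  then have nz: "?z w \<noteq> 0" for w by (metis less_irrefl zero_complex.simps(1))
  have nonpos: "?z w \<notin> \<real>\<^sub>\<le>\<^sub>0" for w
    using re[of w] by (auto simp: complex_nonpos_Reals_iff)
  have im: "(\<Sum>j\<le>m. Im (Ln (?z (?w j)))) = 0"
  proof -
    have "Im (Ln (?z (- w))) = - Im (Ln (?z w))" for w
    proof -
      have "Ln (?z (- w)) = cnj (Ln (?z w))"
        using cnj_Ln[OF nonpos[of w]] by (simp add: cis_cnj)
      then show ?thesis by simp
    qed
    then have "(\<Sum>j\<le>m. Im (Ln (?z (?w j)))) = - (\<Sum>j\<le>m. Im (Ln (?z (?w j))))"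
      using sum_reflect_weights[of "\<lambda>w. Im (Ln (?z w))" m]
      by (simp add: sum_negf del: minus_diff_eq)
    then show ?thesis by simp
  qed
  have rl: "Re (Ln (?z w)) = ln (1 - 2 * X * cos (w * ?\<theta>) + X\<^sup>2) / 2" for w
  proof -
    have "cos (w * \<phi>) = cos (w * ?\<theta>)" using p(3) by auto
    then have "ln (1 - 2 * X * cos (w * ?\<theta>) + X\<^sup>2) = ln ((cmod (?z w))\<^sup>2)"
      by (simp only: cmod_one_minus_cis)
    also have "\<dots> = 2 * ln (cmod (?z w))"
      using nz by (simp add: ln_realpow)
    finally show ?thesis using nz by simp
  qed
  have "Determinant.det (1\<^sub>m (m + 1) - of_real X \<cdot>\<^sub>m sym_rep m g) = (\<Prod>j\<le>m. ?z (?w j))"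
    by (subst det_one_minus_sym_rep[OF p(1,2)]) (auto intro!: prod.cong simp: cis_weight simp del: complex_cnj_cnj)
  also have "\<dots> = (\<Prod>j\<le>m. exp (Ln (?z (?w j))))"
    using nz by (intro prod.cong refl) (simp add: exp_Ln)
  also have "\<dots> = exp (\<Sum>j\<le>m. Ln (?z (?w j)))"
    by (simp add: exp_sum)
  also have "(\<Sum>j\<le>m. Ln (?z (?w j))) = of_real (- sym_log m X (Re (g $ 1 $ 1)))"
    using im by (simp add: complex_eq_iff rl sym_log_def sum_divide_distrib)
  finally show ?thesis
    by (simp add: D_fac_def exp_minus exp_of_real)
qed

text \<open>Chebyshev polynomials \<open>cos (k arccos x)\<close> are Lipschitz with constant \<open>k\<^sup>2\<close>, including at the
  end points \<open>x = \<plusminus>1\<close>, where \<open>arccos\<close> itself is not Lipschitz.\<close>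

lemma cos_mult_diff_le:
  "\<bar>cos (real k * s) - cos (real k * t)\<bar> \<le> (real k)\<^sup>2 * \<bar>cos s - cos t\<bar>"
proof -
  have sin_le: "\<bar>sin (real k * u)\<bar> \<le> real k * \<bar>sin u\<bar>" for k :: nat and u :: real
  proof (induction k)
    case (Suc k)
    have "\<bar>sin (real (Suc k) * u)\<bar> = \<bar>sin (real k * u) * cos u + cos (real k * u) * sin u\<bar>"
      by (simp add: distrib_right sin_add algebra_simps)
    also have "\<dots> \<le> \<bar>sin (real k * u)\<bar> * 1 + 1 * \<bar>sin u\<bar>"
      unfolding abs_mult[symmetric]
      by (intro order.trans[OF abs_triangle_ineq] add_mono) (auto simp: abs_mult intro: mult_left_le mult_left_le_one_le)
    also have "\<dots> \<le> real (Suc k) * \<bar>sin u\<bar>"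
      using Suc by (simp add: algebra_simps)
    finally show ?case .
  qed auto
  have "\<bar>cos (real k * s) - cos (real k * t)\<bar> = 2 * (\<bar>sin (real k * ((s + t) / 2))\<bar> * \<bar>sin (real k * ((t - s) / 2))\<bar>)"
    by (simp add: cos_diff_cos abs_mult algebra_simps flip: distrib_left right_diff_distrib)
  also have "\<dots> \<le> 2 * ((real k * \<bar>sin ((s + t) / 2)\<bar>) * (real k * \<bar>sin ((t - s) / 2)\<bar>))"
    by (intro mult_left_mono mult_mono sin_le) auto
  also have "\<dots> = (real k)\<^sup>2 * \<bar>cos s - cos t\<bar>"
    by (simp add: cos_diff_cos abs_mult power2_eq_square)
  finally show ?thesis .
qed

lemma cos_weight_diff_le:
  assumes "j \<le> m" "\<bar>x\<bar> \<le> 1" "\<bar>y\<bar> \<le> 1"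
  shows "\<bar>cos ((real m - 2 * real j) * arccos x) - cos ((real m - 2 * real j) * arccos y)\<bar> \<le> (real m)\<^sup>2 * \<bar>x - y\<bar>"
proof -
  define k where "k = nat \<bar>int m - 2 * int j\<bar>"
  have k: "real m - 2 * real j = real k \<or> real m - 2 * real j = - real k" "real k \<le> real m"
    using assms(1) by (simp_all add: k_def) linarith+
  then have "cos ((real m - 2 * real j) * t) = cos (real k * t)" for t
    by (metis cos_minus mult_minus_left)
  then have "\<bar>cos ((real m - 2 * real j) * arccos x) - cos ((real m - 2 * real j) * arccos y)\<bar>
     \<le> (real k)\<^sup>2 * \<bar>x - y\<bar>"
    using cos_mult_diff_le[of k "arccos x" "arccos y"] assms by (simp add: cos_arccos_abs)
  also have "\<dots> \<le> (real m)\<^sup>2 * \<bar>x - y\<bar>"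
    using k(2) by (intro mult_right_mono power_mono) auto
  finally show ?thesis .
qed

lemma sym_log_arg_ge:
  fixes X t :: real
  assumes "0 \<le> X" "X \<le> 1 / 2"
  shows "1 / 4 \<le> 1 - 2 * X * cos t + X\<^sup>2"
proof -
  have "2 * X * cos t \<le> 2 * X * 1" using assms by (intro mult_left_mono) auto
  moreover have "(1 / 2)\<^sup>2 \<le> (1 - X)\<^sup>2" using assms by (intro power_mono) auto
  ultimately show ?thesis by (simp add: power2_eq_square algebra_simps)
qed

lemma abs_ln_diff_le:
  fixes u v :: real
  assumes "c > 0" "c \<le> u" "c \<le> v"
  shows "\<bar>ln u - ln v\<bar> \<le> \<bar>u - v\<bar> / c"
proof -
  have *: "ln a - ln b \<le> \<bar>a - b\<bar> / c" if "c \<le> a" "c \<le> b" for a b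
  proof -
    have "ln (a / b) \<le> a / b - 1" using that assms by (intro ln_le_minus_one) auto
    also have "a / b - 1 = (a - b) / b" using that assms by (simp add: diff_divide_distrib)
    also have "\<dots> \<le> \<bar>a - b\<bar> / b" using that assms by (intro divide_right_mono) auto
    also have "\<dots> \<le> \<bar>a - b\<bar> / c" using that assms by (intro divide_left_mono) auto
    finally show ?thesis using that assms by (simp add: ln_divide_pos)
  qed
  show ?thesis using *[of u v] *[of v u] assms by (simp add: abs_minus_commute)
qed

text \<open>The factor \<open>X\<close> in the constant is what permits balls of radius \<open>p / r\<close> around the maximum.\<close>

lemma sym_log_lipschitz:
  assumes X: "0 \<le> X" "X \<le> 1 / 2" and xy: "\<bar>x\<bar> \<le> 1" "\<bar>y\<bar> \<le> 1"
  shows "\<bar>sym_log m X x - sym_log m X y\<bar> \<le> 4 * (real m + 1) * (real m)\<^sup>2 * X * \<bar>x - y\<bar>"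
proof -
  let ?u = "\<lambda>x j. 1 - 2 * X * cos ((real m - 2 * real j) * arccos x) + X\<^sup>2"
  have "\<bar>ln (?u y j) - ln (?u x j)\<bar> \<le> 8 * X * ((real m)\<^sup>2 * \<bar>x - y\<bar>)" if "j \<le> m" for j
  proof -
    have "\<bar>ln (?u y j) - ln (?u x j)\<bar> \<le> \<bar>?u y j - ?u x j\<bar> / (1 / 4)"
      using X by (intro abs_ln_diff_le sym_log_arg_ge) auto
    also have "\<bar>?u y j - ?u x j\<bar> / (1 / 4) = 8 * X * \<bar>cos ((real m - 2 * real j) * arccos x) - cos ((real m - 2 * real j) * arccos y)\<bar>"
    proof -
      have "?u y j - ?u x j = 2 * X * (cos ((real m - 2 * real j) * arccos x) - cos ((real m - 2 * real j) * arccos y))"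
        by (simp add: algebra_simps)
      then show ?thesis using X by (simp add: abs_mult)
    qed
    also have "\<dots> \<le> 8 * X * ((real m)\<^sup>2 * \<bar>x - y\<bar>)"
      using X by (intro mult_left_mono cos_weight_diff_le that xy) auto
    finally show ?thesis .
  qed
  then have "\<bar>\<Sum>j\<le>m. ln (?u y j) - ln (?u x j)\<bar> \<le> (\<Sum>j\<le>m. 8 * X * ((real m)\<^sup>2 * \<bar>x - y\<bar>))"
    by (intro order.trans[OF sum_abs] sum_mono) auto
  moreover have "sym_log m X x - sym_log m X y = (\<Sum>j\<le>m. ln (?u y j) - ln (?u x j)) / 2"
    unfolding sym_log_def sum_subtractf by (simp add: field_simps)
  ultimately show ?thesis by (simp add: algebra_simps)
qed

lemma sym_char_lipschitz:
  assumes "\<bar>x\<bar> \<le> 1" "\<bar>y\<bar> \<le> 1"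
  shows "\<bar>sym_char m x - sym_char m y\<bar> \<le> (real m + 1) * (real m)\<^sup>2 * \<bar>x - y\<bar>"
proof -
  have "\<bar>sym_char m x - sym_char m y\<bar> \<le> (\<Sum>j\<le>m. (real m)\<^sup>2 * \<bar>x - y\<bar>)"
    unfolding sym_char_def sum_subtractf[symmetric]
    by (intro order.trans[OF sum_abs] sum_mono cos_weight_diff_le assms) auto
  then show ?thesis by (simp add: algebra_simps)
qed

lemma sym_char_bound: "\<bar>sym_char m x\<bar> \<le> real m + 1"
proof -
  have "\<bar>sym_char m x\<bar> \<le> (\<Sum>j\<le>m. 1)"
    unfolding sym_char_def by (intro order.trans[OF sum_abs] sum_mono) auto
  then show ?thesis by simp
qed

lemma sym_log_approx:
  assumes X: "0 \<le> X" "X \<le> 1 / 2"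
  shows "\<bar>sym_log m X x - X * sym_char m x\<bar> \<le> 13 * (real m + 1) * X\<^sup>2"
proof -
  let ?t = "\<lambda>j. (real m - 2 * real j) * arccos x"
  have one: "\<bar>- ln (1 - 2 * X * cos t + X\<^sup>2) / 2 - X * cos t\<bar> \<le> 13 * X\<^sup>2" for t
  proof -
    define w where "w = - 2 * X * cos t + X\<^sup>2"
    have e: "1 - 2 * X * cos t + X\<^sup>2 = 1 + w" "X * cos t = (X\<^sup>2 - w) / 2" by (simp_all add: w_def)
    have pos: "1 / 4 \<le> 1 + w" using sym_log_arg_ge[OF X, of t] by (simp only: e)
    have "\<bar>w\<bar> \<le> 2 * X * \<bar>cos t\<bar> + X\<^sup>2"
      unfolding w_def using X by (intro order.trans[OF abs_triangle_ineq]) (auto simp: abs_mult)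
    also have "\<dots> \<le> 2 * X * 1 + (1 / 2) * X"
      unfolding power2_eq_square using X by (intro add_mono mult_left_mono mult_right_mono) auto
    finally have "\<bar>w\<bar>\<^sup>2 \<le> (5 / 2 * X)\<^sup>2" by (intro power_mono) auto
    then have w2: "w\<^sup>2 \<le> 25 / 4 * X\<^sup>2" by (simp add: power_mult_distrib power2_eq_square)
    have up: "ln (1 + w) \<le> w" using pos ln_le_minus_one[of "1 + w"] by simp
    have "- ln (1 + w) = ln (1 / (1 + w))" using pos by (simp add: ln_div)
    also have "\<dots> \<le> 1 / (1 + w) - 1" using pos by (intro ln_le_minus_one) auto
    also have "\<dots> = - w + w\<^sup>2 / (1 + w)" using pos by (simp add: field_simps power2_eq_square)
    also have "w\<^sup>2 / (1 + w) \<le> w\<^sup>2 / (1 / 4)" using pos by (intro divide_left_mono) auto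
    finally have "w - 4 * w\<^sup>2 \<le> ln (1 + w)" by simp
    with up w2 have "- (25 * X\<^sup>2) \<le> ln (1 + w) - w" "ln (1 + w) - w \<le> 0" by linarith+
    moreover have "- ln (1 - 2 * X * cos t + X\<^sup>2) / 2 - X * cos t = - (ln (1 + w) - w + X\<^sup>2) / 2"
      unfolding e by (simp add: field_simps)
    moreover have "\<bar>- (d + s) / 2\<bar> \<le> 13 * s" if "- (25 * s) \<le> d" "d \<le> 0" "0 \<le> s" for d s :: real
      using that by (intro abs_leI) (simp_all add: field_simps)
    ultimately show ?thesis by (metis zero_le_power2)
  qed
  have "sym_log m X x - X * sym_char m x = (\<Sum>j\<le>m. - ln (1 - 2 * X * cos (?t j) + X\<^sup>2) / 2 - X * cos (?t j))"
    by (simp add: sym_log_def sym_char_def sum_subtractf sum_distrib_left sum_negf flip: sum_divide_distrib)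
  moreover have "\<bar>\<Sum>j\<le>m. - ln (1 - 2 * X * cos (?t j) + X\<^sup>2) / 2 - X * cos (?t j)\<bar> \<le> (\<Sum>j\<le>m. 13 * X\<^sup>2)"
    by (rule order.trans[OF sum_abs sum_mono[OF one]])
  moreover have "(\<Sum>j\<le>m. 13 * X\<^sup>2) = 13 * (real m + 1) * X\<^sup>2" by simp
  ultimately show ?thesis by (simp only:)
qed

section \<open>Haar measure on the group\<close>

lemma SU2_norm_entries:
  assumes "g \<in> SU2"
  shows "cmod (g $ 1 $ 1) \<le> 1" "cmod (g $ 2 $ 1) \<le> 1"
proof -
  have "(cmod (g $ 1 $ 1))\<^sup>2 \<le> 1\<^sup>2" "(cmod (g $ 2 $ 1))\<^sup>2 \<le> 1\<^sup>2"
    using SU2_eq_su2(2)[OF assms] zero_le_power2[of "cmod (g $ 1 $ 1)"] zero_le_power2[of "cmod (g $ 2 $ 1)"]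
    unfolding one_power2 by linarith+
  then show "cmod (g $ 1 $ 1) \<le> 1" "cmod (g $ 2 $ 1) \<le> 1"
    by (auto intro: power2_le_imp_le)
qed

lemma lipschitz_bound_imp_continuous_on:
  fixes f :: "real \<Rightarrow> real"
  assumes "\<And>x y. x \<in> S \<Longrightarrow> y \<in> S \<Longrightarrow> \<bar>f x - f y\<bar> \<le> L * \<bar>x - y\<bar>"
  shows "continuous_on S f"
proof -
  have "lipschitz_on \<bar>L\<bar> S f"
  proof (rule lipschitz_onI)
    fix x y assume "x \<in> S" "y \<in> S"
    then have "\<bar>f x - f y\<bar> \<le> L * \<bar>x - y\<bar>" by (rule assms)
    also have "\<dots> \<le> \<bar>L\<bar> * \<bar>x - y\<bar>" by (intro mult_right_mono) auto
    finally show "dist (f x) (f y) \<le> \<bar>L\<bar> * dist x y" by (simp add: dist_real_def)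
  qed simp
  then show ?thesis by (rule lipschitz_on_continuous_on)
qed

lemma continuous_on_sym_log:
  assumes "0 \<le> X" "X \<le> 1 / 2"
  shows "continuous_on {-1..1} (sym_log m X)"
  by (rule lipschitz_bound_imp_continuous_on[OF sym_log_lipschitz[OF assms]]) auto

lemma continuous_on_sym_char: "continuous_on {-1..1} (sym_char m)"
  by (rule lipschitz_bound_imp_continuous_on[OF sym_char_lipschitz]) auto

lemma Re_SU2_image: "(\<lambda>g. Re (g $ 1 $ 1)) ` SU2 = {-1..1}"
proof (intro equalityI subsetI)
  fix x :: real assume x: "x \<in> {-1..1}"
  have "su2 (cis (arccos x)) 0 \<in> SU2" by (rule su2_in_SU2) simp
  then show "x \<in> (\<lambda>g. Re (g $ 1 $ 1)) ` SU2"
    using x by (intro image_eqI[of _ _ "su2 (cis (arccos x)) 0"]) auto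
qed (use SU2_Re_bound in force)

text \<open>The maxima over the group are maxima over the interval of possible values of \<open>Re g\<^sub>1\<^sub>1\<close>.\<close>

lemma Greatest_continuous_SU2:
  assumes "continuous_on {-1..1} f"
  obtains x where "\<bar>x\<bar> \<le> 1" "(GREATEST v. v \<in> (\<lambda>g. f (Re (g $ 1 $ 1)) :: real) ` SU2) = f x"
    "\<And>y. \<bar>y\<bar> \<le> 1 \<Longrightarrow> f y \<le> f x"
proof -
  obtain x where x: "x \<in> {-1..1}" "\<And>y. y \<in> {-1..1} \<Longrightarrow> f y \<le> f x"
    using continuous_attains_sup[OF _ _ assms] by auto
  have "(\<lambda>g. f (Re (g $ 1 $ 1)) :: real) ` SU2 = f ` {-1..1}"
    by (simp flip: Re_SU2_image add: image_image)
  then have "(GREATEST v. v \<in> (\<lambda>g. f (Re (g $ 1 $ 1)) :: real) ` SU2) = f x"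
    using x by (intro Greatest_equality) auto
  then show thesis using x by (intro that[of x]) (auto simp: abs_le_iff)
qed

locale haar_SU2 =
  fixes \<mu> :: "(complex^2^2) measure"
  assumes haar: "is_haar_prob_SU2 \<mu>"
begin

sublocale prob_space \<mu>
  using haar by (simp add: is_haar_prob_SU2_def)

lemma sets_haar: "sets \<mu> = sets (restrict_space borel SU2)"
  using haar by (simp add: is_haar_prob_SU2_def)

lemma space_haar [simp]: "space \<mu> = SU2"
  using sets_eq_imp_space_eq[OF sets_haar] by (simp add: space_restrict_space)

lemma measurable_continuous:
  fixes f :: "complex^2^2 \<Rightarrow> 'a::topological_space"
  assumes "continuous_on SU2 f"
  shows "f \<in> borel_measurable \<mu>"
  using borel_measurable_continuous_on_restrict[OF assms] by (simp cong: measurable_cong_sets add: sets_haar)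

lemma integrable_continuous:
  fixes f :: "complex^2^2 \<Rightarrow> 'a::{banach, second_countable_topology}"
  assumes "continuous_on SU2 f"
  shows "integrable \<mu> f"
proof -
  obtain B where "\<And>g. g \<in> SU2 \<Longrightarrow> norm (f g) \<le> B"
    using compact_imp_bounded[OF compact_continuous_image[OF assms compact_SU2]]
    by (auto simp: bounded_iff)
  then show ?thesis
    by (intro integrable_const_bound[of _ B] AE_I2 measurable_continuous assms) auto
qed

lemma continuous_on_mult_left: "continuous_on S (\<lambda>g :: complex^2^2. h ** g)"
  unfolding matrix_matrix_mult_def
  by (intro continuous_on_vec_lambda continuous_intros)

lemma measurable_mult_left:
  assumes "h \<in> SU2"
  shows "(\<lambda>g. h ** g) \<in> measurable \<mu> \<mu>"
proof -
  have "(\<lambda>g. h ** g) \<in> measurable \<mu> (restrict_space borel SU2)"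
    using assms by (intro measurable_restrict_space2 measurable_continuous continuous_on_mult_left)
                   (auto simp: SU2_mult_closed)
  then show ?thesis
    by (simp cong: measurable_cong_sets add: sets_haar)
qed

lemma distr_mult_left: "h \<in> SU2 \<Longrightarrow> distr \<mu> \<mu> (\<lambda>g. h ** g) = \<mu>"
  using haar by (simp add: is_haar_prob_SU2_def)

lemma integral_translate:
  fixes f :: "complex^2^2 \<Rightarrow> 'a::{banach, second_countable_topology}"
  assumes "h \<in> SU2" "continuous_on SU2 f"
  shows "(LINT g|\<mu>. f (h ** g)) = (LINT g|\<mu>. f g)"
  using integral_distr[OF measurable_mult_left[OF assms(1)] measurable_continuous[OF assms(2)]]
  by (simp add: distr_mult_left[OF assms(1)])

lemma continuous_on_coeff_mult:
  fixes p q :: "complex^2^2 \<Rightarrow> complex poly"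
  assumes "\<And>i. continuous_on S (\<lambda>g. coeff (p g) i)" "\<And>i. continuous_on S (\<lambda>g. coeff (q g) i)"
  shows "continuous_on S (\<lambda>g. coeff (p g * q g) i)"
  unfolding coeff_mult using assms by (intro continuous_intros)

lemma continuous_on_coeff_linear_power:
  "continuous_on S (\<lambda>g :: complex^2^2. coeff ([:g $ a $ b, g $ c $ d:] ^ n) i)"
proof (induction n arbitrary: i)
  case 0
  then show ?case by simp
next
  case (Suc n)
  have lin: "continuous_on S (\<lambda>g :: complex^2^2. coeff [:g $ a $ b, g $ c $ d:] k)" for k
  proof (cases k)
    case (Suc l)
    then show ?thesis by (cases l) (auto intro!: continuous_intros)
  qed (auto intro!: continuous_intros)
  show ?case
    unfolding power_Suc by (rule continuous_on_coeff_mult[OF lin Suc.IH])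
qed

lemma continuous_on_sym_rep:
  assumes "i \<le> m" "j \<le> m"
  shows "continuous_on S (\<lambda>g. sym_rep m g $$ (i, j))"
  unfolding sym_rep_index[OF assms]
  by (intro continuous_on_coeff_mult continuous_on_coeff_linear_power)

lemma continuous_on_Re_entry: "continuous_on {-1..1} f \<Longrightarrow> continuous_on SU2 (\<lambda>g. f (Re (g $ 1 $ 1)) :: real)"
  by (rule continuous_on_compose2[of "{-1..1}"]) (use Re_SU2_image in \<open>auto intro!: continuous_intros\<close>)

text \<open>The matrix \<open>M\<close> of integrals satisfies \<open>sym_rep m h * M = M\<close> for all \<open>h\<close>. Diagonal \<open>h\<close> multiplies
  the \<open>i\<close>-th row by a character of weight \<open>m - 2i\<close>, so every row except the one of weight zero vanishes.
  That row vanishes as well, since an \<open>h\<close> without zero entries would spread it into the others.\<close>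

lemma integral_sym_rep_eq_0:
  assumes m: "m \<ge> 1" and ij: "i \<le> m" "j \<le> m"
  shows "(LINT g|\<mu>. sym_rep m g $$ (i, j)) = 0"
proof -
  define M where "M = (\<lambda>i j. LINT g|\<mu>. sym_rep m g $$ (i, j))"
  have inv: "M i j = (\<Sum>k\<le>m. sym_rep m h $$ (i, k) * M k j)" if "h \<in> SU2" "i \<le> m" for h i
  proof -
    have "M i j = (LINT g|\<mu>. sym_rep m (h ** g) $$ (i, j))"
      unfolding M_def using that ij by (intro integral_translate[symmetric] continuous_on_sym_rep)
    also have "\<dots> = (LINT g|\<mu>. (\<Sum>k\<le>m. sym_rep m h $$ (i, k) * sym_rep m g $$ (k, j)))"
      using that ij by (simp add: sym_rep_mult scalar_prod_def atLeast0LessThan lessThan_Suc_atMost)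
    also have "\<dots> = (\<Sum>k\<le>m. sym_rep m h $$ (i, k) * M k j)"
      unfolding M_def using ij
      by (subst Bochner_Integration.integral_sum)
         (auto intro!: integrable_continuous continuous_on_mult continuous_on_const continuous_on_sym_rep)
    finally show ?thesis .
  qed
  have off: "M i j = 0" if "i \<le> m" "m \<noteq> 2 * i" for i
  proof -
    define w where "w = real m - 2 * real i"
    have w: "w \<noteq> 0" using that(2) by (simp add: w_def)
    \<comment> \<open>The angle is chosen such that the weight \<open>w\<close> acts by \<open>-1\<close>.\<close>
    let ?h = "su2 (cis (pi / w)) 0"
    have h: "?h \<in> SU2" by (rule su2_in_SU2) simp
    have "sym_rep m ?h $$ (i, k) * M k j = (if k = i then - M i j else 0)" if "k \<le> m" for k
      using that \<open>i \<le> m\<close> w by (simp add: sym_rep_diagonal cis_weight flip: w_def)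
    then have "M i j = (\<Sum>k\<le>m. if k = i then - M i j else 0)"
      using inv[OF h that(1)] by simp
    then show ?thesis using that(1) by simp
  qed
  show ?thesis
  proof (cases "m = 2 * i")
    case False
    then show ?thesis using off ij by (simp add: M_def)
  next
    case True
    let ?s = "complex_of_real (1 / sqrt 2)"
    let ?h = "su2 ?s ?s"
    have h: "?h \<in> SU2" by (rule su2_in_SU2) (simp add: norm_divide power_divide)
    have "0 = M 0 j" using off[of 0] m by simp
    also have "\<dots> = (\<Sum>k\<le>m. sym_rep m ?h $$ (0, k) * M k j)"
      by (rule inv[OF h]) simp
    also have "\<dots> = (\<Sum>k\<le>m. if k = i then sym_rep m ?h $$ (0, i) * M i j else 0)"
      by (intro sum.cong) (use off True in auto)
    also have "\<dots> = sym_rep m ?h $$ (0, i) * M i j"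
      using ij by simp
    finally have "sym_rep m ?h $$ (0, i) * M i j = 0" by simp
    moreover have "sym_rep m ?h $$ (0, i) \<noteq> 0"
      using ij by (simp add: sym_rep_index coeff_mult coeff_0_power)
    ultimately show ?thesis by (simp add: M_def)
  qed
qed

lemma integral_sym_char_eq_0:
  assumes "m \<ge> 1"
  shows "(LINT g|\<mu>. sym_char m (Re (g $ 1 $ 1))) = 0"
proof -
  have "complex_of_real (LINT g|\<mu>. sym_char m (Re (g $ 1 $ 1))) = (LINT g|\<mu>. complex_of_real (sym_char m (Re (g $ 1 $ 1))))"
    by simp
  also have "\<dots> = (LINT g|\<mu>. (\<Sum>i\<le>m. sym_rep m g $$ (i, i)))"
    by (intro Bochner_Integration.integral_cong refl)
       (simp add: character_def lessThan_Suc_atMost flip: character_sym_rep_SU2)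
  also have "\<dots> = 0"
    using assms by (subst Bochner_Integration.integral_sum)
       (auto intro!: integrable_continuous continuous_on_sym_rep simp: integral_sym_rep_eq_0)
  finally show ?thesis by simp
qed

text \<open>A covering argument in place of an explicit formula for the Haar measure: the group, seen in
  the cube of the real and imaginary parts of the first column, meets at most \<open>(2n + 1)\<^sup>4\<close> cells of side
  \<open>1/n\<close>; elements of one cell differ by an element of the neighbourhood \<open>N\<close>, so that as many translates of
  \<open>N\<close>, all of the same measure, cover the group. The true order \<open>d\<^sup>3\<close> is not attained, but only the
  logarithm of the bound matters.\<close>

lemma measure_near_identity:
  assumes d: "0 < d" "d \<le> 1"
  shows "measure \<mu> {k \<in> SU2. cmod (k $ 1 $ 1 - 1) + cmod (k $ 2 $ 1) \<le> d} \<ge> (d / 19) ^ 4"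
proof -
  define N where "N = {k \<in> SU2. cmod (k $ 1 $ 1 - 1) + cmod (k $ 2 $ 1) \<le> d}"
  \<comment> \<open>In a cell of side \<open>1/n\<close> each of the two complex entries varies by at most \<open>2/n\<close>; each of
    the two entries of the quotient then moves by at most \<open>4/n\<close>.\<close>
  define n where "n = nat \<lceil>8 / d\<rceil>"
  have n: "8 / d \<le> real n" "real n \<le> 8 / d + 1" "n > 0"
    using d by (auto simp: n_def)
  define cell where "cell = (\<lambda>g :: complex^2^2. (\<lfloor>n * Re (g $ 1 $ 1)\<rfloor>, \<lfloor>n * Im (g $ 1 $ 1)\<rfloor>,
                               \<lfloor>n * Re (g $ 2 $ 1)\<rfloor>, \<lfloor>n * Im (g $ 2 $ 1)\<rfloor>))"
  let ?I = "{- int n..int n}"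
  let ?grid = "?I \<times> ?I \<times> ?I \<times> ?I"
  have Nmeas: "N \<in> sets \<mu>"
  proof -
    have "(\<lambda>g. cmod (g $ 1 $ 1 - 1) + cmod (g $ 2 $ 1)) \<in> borel_measurable \<mu>"
      by (intro measurable_continuous continuous_intros)
    then have "{g \<in> space \<mu>. cmod (g $ 1 $ 1 - 1) + cmod (g $ 2 $ 1) \<le> d} \<in> sets \<mu>"
      by measurable
    then show ?thesis by (simp add: N_def)
  qed
  have grid: "cell g \<in> ?grid" if g: "g \<in> SU2" for g
  proof -
    have "cmod (g $ 1 $ 1) \<le> 1" "cmod (g $ 2 $ 1) \<le> 1"
      using SU2_norm_entries[OF g] by auto
    then have b: "\<bar>Re (g $ 1 $ 1)\<bar> \<le> 1" "\<bar>Im (g $ 1 $ 1)\<bar> \<le> 1" "\<bar>Re (g $ 2 $ 1)\<bar> \<le> 1" "\<bar>Im (g $ 2 $ 1)\<bar> \<le> 1"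
      using abs_Re_le_cmod abs_Im_le_cmod order.trans by blast+
    have "\<lfloor>real n * x\<rfloor> \<in> ?I" if "\<bar>x\<bar> \<le> 1" for x
    proof -
      have "real n * x \<le> real n * 1" "real n * (- 1) \<le> real n * x"
        using that by (intro mult_left_mono; force)+
      then show ?thesis by (auto simp: le_floor_iff floor_le_iff)
    qed
    then show ?thesis using b by (auto simp: cell_def)
  qed
  define rep where "rep = (\<lambda>v. SOME h. h \<in> SU2 \<and> cell h = v)"
  have rep: "rep (cell g) \<in> SU2" "cell (rep (cell g)) = cell g" if "g \<in> SU2" for g
    using someI[of "\<lambda>h. h \<in> SU2 \<and> cell h = cell g" g] that by (auto simp: rep_def)
  define adj where "adj = (\<lambda>h :: complex^2^2. su2 (cnj (h $ 1 $ 1)) (- (h $ 2 $ 1)))"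
  have adj: "adj h \<in> SU2" if "h \<in> SU2" for h
    unfolding adj_def using SU2_eq_su2(2)[OF that] by (intro su2_in_SU2) simp
  \<comment> \<open>Elements of one cell differ by an element of \<open>N\<close>.\<close>
  have near: "adj h ** g \<in> N" if g: "g \<in> SU2" and h: "h \<in> SU2" and cell: "cell h = cell g" for g h
  proof -
    define a c a' c' where "a = h $ 1 $ 1" and "c = h $ 2 $ 1" and "a' = g $ 1 $ 1" and "c' = g $ 2 $ 1"
    have ac: "(cmod a)\<^sup>2 + (cmod c)\<^sup>2 = 1"
      using SU2_eq_su2(2)[OF h] by (simp add: a_def c_def)
    then have acc: "cnj a * a + cnj c * c = 1"
      by (metis complex_norm_square mult.commute of_real_1 of_real_add)
    have le1: "cmod a \<le> 1" "cmod c \<le> 1"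
      using SU2_norm_entries[OF h] by (auto simp: a_def c_def)
    have fl: "\<bar>x - y\<bar> \<le> 1 / n" if "\<lfloor>real n * x\<rfloor> = \<lfloor>real n * y\<rfloor>" for x y
    proof -
      have "\<bar>real n * x - real n * y\<bar> \<le> 1"
        using that by linarith
      then have "real n * \<bar>x - y\<bar> \<le> 1"
        by (simp add: abs_mult flip: right_diff_distrib)
      then show ?thesis using n(3) by (simp add: field_simps)
    qed
    have da: "cmod (a' - a) \<le> 2 / n" and dc: "cmod (c' - c) \<le> 2 / n"
      using cell fl[of "Re a'" "Re a"] fl[of "Im a'" "Im a"] fl[of "Re c'" "Re c"] fl[of "Im c'" "Im c"]
        cmod_le[of "a' - a"] cmod_le[of "c' - c"]
      by (auto simp: cell_def a_def c_def a'_def c'_def)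
    have "adj h ** g = su2 (cnj a) (- c) ** su2 a' c'"
      using SU2_eq_su2(1)[OF g] by (simp add: adj_def a_def c_def a'_def c'_def)
    then have e: "(adj h ** g) $ 1 $ 1 - 1 = cnj a * (a' - a) + cnj c * (c' - c)"
      "(adj h ** g) $ 2 $ 1 = - c * (a' - a) + a * (c' - c)"
      using acc by (simp_all add: su2_mult algebra_simps)
    have prod_le: "cmod (u * v) \<le> 2 / n" if "cmod u \<le> 1" "cmod v \<le> 2 / n" for u v
    proof -
      have "cmod u * cmod v \<le> 1 * (2 / n)" using that by (intro mult_mono) auto
      then show ?thesis by (simp add: norm_mult)
    qed
    have "cmod ((adj h ** g) $ 1 $ 1 - 1) \<le> 2 / n + 2 / n"
      unfolding e by (rule order.trans[OF norm_triangle_ineq add_mono])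
        (use le1 da dc in \<open>auto intro!: prod_le\<close>)
    moreover have "cmod ((adj h ** g) $ 2 $ 1) \<le> 2 / n + 2 / n"
      unfolding e by (rule order.trans[OF norm_triangle_ineq add_mono])
        (use le1 da dc in \<open>auto intro!: prod_le\<close>)
    moreover have "8 / n \<le> d" using n d by (simp add: field_simps)
    ultimately show ?thesis
      unfolding N_def using SU2_mult_closed[OF adj[OF h] g] by simp
  qed
  define T where "T = (\<lambda>v. (\<lambda>g. adj (rep v) ** g) -` N \<inter> space \<mu>)"
  have Tsets: "T v \<in> sets \<mu>" and Tm: "measure \<mu> (T v) = measure \<mu> N" if v: "v \<in> cell ` SU2" for v
  proof -
    have h: "adj (rep v) \<in> SU2" using v rep(1) adj by auto
    show "T v \<in> sets \<mu>"
      unfolding T_def by (rule measurable_sets[OF measurable_mult_left[OF h] Nmeas])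
    show "measure \<mu> (T v) = measure \<mu> N"
      using measure_distr[OF measurable_mult_left[OF h] Nmeas] by (simp add: T_def distr_mult_left[OF h])
  qed
  have fin: "finite (cell ` SU2)" and card: "card (cell ` SU2) \<le> (2 * n + 1) ^ 4"
  proof -
    have sub: "cell ` SU2 \<subseteq> ?grid" by (rule image_subsetI) (rule grid)
    then show "finite (cell ` SU2)" by (rule finite_subset) simp
    have "card (cell ` SU2) \<le> card ?grid" using sub by (intro card_mono) auto
    also have "\<dots> = (2 * n + 1) ^ 4"
    proof -
      have "card ?I = 2 * n + 1" unfolding card_atLeastAtMost_int
        by (subst nat_int[symmetric]) (rule arg_cong[of _ _ nat], simp)
      then show ?thesis by (simp only: card_cartesian_product power4_eq_xxxx mult.assoc)
    qed
    finally show "card (cell ` SU2) \<le> (2 * n + 1) ^ 4" .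
  qed
  have "1 = measure \<mu> (space \<mu>)" by (simp add: prob_space del: space_haar)
  also have "\<dots> \<le> measure \<mu> (\<Union>v\<in>cell ` SU2. T v)"
  proof (rule finite_measure_mono)
    show "space \<mu> \<subseteq> (\<Union>v\<in>cell ` SU2. T v)"
      using near rep by (fastforce simp: T_def)
    show "(\<Union>v\<in>cell ` SU2. T v) \<in> sets \<mu>"
      by (intro sets.finite_UN fin Tsets)
  qed
  also have "\<dots> \<le> (\<Sum>v\<in>cell ` SU2. measure \<mu> (T v))"
    by (intro finite_measure_subadditive_finite fin image_subsetI Tsets)
  also have "\<dots> = real (card (cell ` SU2)) * measure \<mu> N"
    by (simp add: Tm)
  also have "\<dots> \<le> real ((2 * n + 1) ^ 4) * measure \<mu> N"
    using card by (intro mult_right_mono) (auto simp del: of_nat_power)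
  finally have "1 \<le> real (2 * n + 1) ^ 4 * measure \<mu> N" by simp
  moreover have "d * real (2 * n + 1) \<le> 19"
  proof -
    have "d * real (2 * n + 1) \<le> d * (2 * (8 / d + 1) + 1)"
      using n d by (intro mult_left_mono) auto
    also have "\<dots> = 16 + 3 * d" using d by (simp add: field_simps)
    finally show ?thesis using d by linarith
  qed
  then have "(d * real (2 * n + 1) / 19) ^ 4 \<le> 1"
    using d by (intro power_le_one) auto
  ultimately have "(d * real (2 * n + 1) / 19) ^ 4 \<le> real (2 * n + 1) ^ 4 * measure \<mu> N" by linarith
  then have "real (2 * n + 1) ^ 4 * (d / 19) ^ 4 \<le> real (2 * n + 1) ^ 4 * measure \<mu> N"
    by (simp add: power_mult_distrib power_divide mult.commute)
  then show ?thesis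
    unfolding N_def[symmetric] by (subst (asm) mult_le_cancel_left_pos) auto
qed

text \<open>Translation of the neighbourhood of the identity by a diagonal element with \<open>Re g\<^sub>1\<^sub>1 = x\<close>.\<close>

lemma measure_near_point:
  assumes d: "0 < d" "d \<le> 1" and x: "\<bar>x\<bar> \<le> 1"
  shows "measure \<mu> {g \<in> SU2. \<bar>Re (g $ 1 $ 1) - x\<bar> \<le> d} \<ge> (d / 19) ^ 4"
    "{g \<in> SU2. \<bar>Re (g $ 1 $ 1) - x\<bar> \<le> d} \<in> sets \<mu>"
proof -
  let ?N = "{k \<in> SU2. cmod (k $ 1 $ 1 - 1) + cmod (k $ 2 $ 1) \<le> d}"
  let ?S = "{g \<in> SU2. \<bar>Re (g $ 1 $ 1) - x\<bar> \<le> d}"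
  let ?z = "cis (arccos x)"
  let ?h = "su2 (cnj ?z) 0"
  have h: "?h \<in> SU2" by (rule su2_in_SU2) simp
  have "(\<lambda>g. \<bar>Re (g $ 1 $ 1) - x\<bar>) \<in> borel_measurable \<mu>"
    by (intro measurable_continuous continuous_intros)
  then have "{g \<in> space \<mu>. \<bar>Re (g $ 1 $ 1) - x\<bar> \<le> d} \<in> sets \<mu>"
    by measurable
  then show S: "?S \<in> sets \<mu>" by simp
  have "(\<lambda>g. cmod (g $ 1 $ 1 - 1) + cmod (g $ 2 $ 1)) \<in> borel_measurable \<mu>"
    by (intro measurable_continuous continuous_intros)
  then have "{g \<in> space \<mu>. cmod (g $ 1 $ 1 - 1) + cmod (g $ 2 $ 1) \<le> d} \<in> sets \<mu>"
    by measurable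
  then have N: "?N \<in> sets \<mu>" by simp
  have "(\<lambda>g. ?h ** g) -` ?N \<inter> space \<mu> \<subseteq> ?S"
  proof
    fix g assume "g \<in> (\<lambda>g. ?h ** g) -` ?N \<inter> space \<mu>"
    then have g: "g \<in> SU2" "cmod ((?h ** g) $ 1 $ 1 - 1) + cmod ((?h ** g) $ 2 $ 1) \<le> d" by auto
    have "?h ** g = su2 (cnj ?z * g $ 1 $ 1) (?z * g $ 2 $ 1)"
      using SU2_eq_su2(1)[OF g(1)] by (metis (no_types, lifting) su2_mult complex_cnj_zero complex_cnj_cnj mult_zero_left diff_zero add_0)
    then have "cmod (cnj ?z * g $ 1 $ 1 - 1) \<le> d"
      using g(2) by (simp add: norm_mult) (smt (verit) norm_ge_zero)
    moreover have "cmod (g $ 1 $ 1 - ?z) = cmod (?z * (cnj ?z * g $ 1 $ 1 - 1))"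
    proof -
      have "?z * cnj ?z = 1" by (simp flip: complex_norm_square)
      then have "g $ 1 $ 1 - ?z = ?z * (cnj ?z * g $ 1 $ 1 - 1)"
        by (metis mult.assoc mult_1 mult.right_neutral right_diff_distrib)
      then show ?thesis by simp
    qed
    ultimately have "cmod (g $ 1 $ 1 - ?z) \<le> d"
      by (simp add: norm_mult)
    then have "\<bar>Re (g $ 1 $ 1 - ?z)\<bar> \<le> d"
      using abs_Re_le_cmod order.trans by blast
    then show "g \<in> ?S" using g(1) x by simp
  qed
  then have "measure \<mu> ((\<lambda>g. ?h ** g) -` ?N \<inter> space \<mu>) \<le> measure \<mu> ?S"
    using S by (rule finite_measure_mono)
  moreover have "measure \<mu> ((\<lambda>g. ?h ** g) -` ?N \<inter> space \<mu>) = measure \<mu> ?N"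
    using measure_distr[OF measurable_mult_left[OF h] N] by (simp add: distr_mult_left[OF h])
  ultimately show "measure \<mu> ?S \<ge> (d / 19) ^ 4"
    using measure_near_identity[OF d] by linarith
qed

end




section \<open>Maxima of the Euler factors\<close>

lemma abs_exp_minus_linear_le: "\<bar>exp y - 1 - y\<bar> \<le> y\<^sup>2 * exp \<bar>y\<bar>" for y :: real
proof -
  obtain t where t: "\<bar>t\<bar> \<le> \<bar>y\<bar>" "exp y = (\<Sum>k<2. y ^ k / fact k) + exp t / fact 2 * y ^ 2"
    using Maclaurin_exp_le[of y 2] by auto
  have "exp y - 1 - y = exp t / 2 * y\<^sup>2"
    using t(2) by (simp add: numeral_2_eq_2)
  moreover have "exp t / 2 \<le> exp \<bar>y\<bar>"
  proof -
    have "exp t \<le> exp \<bar>y\<bar>" using t(1) by simp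
    then show ?thesis using exp_gt_zero[of t] by linarith
  qed
  then have "exp t / 2 * y\<^sup>2 \<le> exp \<bar>y\<bar> * y\<^sup>2"
    by (rule mult_right_mono) simp
  moreover have "0 \<le> exp t / 2 * y\<^sup>2" by simp
  ultimately show ?thesis by (simp only: mult.commute abs_of_nonneg)
qed

lemma (in prob_space) abs_integral_le:
  fixes f :: "'a \<Rightarrow> real"
  assumes "\<And>x. x \<in> space M \<Longrightarrow> \<bar>f x\<bar> \<le> B"
  shows "\<bar>LINT x|M. f x\<bar> \<le> B"
proof -
  have "B \<ge> 0" using assms not_empty by fastforce
  have "\<bar>LINT x|M. f x\<bar> \<le> (LINT x|M. \<bar>f x\<bar>)"
    by (rule integral_abs_bound)
  also have "\<dots> \<le> (LINT x|M. B)"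
    using assms \<open>B \<ge> 0\<close> by (intro integral_mono') auto
  finally show ?thesis by (simp add: prob_space)
qed

text \<open>Bounds for finite blocks beyond \<open>N\<close>, uniform in their length, are what the estimates over
  primes provide; they give convergence and the size of the tail at once.\<close>

lemma abs_suminf_tail_le:
  fixes c :: "nat \<Rightarrow> real"
  assumes T: "\<And>N'. N' \<ge> N \<Longrightarrow> (\<Sum>n\<in>{N<..N'}. \<bar>c n\<bar>) \<le> T"
  shows "summable c" "\<bar>\<Sum>k. c (k + Suc N)\<bar> \<le> T"
proof -
  have part: "(\<Sum>k<n. \<bar>c (k + Suc N)\<bar>) \<le> T" for n
  proof -
    have "(\<Sum>k<n. \<bar>c (k + Suc N)\<bar>) = (\<Sum>k\<in>{N<..N + n}. \<bar>c k\<bar>)"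
      by (rule sum.reindex_bij_witness[of _ "\<lambda>k. k - Suc N" "\<lambda>k. k + Suc N"]) auto
    then show ?thesis using T[of "N + n"] by simp
  qed
  have s: "summable (\<lambda>k. \<bar>c (k + Suc N)\<bar>)"
    by (rule summableI_nonneg_bounded[OF _ part]) simp
  then have "summable (\<lambda>k. c (k + Suc N))" by (rule summable_rabs_cancel)
  then show "summable c" by (subst (asm) summable_iff_shift)
  have "\<bar>\<Sum>k. c (k + Suc N)\<bar> \<le> (\<Sum>k. \<bar>c (k + Suc N)\<bar>)"
    by (rule summable_rabs[OF s])
  also have "\<dots> \<le> T" by (rule suminf_le_const[OF s part])
  finally show "\<bar>\<Sum>k. c (k + Suc N)\<bar> \<le> T" .
qed

text \<open>The expression under the sum that defines \<^const>\<open>Sym1_const\<close>. It equals the maximum of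
  \<open>\<sigma> log D(1/p, Sym\<^sup>m, g)\<close>; the two signs outside and inside the logarithm turn the minimum of \<open>D\<close>
  for \<open>\<sigma> = -1\<close> into a maximum.\<close>

definition max_log :: "real \<Rightarrow> nat \<Rightarrow> nat \<Rightarrow> real" where
  "max_log \<sigma> m p = \<sigma> * ln (\<sigma> * (GREATEST v. v \<in> (\<lambda>g. \<sigma> * Re (D_fac (1 / of_nat p) (sym_rep m) g)) ` SU2))"

lemma inverse_prime_bounds:
  assumes "prime p"
  shows "0 < 1 / real p" "1 / real p \<le> 1 / 2"
  using prime_ge_2_nat[OF assms] by (auto simp: field_simps)

lemma max_log_attained:
  assumes \<sigma>: "\<sigma> \<in> {1, -1}" and p: "prime p"
  obtains x where "\<bar>x\<bar> \<le> 1" "max_log \<sigma> m p = \<sigma> * sym_log m (1 / real p) x"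
    "\<And>y. \<bar>y\<bar> \<le> 1 \<Longrightarrow> \<sigma> * sym_log m (1 / real p) y \<le> max_log \<sigma> m p"
proof -
  note X = inverse_prime_bounds[OF p]
  let ?l = "sym_log m (1 / real p)"
  have "(\<lambda>g. \<sigma> * Re (D_fac (1 / of_nat p) (sym_rep m) g)) ` SU2 = (\<lambda>g. \<sigma> * exp (?l (Re (g $ 1 $ 1)))) ` SU2"
  proof (intro image_cong refl)
    fix g assume g: "g \<in> SU2"
    have "D_fac (of_real (1 / real p)) (sym_rep m) g = of_real (exp (?l (Re (g $ 1 $ 1))))"
      using X by (intro D_fac_sym_rep_SU2 g) auto
    then show "\<sigma> * Re (D_fac (1 / of_nat p) (sym_rep m) g) = \<sigma> * exp (?l (Re (g $ 1 $ 1)))"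
      by simp
  qed
  moreover have "continuous_on {-1..1} (\<lambda>x. \<sigma> * exp (?l x))"
    using X by (intro continuous_intros continuous_on_sym_log) auto
  from Greatest_continuous_SU2[OF this] obtain x where x: "\<bar>x\<bar> \<le> 1"
      "(GREATEST v. v \<in> (\<lambda>g. \<sigma> * exp (?l (Re (g $ 1 $ 1)))) ` SU2) = \<sigma> * exp (?l x)"
      "\<And>y. \<bar>y\<bar> \<le> 1 \<Longrightarrow> \<sigma> * exp (?l y) \<le> \<sigma> * exp (?l x)"
    by blast
  ultimately have "max_log \<sigma> m p = \<sigma> * ?l x"
    using \<sigma> by (auto simp: max_log_def)
  then show thesis
    using x \<sigma> by (intro that[of x]) auto
qed

lemma Sym_const_attained:
  obtains x where "\<bar>x\<bar> \<le> 1" "Sym_const \<sigma> m = \<sigma> * sym_char m x"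
    "\<And>y. \<bar>y\<bar> \<le> 1 \<Longrightarrow> \<sigma> * sym_char m y \<le> Sym_const \<sigma> m"
proof -
  have "(\<lambda>g. \<sigma> * Re (character (sym_rep m) g)) ` SU2 = (\<lambda>g. \<sigma> * sym_char m (Re (g $ 1 $ 1))) ` SU2"
    by (intro image_cong refl) (simp add: character_sym_rep_SU2)
  moreover have "continuous_on {-1..1} (\<lambda>x. \<sigma> * sym_char m x)"
    by (intro continuous_intros continuous_on_sym_char)
  from Greatest_continuous_SU2[OF this] obtain x where x: "\<bar>x\<bar> \<le> 1"
      "(GREATEST v. v \<in> (\<lambda>g. \<sigma> * sym_char m (Re (g $ 1 $ 1))) ` SU2) = \<sigma> * sym_char m x"
      "\<And>y. \<bar>y\<bar> \<le> 1 \<Longrightarrow> \<sigma> * sym_char m y \<le> \<sigma> * sym_char m x"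
    by blast
  ultimately show thesis
    by (intro that[of x]) (auto simp: Sym_const_def)
qed

text \<open>Taking maxima does not increase the uniform distance between \<open>sym_log m X\<close> and
  \<open>X sym_char m\<close>.\<close>

lemma max_log_approx:
  assumes \<sigma>: "\<sigma> \<in> {1, -1}" and p: "prime p"
  shows "\<bar>max_log \<sigma> m p - Sym_const \<sigma> m / real p\<bar> \<le> 13 * (real m + 1) / (real p)\<^sup>2"
proof -
  note X = inverse_prime_bounds[OF p]
  let ?X = "1 / real p" and ?E = "13 * (real m + 1) / (real p)\<^sup>2"
  obtain x where x: "\<bar>x\<bar> \<le> 1" "max_log \<sigma> m p = \<sigma> * sym_log m ?X x"
    "\<And>y. \<bar>y\<bar> \<le> 1 \<Longrightarrow> \<sigma> * sym_log m ?X y \<le> max_log \<sigma> m p"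
    using max_log_attained[OF \<sigma> p, of m] by blast
  obtain z where z: "\<bar>z\<bar> \<le> 1" "Sym_const \<sigma> m = \<sigma> * sym_char m z"
    "\<And>y. \<bar>y\<bar> \<le> 1 \<Longrightarrow> \<sigma> * sym_char m y \<le> Sym_const \<sigma> m"
    using Sym_const_attained[of \<sigma> m] by blast
  have ap: "\<bar>\<sigma> * sym_log m ?X y - ?X * (\<sigma> * sym_char m y)\<bar> \<le> ?E" for y
  proof -
    have "\<bar>sym_log m ?X y - ?X * sym_char m y\<bar> \<le> ?E"
      using sym_log_approx[of ?X m y] X by (simp add: power_divide)
    moreover have "\<sigma> * sym_log m ?X y - ?X * (\<sigma> * sym_char m y) = \<sigma> * (sym_log m ?X y - ?X * sym_char m y)"
      by (simp add: algebra_simps)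
    moreover have "\<bar>\<sigma>\<bar> = 1" using \<sigma> by auto
    ultimately show ?thesis by (simp only: abs_mult mult_1)
  qed
  have "?X * (\<sigma> * sym_char m x) \<le> ?X * Sym_const \<sigma> m"
    using X z(3)[OF x(1)] by (intro mult_left_mono) auto
  then have "max_log \<sigma> m p \<le> ?X * Sym_const \<sigma> m + ?E"
    using ap[of x] x(2) by linarith
  moreover have "?X * Sym_const \<sigma> m \<le> max_log \<sigma> m p + ?E"
    unfolding z(2) using ap[of z] x(3)[OF z(1)] by linarith
  ultimately show ?thesis by simp
qed

section \<open>Moments with a weight\<close>

text \<open>The assumptions on the weight \<open>W\<close> are what the two Euler products have in common: the first
  representation enters only through them.\<close>

locale weighted_moment = haar_SU2 +
  fixes m :: nat and \<sigma> :: real and W :: "nat \<Rightarrow> complex^2^2 \<Rightarrow> real" and K0 :: real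
  assumes m: "m \<ge> 1" and sign: "\<sigma> \<in> {1, -1}"
    and continuous_W: "prime p \<Longrightarrow> continuous_on SU2 (W p)"
    and W_bounds: "prime p \<Longrightarrow> g \<in> SU2 \<Longrightarrow> 1 / K0 \<le> W p g" "prime p \<Longrightarrow> g \<in> SU2 \<Longrightarrow> W p g \<le> K0"
    and W_near_one: "prime p \<Longrightarrow> g \<in> SU2 \<Longrightarrow> \<bar>W p g - 1\<bar> \<le> K0 / sqrt (real p)"
    and W_integral: "prime p \<Longrightarrow> \<bar>(LINT g|\<mu>. W p g) - 1\<bar> \<le> K0 / (real p * sqrt (real p))"
    and K0: "K0 \<ge> 1"
begin

definition moment :: "real \<Rightarrow> nat \<Rightarrow> real" where
  "moment r p = (LINT g|\<mu>. W p g * exp (\<sigma> * r * sym_log m (1 / real p) (Re (g $ 1 $ 1))))"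

lemma W_nonneg:
  assumes "prime p" "g \<in> SU2"
  shows "0 \<le> W p g"
proof -
  have "0 \<le> 1 / K0" using K0 by simp
  also have "\<dots> \<le> W p g" using assms by (rule W_bounds)
  finally show ?thesis .
qed

lemma continuous_integrand:
  assumes "prime p"
  shows "continuous_on SU2 (\<lambda>g. W p g * exp (\<sigma> * r * sym_log m (1 / real p) (Re (g $ 1 $ 1))))"
  using inverse_prime_bounds[OF assms]
  by (intro continuous_intros continuous_W assms continuous_on_Re_entry continuous_on_sym_log) auto

text \<open>Laplace's method with a Lipschitz bound instead of a second derivative. On the ball of radius
  \<open>\<delta> = p / (K r)\<close> around a maximum the exponent loses at most \<open>r \<cdot> L / p \<cdot> \<delta> = L / K\<close>, and the measure
  of the ball contributes the logarithmic term.\<close>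

lemma moment_small_prime:
  assumes p: "prime p" and r: "r > 0" and K: "K \<ge> 1" "real p \<le> K * r"
  shows "\<bar>ln (moment r p) - r * max_log \<sigma> m p\<bar>
      \<le> ln K0 + 4 * (real m + 1) * (real m)\<^sup>2 + 4 * ln 19 + 4 * ln (K * r / real p)" "moment r p > 0"
proof -
  note X = inverse_prime_bounds[OF p]
  let ?X = "1 / real p"
  let ?l = "sym_log m ?X"
  define F where "F = (\<lambda>g. W p g * exp (\<sigma> * r * ?l (Re (g $ 1 $ 1))))"
  define L where "L = 4 * (real m + 1) * (real m)\<^sup>2"
  define \<delta> where "\<delta> = real p / (K * r)"
  have p0: "real p > 0" using p prime_gt_0_nat by simp
  have \<delta>: "0 < \<delta>" "\<delta> \<le> 1" using p0 r K by (auto simp: \<delta>_def)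
  have intF: "integrable \<mu> F"
    unfolding F_def by (intro integrable_continuous continuous_integrand p)
  have L0: "L \<ge> 0" by (simp add: L_def)
  obtain x where x: "\<bar>x\<bar> \<le> 1" "max_log \<sigma> m p = \<sigma> * ?l x"
    "\<And>y. \<bar>y\<bar> \<le> 1 \<Longrightarrow> \<sigma> * ?l y \<le> max_log \<sigma> m p"
    using max_log_attained[OF sign p, of m] by blast
  let ?lam = "max_log \<sigma> m p"
  have upper: "moment r p \<le> K0 * exp (r * ?lam)"
  proof -
    have "F g \<le> K0 * exp (r * ?lam)" if g: "g \<in> SU2" for g
      unfolding F_def
    proof (intro mult_mono W_bounds p g)
      have "r * (\<sigma> * ?l (Re (g $ 1 $ 1))) \<le> r * ?lam"
        using r x(3)[OF SU2_Re_bound[OF g]] by (intro mult_left_mono) auto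
      then show "exp (\<sigma> * r * ?l (Re (g $ 1 $ 1))) \<le> exp (r * ?lam)"
        by (simp add: mult_ac)
    qed (use K0 in auto)
    then have "(LINT g|\<mu>. F g) \<le> (LINT g|\<mu>. K0 * exp (r * ?lam))"
      by (intro integral_mono intF) auto
    then show ?thesis by (simp add: moment_def F_def prob_space del: space_haar)
  qed
  define S where "S = {g \<in> SU2. \<bar>Re (g $ 1 $ 1) - x\<bar> \<le> \<delta>}"
  have S: "measure \<mu> S \<ge> (\<delta> / 19) ^ 4" "S \<in> sets \<mu>"
    unfolding S_def using measure_near_point[OF \<delta> x(1)] by auto
  let ?b = "1 / K0 * exp (r * ?lam - L)"
  have lower: "moment r p \<ge> ?b * (\<delta> / 19) ^ 4"
  proof -
    have le: "indicator S g * ?b \<le> F g" if g: "g \<in> SU2" for g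
    proof (cases "g \<in> S")
      case True
      have "\<bar>?l (Re (g $ 1 $ 1)) - ?l x\<bar> \<le> L * ?X * \<bar>Re (g $ 1 $ 1) - x\<bar>"
        unfolding L_def using X by (intro sym_log_lipschitz SU2_Re_bound g x(1)) auto
      also have "\<dots> \<le> L * ?X * \<delta>"
        using True X L0 by (intro mult_left_mono) (auto simp: S_def)
      finally have "r * \<bar>?l (Re (g $ 1 $ 1)) - ?l x\<bar> \<le> r * (L * ?X * \<delta>)"
        using r by (intro mult_left_mono) auto
      also have "\<dots> = L / K" using r p0 by (simp add: \<delta>_def)
      also have "\<dots> \<le> L" using K L0 by (simp add: divide_le_eq mult_le_cancel_left1)
      finally have le: "r * \<bar>?l (Re (g $ 1 $ 1)) - ?l x\<bar> \<le> L" .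
      have "\<sigma> * r * ?l (Re (g $ 1 $ 1)) - r * ?lam = \<sigma> * (r * (?l (Re (g $ 1 $ 1)) - ?l x))"
        unfolding x(2) by (simp add: right_diff_distrib)
      then have "\<bar>\<sigma> * r * ?l (Re (g $ 1 $ 1)) - r * ?lam\<bar> = r * \<bar>?l (Re (g $ 1 $ 1)) - ?l x\<bar>"
        using sign r by (auto simp: abs_mult)
      then have "exp (r * ?lam - L) \<le> exp (\<sigma> * r * ?l (Re (g $ 1 $ 1)))" using le by simp
      then have "?b \<le> F g"
        unfolding F_def using W_bounds(1)[OF p g] W_nonneg[OF p g] by (intro mult_mono) auto
      then show ?thesis using True by simp
    next
      case False
      then show ?thesis using W_nonneg[OF p g] by (simp add: F_def)
    qed
    have ind: "integrable \<mu> (indicator S :: _ \<Rightarrow> real)"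
      using S(2) by (rule integrable_real_indicator) (simp add: emeasure_eq_measure)
    have "(LINT g|\<mu>. indicator S g * ?b) \<le> (LINT g|\<mu>. F g)"
    proof (rule integral_mono)
      show "integrable \<mu> (\<lambda>g. indicator S g * ?b)" by (rule integrable_mult_left) (rule ind)
    qed (use intF le in simp_all)
    moreover have "(LINT g|\<mu>. indicator S g * ?b) = measure \<mu> S * ?b"
    proof -
      have "(LINT g|\<mu>. indicator S g * ?b) = (LINT g|\<mu>. indicator S g) * ?b"
        by (rule Bochner_Integration.integral_mult_left) (rule ind)
      also have "S \<inter> SU2 = S" by (auto simp: S_def)
      then have "(LINT g|\<mu>. indicator S g) = measure \<mu> S" by simp
      finally show ?thesis .
    qed
    moreover have "(\<delta> / 19) ^ 4 * ?b \<le> measure \<mu> S * ?b"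
      using S(1) K0 by (intro mult_right_mono) auto
    moreover have "moment r p = (LINT g|\<mu>. F g)" by (simp add: moment_def F_def)
    ultimately show ?thesis by (simp only: mult.commute)
  qed
  have bpos: "?b * (\<delta> / 19) ^ 4 > 0" using K0 \<delta> by auto
  then show pos: "moment r p > 0" using lower by linarith
  have "ln (moment r p) \<le> ln (K0 * exp (r * ?lam))"
    using pos upper by (subst ln_le_cancel_iff) auto
  also have "\<dots> = ln K0 + r * ?lam" using K0 by (simp add: ln_mult_pos)
  finally have 1: "ln (moment r p) - r * ?lam \<le> ln K0" by simp
  have "ln (?b * (\<delta> / 19) ^ 4) \<le> ln (moment r p)"
    using pos lower bpos by (subst ln_le_cancel_iff) auto
  also have "ln (?b * (\<delta> / 19) ^ 4) = - ln K0 + (r * ?lam - L) + 4 * (ln \<delta> - ln 19)"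
  proof -
    have "ln (?b * (\<delta> / 19) ^ 4) = ln ?b + ln ((\<delta> / 19) ^ 4)"
      using K0 \<delta> by (intro ln_mult_pos) auto
    moreover have "ln ?b = ln (1 / K0) + ln (exp (r * ?lam - L))"
      using K0 by (intro ln_mult_pos) auto
    moreover have "ln (1 / K0) = - ln K0"
      using K0 by (simp add: ln_divide_pos)
    moreover have "ln ((\<delta> / 19) ^ 4) = 4 * ln (\<delta> / 19)"
      by (simp add: ln_realpow)
    moreover have "ln (\<delta> / 19) = ln \<delta> - ln 19"
      using \<delta> by (simp add: ln_divide_pos)
    ultimately show ?thesis by (simp only: ln_exp)
  qed
  also have "ln \<delta> = - ln (K * r / real p)"
  proof -
    have "\<delta> = inverse (K * r / real p)" by (simp add: \<delta>_def)
    then show ?thesis by (simp only: ln_inverse)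
  qed
  finally have 2: "- (ln K0 + L + 4 * ln 19 + 4 * ln (K * r / real p)) \<le> ln (moment r p) - r * ?lam"
    by (simp add: algebra_simps)
  have "0 \<le> ln (K * r / real p)" "0 \<le> ln (19::real)"
    using p0 K by simp_all
  with 1 2 L0 show "\<bar>ln (moment r p) - r * max_log \<sigma> m p\<bar>
      \<le> ln K0 + 4 * (real m + 1) * (real m)\<^sup>2 + 4 * ln 19 + 4 * ln (K * r / real p)"
    unfolding L_def[symmetric] by linarith
qed

text \<open>\<open>M\<close> bounds \<open>\<bar>sym_log m X x\<bar> / X\<close>, hence also the exponent of the moment when \<open>r \<le> p\<close>.\<close>

definition M :: real where "M = 14 * (real m + 1)"
definition B :: real where "B = K0 * (1 + M + M\<^sup>2 * exp M)"

lemma M_ge: "M \<ge> 14" and B_ge: "B \<ge> 1"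
proof -
  show "M \<ge> 14" by (simp add: M_def)
  then have "1 * 1 \<le> K0 * (1 + M + M\<^sup>2 * exp M)" using K0 by (intro mult_mono) auto
  then show "B \<ge> 1" by (simp add: B_def)
qed

text \<open>With \<open>y\<close> the exponent, \<open>W e\<^sup>y - W - \<sigma> r X \<chi> = (W - 1) \<sigma> r X \<chi> + W (y - \<sigma> r X \<chi>) + W (e\<^sup>y - 1 - y)\<close>.
  The subtracted linear term integrates to zero; the first summand is of order \<open>r p\<^sup>-\<^sup>3\<^sup>/\<^sup>2\<close>, and the
  other two are of order \<open>r\<^sup>2 p\<^sup>-\<^sup>2\<close>.\<close>

lemma moment_large_prime:
  assumes p: "prime p" and r: "r \<ge> 1" "r \<le> real p"
  shows "\<bar>moment r p - 1\<bar> \<le> B * (r / (real p * sqrt (real p)) + r\<^sup>2 / (real p)\<^sup>2)"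
proof -
  note X = inverse_prime_bounds[OF p]
  define X where "X = 1 / real p"
  have X': "0 < X" "X \<le> 1 / 2" "r * X \<le> 1"
    using X r by (auto simp: X_def)
  let ?l = "\<lambda>g :: complex^2^2. sym_log m X (Re (g $ 1 $ 1))"
  let ?c = "\<lambda>g :: complex^2^2. sym_char m (Re (g $ 1 $ 1))"
  let ?y = "\<lambda>g. \<sigma> * r * ?l g"
  define s where "s = 1 / sqrt (real p)"
  have rX: "0 \<le> r * X" using r X' by simp
  have sg: "\<bar>\<sigma>\<bar> = 1" using sign by auto
  have M1: "real m + 1 \<le> M" "13 * (real m + 1) \<le> M" by (auto simp: M_def)
  have dl: "\<bar>?y g - \<sigma> * r * X * ?c g\<bar> \<le> M * (r * X)\<^sup>2" for g
  proof -
    have "\<bar>?y g - \<sigma> * r * X * ?c g\<bar> = r * \<bar>?l g - X * ?c g\<bar>"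
    proof -
      have "?y g - \<sigma> * r * X * ?c g = \<sigma> * (r * (?l g - X * ?c g))" by (simp add: algebra_simps)
      then show ?thesis using r sg by (simp only: abs_mult)
    qed
    also have "\<dots> \<le> r * (13 * (real m + 1) * X\<^sup>2)"
      using r X' by (intro mult_left_mono sym_log_approx) auto
    also have "\<dots> \<le> r * (M * X\<^sup>2)"
      using r M1 by (intro mult_left_mono mult_right_mono) auto
    also have "\<dots> \<le> (r * r) * (M * X\<^sup>2)"
      using r M_ge by (intro mult_right_mono) auto
    finally show ?thesis by (simp add: power_mult_distrib power2_eq_square mult_ac)
  qed
  have yb: "\<bar>?y g\<bar> \<le> M * (r * X)" for g
  proof -
    have "\<bar>?l g\<bar> \<le> X * (real m + 1) + 13 * (real m + 1) * X\<^sup>2"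
    proof -
      have "\<bar>X * ?c g\<bar> \<le> X * (real m + 1)"
        unfolding abs_mult using X' sym_char_bound by (intro mult_mono) auto
      moreover have "\<bar>?l g - X * ?c g\<bar> \<le> 13 * (real m + 1) * X\<^sup>2"
        using X' by (intro sym_log_approx) auto
      ultimately show ?thesis by linarith
    qed
    also have "\<dots> \<le> X * (real m + 1) + 13 * (real m + 1) * (X * 1)"
      unfolding power2_eq_square using X' by (intro add_mono mult_left_mono) auto
    also have "\<dots> = M * X" by (simp add: M_def algebra_simps)
    finally have "r * \<bar>?l g\<bar> \<le> r * (M * X)" using r by (intro mult_left_mono) auto
    moreover have "\<bar>?y g\<bar> = r * \<bar>?l g\<bar>" using r sg by (simp add: abs_mult)
    ultimately show ?thesis by (simp only: mult_ac)
  qed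
  have eb: "\<bar>exp (?y g) - 1 - ?y g\<bar> \<le> M\<^sup>2 * exp M * (r * X)\<^sup>2" for g
  proof -
    have "M * (r * X) \<le> M * 1" using X' M_ge by (intro mult_left_mono) auto
    then have "\<bar>?y g\<bar> \<le> M" using yb[of g] by linarith
    have "(?y g)\<^sup>2 * exp \<bar>?y g\<bar> \<le> (M * (r * X))\<^sup>2 * exp M"
    proof (intro mult_mono)
      show "(?y g)\<^sup>2 \<le> (M * (r * X))\<^sup>2"
        using yb[of g] by (metis abs_ge_zero power2_abs power_mono)
    qed (use \<open>\<bar>?y g\<bar> \<le> M\<close> in auto)
    then show ?thesis using abs_exp_minus_linear_le[of "?y g"] by (simp add: power_mult_distrib mult_ac)
  qed
  define E where "E = K0 * (real m + 1) * (r * X * s) + K0 * (M + M\<^sup>2 * exp M) * (r * X)\<^sup>2"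
  have pt: "\<bar>W p g * exp (?y g) - W p g - \<sigma> * r * X * ?c g\<bar> \<le> E" if g: "g \<in> SU2" for g
  proof -
    have "W p g * exp (?y g) - W p g - \<sigma> * r * X * ?c g
        = (W p g - 1) * (\<sigma> * r * X * ?c g) + W p g * ((?y g - \<sigma> * r * X * ?c g) + (exp (?y g) - 1 - ?y g))"
      by (simp add: algebra_simps)
    moreover have "\<bar>(W p g - 1) * (\<sigma> * r * X * ?c g)\<bar> \<le> K0 * (real m + 1) * (r * X * s)"
    proof -
      have "\<bar>(W p g - 1) * (\<sigma> * r * X * ?c g)\<bar> = \<bar>W p g - 1\<bar> * ((r * X) * \<bar>?c g\<bar>)"
        using r X' sg by (simp add: abs_mult mult.assoc)
      also have "\<dots> \<le> (K0 / sqrt (real p)) * ((r * X) * (real m + 1))"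
        using W_near_one[OF p g] sym_char_bound rX K0 by (intro mult_mono mult_left_mono) auto
      finally show ?thesis by (simp add: s_def mult_ac)
    qed
    moreover have "\<bar>W p g * ((?y g - \<sigma> * r * X * ?c g) + (exp (?y g) - 1 - ?y g))\<bar>
        \<le> K0 * (M * (r * X)\<^sup>2 + M\<^sup>2 * exp M * (r * X)\<^sup>2)"
    proof -
      have "\<bar>(?y g - \<sigma> * r * X * ?c g) + (exp (?y g) - 1 - ?y g)\<bar> \<le> M * (r * X)\<^sup>2 + M\<^sup>2 * exp M * (r * X)\<^sup>2"
        using dl[of g] eb[of g] by (intro order.trans[OF abs_triangle_ineq add_mono])
      then show ?thesis
        unfolding abs_mult using W_nonneg[OF p g] W_bounds(2)[OF p g] K0 by (intro mult_mono) auto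
    qed
    ultimately show ?thesis
      unfolding E_def by (simp add: distrib_left distrib_right)
  qed
  have int: "integrable \<mu> (\<lambda>g. W p g * exp (?y g))" "integrable \<mu> (W p)" "integrable \<mu> (\<lambda>g. \<sigma> * r * X * ?c g)"
    unfolding X_def using p continuous_on_Re_entry[OF continuous_on_sym_char]
    by (auto intro!: integrable_continuous continuous_integrand continuous_W continuous_intros simp del: integrable_mult_right)
  have "(LINT g|\<mu>. W p g * exp (?y g) - W p g - \<sigma> * r * X * ?c g) = moment r p - (LINT g|\<mu>. W p g)"
    using int integral_sym_char_eq_0[OF m] by (simp add: moment_def X_def)
  then have "\<bar>moment r p - (LINT g|\<mu>. W p g)\<bar> \<le> E"
    using abs_integral_le[of "\<lambda>g. W p g * exp (?y g) - W p g - \<sigma> * r * X * ?c g" E] pt by simp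
  moreover have "\<bar>(LINT g|\<mu>. W p g) - 1\<bar> \<le> K0 * (r * X * s)"
  proof -
    have "1 * (K0 / (real p * sqrt (real p))) \<le> r * (K0 / (real p * sqrt (real p)))"
      using r K0 by (intro mult_right_mono) auto
    then show ?thesis using W_integral[OF p] by (simp add: X_def s_def mult_ac)
  qed
  ultimately have "\<bar>moment r p - 1\<bar> \<le> K0 * (r * X * s) + E" by linarith
  also have "\<dots> = K0 * (1 + (real m + 1)) * (r * X * s) + K0 * (M + M\<^sup>2 * exp M) * (r * X)\<^sup>2"
    by (simp add: E_def algebra_simps)
  also have "\<dots> \<le> B * (r * X * s) + B * (r * X)\<^sup>2"
  proof (intro add_mono mult_right_mono)
    have "0 \<le> M\<^sup>2 * exp M" by simp
    then have "1 + (real m + 1) \<le> 1 + M + M\<^sup>2 * exp M" "M + M\<^sup>2 * exp M \<le> 1 + M + M\<^sup>2 * exp M"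
      using M1 by linarith+
    then show "K0 * (1 + (real m + 1)) \<le> B" "K0 * (M + M\<^sup>2 * exp M) \<le> B"
      unfolding B_def using K0 by (auto intro!: mult_left_mono)
  qed (use rX in \<open>auto simp: s_def\<close>)
  also have "\<dots> = B * (r / (real p * sqrt (real p)) + r\<^sup>2 / (real p)\<^sup>2)"
    by (simp add: X_def s_def distrib_left power_divide)
  finally show ?thesis .
qed

text \<open>Chosen so that the bound of \<open>moment_large_prime\<close> is at most \<open>1/2\<close> beyond \<open>cutoff * r\<close>, which
  keeps the logarithm under control.\<close>

definition cutoff :: real where "cutoff = 4 * B"

lemma abs_ln_moment_large_prime:
  assumes p: "prime p" and r: "r \<ge> 1" "cutoff * r \<le> real p"
  shows "moment r p > 0"
    "\<bar>ln (moment r p)\<bar> \<le> 2 * B * (r / (real p * sqrt (real p)) + r\<^sup>2 / (real p)\<^sup>2)"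
proof -
  have p0: "real p \<ge> 1" using prime_ge_2_nat[OF p] by simp
  have "1 * r \<le> cutoff * r" using r B_ge by (intro mult_right_mono) (auto simp: cutoff_def)
  then have rp: "r \<le> real p" using r(2) by linarith
  define q where "q = r / real p"
  have q: "0 \<le> q" "cutoff * q \<le> 1" "q \<le> 1" using r rp p0 by (auto simp: q_def field_simps)
  let ?e = "r / (real p * sqrt (real p)) + r\<^sup>2 / (real p)\<^sup>2"
  have "?e \<le> q + q"
  proof (rule add_mono)
    have "r / (real p * sqrt (real p)) = q / sqrt (real p)" by (simp add: q_def)
    also have "\<dots> \<le> q / 1" using q p0 by (intro divide_left_mono) auto
    finally show "r / (real p * sqrt (real p)) \<le> q" by simp
    have "r\<^sup>2 / (real p)\<^sup>2 = q * q" by (simp add: q_def power2_eq_square)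
    also have "\<dots> \<le> q * 1" using q by (intro mult_left_mono) auto
    finally show "r\<^sup>2 / (real p)\<^sup>2 \<le> q" by simp
  qed
  then have "B * ?e \<le> B * (q + q)" using B_ge by (intro mult_left_mono) auto
  also have "\<dots> \<le> 1 / 2" using q(2) by (simp add: cutoff_def)
  finally have half: "B * ?e \<le> 1 / 2" .
  have m1: "\<bar>moment r p - 1\<bar> \<le> B * ?e" by (rule moment_large_prime[OF p r(1) rp])
  then have ge: "1 / 2 \<le> moment r p" using half unfolding abs_le_iff by linarith
  then show "moment r p > 0" by simp
  have "\<bar>ln (moment r p) - ln 1\<bar> \<le> \<bar>moment r p - 1\<bar> / (1 / 2)"
    using ge by (intro abs_ln_diff_le) auto
  then show "\<bar>ln (moment r p)\<bar> \<le> 2 * B * ?e" using m1 by simp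
qed

lemma cutoff_ge: "cutoff \<ge> 4"
  using B_ge by (simp add: cutoff_def)

lemma moment_pos:
  assumes "prime p" "r \<ge> 1"
  shows "moment r p > 0"
  using moment_small_prime(2)[of p r cutoff] abs_ln_moment_large_prime(1)[of p r] assms cutoff_ge
  by (cases "real p \<le> cutoff * r") auto

text \<open>With \<open>N = \<lfloor>K r\<rfloor>\<close> the difference of the two sides is
  \<open>\<Sum>\<^bsub>p \<le> N\<^esub> (ln I\<^sub>p - r \<lambda>\<^sub>p) + r S (\<Sum>\<^bsub>p \<le> N\<^esub> 1/p - ln ln (K r) - \<gamma>) + r S (ln ln (K r) - ln ln r)\<close> plus a tail over
  \<open>p > N\<close> of terms \<open>ln I\<^sub>p - r (\<lambda>\<^sub>p - S/p)\<close>. Each of the four parts is \<open>O(r / ln r)\<close>.\<close>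

lemma euler_sum_asymptotics:
  defines "a \<equiv> \<lambda>r p. if prime p then ln (moment r p) else 0"
  shows "\<And>r. r \<ge> 2 \<Longrightarrow> summable (a r)"
    and "\<exists>C. \<forall>r\<ge>2. \<bar>(\<Sum>p. a r p) - (Sym_const \<sigma> m * r * ln (ln r) + Sym1_const \<sigma> m * r)\<bar> \<le> C * (r / ln r)"
proof -
  define S where "S = Sym_const \<sigma> m"
  define b where "b = (\<lambda>p. if prime p then max_log \<sigma> m p - S / real p else 0)"
  define C0 where "C0 = 13 * (real m + 1)"
  define A where "A = ln K0 + 4 * (real m + 1) * (real m)\<^sup>2 + 4 * ln 19"
  define C2 where "C2 = 2 * B + C0"
  have A0: "A \<ge> 0" using K0 by (simp add: A_def)
  have C0: "C0 \<ge> 0" by (simp add: C0_def)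
  then have C2: "C2 \<ge> 0" using B_ge by (simp add: C2_def)
  obtain C1 where C1: "\<And>x. x \<ge> 2 \<Longrightarrow>
      \<bar>(\<Sum>p | prime p \<and> real p \<le> x. 1 / real p) - ln (ln x) - mertens_const\<bar> \<le> C1 / ln x"
    using mertens_const_spec by blast
  have b_bound: "\<bar>b p\<bar> \<le> C0 / (real p)\<^sup>2" for p
    using max_log_approx[OF sign, of p m] C0 by (auto simp: b_def S_def C0_def)
  have sum_sq: "(\<Sum>n\<in>{N<..N'}. if prime n then 1 / (real n)\<^sup>2 else 0) \<le> 12 / (real N * ln (real N))"
    if "2 \<le> N" "N \<le> N'" for N N'
  proof -
    have "(\<Sum>n\<in>{N<..N'}. if prime n then 1 / (real n)\<^sup>2 else 0) = (\<Sum>p | prime p \<and> N < p \<and> p \<le> N'. 1 / (real p)\<^sup>2)"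
      by (rule sum.mono_neutral_cong_right) auto
    then show ?thesis using sum_primes_inverse_squares_le[OF that] by simp
  qed
  have b_sum: "summable b"
  proof (rule abs_suminf_tail_le(1)[of 2])
    fix N' :: nat assume N': "2 \<le> N'"
    have "(\<Sum>n\<in>{2<..N'}. \<bar>b n\<bar>) \<le> (\<Sum>n\<in>{2<..N'}. C0 * (if prime n then 1 / (real n)\<^sup>2 else 0))"
    proof (rule sum_mono)
      fix n show "\<bar>b n\<bar> \<le> C0 * (if prime n then 1 / (real n)\<^sup>2 else 0)"
        using b_bound[of n] by (cases "prime n") (auto simp: b_def)
    qed
    also have "\<dots> \<le> C0 * (12 / (real 2 * ln (real 2)))"
      unfolding sum_distrib_left[symmetric] using C0 N' by (intro mult_left_mono sum_sq) auto
    finally show "(\<Sum>n\<in>{2<..N'}. \<bar>b n\<bar>) \<le> C0 * (12 / (real 2 * ln (real 2)))" .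
  qed
  have Sym1: "Sym1_const \<sigma> m = mertens_const * S + (\<Sum>p. b p)"
    unfolding Sym1_const_def b_def max_log_def S_def ..
  define T where "T = (\<lambda>r :: real. 4 * B * r / sqrt r + C2 * 12 * r / ln r)"
  have main: "summable (a r) \<and> \<bar>(\<Sum>p. a r p) - (S * r * ln (ln r) + Sym1_const \<sigma> m * r)\<bar>
      \<le> (A + 4) * 42 * cutoff * (r / ln r) + r * \<bar>S\<bar> * (C1 / ln (cutoff * r)) + r * \<bar>S\<bar> * (ln cutoff / ln r) + T r"
    if r: "r \<ge> 2" for r
  proof -
    define y where "y = cutoff * r"
    define N where "N = nat \<lfloor>y\<rfloor>"
    have "2 * r \<le> cutoff * r" using r cutoff_ge by (intro mult_right_mono) auto
    then have y: "y \<ge> r + 2" unfolding y_def using r by linarith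
    have N: "real N \<le> y" "y \<le> real N + 1" "\<And>p. real p \<le> y \<longleftrightarrow> p \<le> N"
      using y r by (auto simp: N_def le_nat_floor le_nat_iff le_floor_iff)
    have Nr: "r \<le> real N" "2 \<le> N" "y \<le> 2 * real N" using N(2) y r by simp_all
    have lnr: "0 < ln r" "ln r \<le> ln (real N)" using r Nr by auto
    \<comment> \<open>Beyond the cutoff both \<open>ln I\<^sub>p\<close> and \<open>\<lambda>\<^sub>p - S/p\<close> are small by themselves.\<close>
    define c where "c = (\<lambda>p. a r p - r * b p)"
    have tail: "(\<Sum>n\<in>{N<..N'}. \<bar>c n\<bar>) \<le> T r" if N': "N \<le> N'" for N'
    proof -
      have "\<bar>c n\<bar> \<le> 2 * B * r * (1 / (real n * sqrt (real n))) + C2 * r\<^sup>2 * (if prime n then 1 / (real n)\<^sup>2 else 0)"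
        if n: "n \<in> {N<..N'}" for n
      proof (cases "prime n")
        case True
        have "cutoff * r \<le> real n" using n N(3)[of n] by (auto simp: y_def)
        then have "\<bar>ln (moment r n)\<bar> \<le> 2 * B * (r / (real n * sqrt (real n)) + r\<^sup>2 / (real n)\<^sup>2)"
          using True r by (intro abs_ln_moment_large_prime) auto
        moreover have "\<bar>r * b n\<bar> \<le> C0 * r\<^sup>2 * (1 / (real n)\<^sup>2)"
        proof -
          have "\<bar>r * b n\<bar> = r * \<bar>b n\<bar>" using r by (simp add: abs_mult)
          also have "\<dots> \<le> (r * r) * (C0 / (real n)\<^sup>2)"
            using r b_bound[of n] by (intro mult_mono) auto
          finally show ?thesis by (simp add: power2_eq_square mult_ac)
        qed
        ultimately have "\<bar>c n\<bar> \<le> 2 * B * (r / (real n * sqrt (real n)) + r\<^sup>2 / (real n)\<^sup>2) + C0 * r\<^sup>2 * (1 / (real n)\<^sup>2)"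
          using True by (simp add: c_def a_def)
        then show ?thesis using True by (simp add: C2_def algebra_simps)
      next
        case False
        then show ?thesis using r B_ge by (simp add: c_def a_def b_def)
      qed
      then have "(\<Sum>n\<in>{N<..N'}. \<bar>c n\<bar>) \<le> (\<Sum>n\<in>{N<..N'}. 2 * B * r * (1 / (real n * sqrt (real n)))
            + C2 * r\<^sup>2 * (if prime n then 1 / (real n)\<^sup>2 else 0))"
        by (rule sum_mono)
      also have "\<dots> = 2 * B * r * (\<Sum>n\<in>{N<..N'}. 1 / (real n * sqrt (real n)))
            + C2 * r\<^sup>2 * (\<Sum>n\<in>{N<..N'}. if prime n then 1 / (real n)\<^sup>2 else 0)"
        by (simp only: sum.distrib sum_distrib_left)
      also have "\<dots> \<le> 2 * B * r * (2 / sqrt (real N)) + C2 * r\<^sup>2 * (12 / (real N * ln (real N)))"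
      proof (intro add_mono mult_left_mono)
        have "0 \<le> 2 / sqrt (real N')" by simp
        then show "(\<Sum>n\<in>{N<..N'}. 1 / (real n * sqrt (real n))) \<le> 2 / sqrt (real N)"
          using sum_inverse_three_halves_le[of N N'] Nr(2) N' by linarith
        show "(\<Sum>n\<in>{N<..N'}. if prime n then 1 / (real n)\<^sup>2 else 0) \<le> 12 / (real N * ln (real N))"
          by (rule sum_sq[OF Nr(2) N'])
      qed (use r B_ge C2 in auto)
      also have "\<dots> \<le> 2 * B * r * (2 / sqrt r) + C2 * r\<^sup>2 * (12 / (r * ln r))"
        using r B_ge C2 Nr lnr
        by (intro add_mono mult_left_mono divide_left_mono mult_mono) (auto intro!: mult_pos_pos)
      also have "\<dots> = T r" using r lnr by (simp add: T_def power2_eq_square mult_ac)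
      finally show ?thesis .
    qed
    have c_sum: "summable c" and c_tail: "\<bar>\<Sum>k. c (k + Suc N)\<bar> \<le> T r"
      using abs_suminf_tail_le[of N c "T r"] tail by auto
    have "summable (\<lambda>p. c p + r * b p)"
      by (intro summable_add c_sum summable_mult b_sum)
    then have a_sum: "summable (a r)" by (simp add: c_def)
    have "(\<Sum>p. c p) = (\<Sum>p. a r p) - (\<Sum>p. r * b p)"
      unfolding c_def by (rule suminf_diff[symmetric, OF a_sum summable_mult[OF b_sum]])
    also have "(\<Sum>p. r * b p) = r * (\<Sum>p. b p)"
      by (rule suminf_mult[OF b_sum])
    finally have "(\<Sum>p. a r p) = r * (\<Sum>p. b p) + (\<Sum>p. c p)" by simp
    also have "(\<Sum>p. c p) = (\<Sum>k. c (k + Suc N)) + (\<Sum>p<Suc N. c p)"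
      by (rule suminf_split_initial_segment[OF c_sum])
    also have "(\<Sum>p<Suc N. c p) = (\<Sum>p | prime p \<and> p \<le> N. ln (moment r p) - r * max_log \<sigma> m p + r * S * (1 / real p))"
      by (rule sum.mono_neutral_cong_right) (auto simp: c_def a_def b_def algebra_simps)
    also have "\<dots> = (\<Sum>p | prime p \<and> p \<le> N. ln (moment r p) - r * max_log \<sigma> m p)
        + r * S * (\<Sum>p | prime p \<and> p \<le> N. 1 / real p)"
      by (simp only: sum.distrib sum_distrib_left)
    finally have eq: "(\<Sum>p. a r p) = r * (\<Sum>p. b p) + ((\<Sum>k. c (k + Suc N))
        + ((\<Sum>p | prime p \<and> p \<le> N. ln (moment r p) - r * max_log \<sigma> m p)
        + r * S * (\<Sum>p | prime p \<and> p \<le> N. 1 / real p)))" .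
    define D1 where "D1 = (\<Sum>p | prime p \<and> p \<le> N. ln (moment r p) - r * max_log \<sigma> m p)"
    define D2 where "D2 = (\<Sum>p | prime p \<and> p \<le> N. 1 / real p) - ln (ln y) - mertens_const"
    define D3 where "D3 = ln (ln y) - ln (ln r)"
    have "(\<Sum>p. a r p) - (S * r * ln (ln r) + Sym1_const \<sigma> m * r)
        = D1 + r * S * D2 + r * S * D3 + (\<Sum>k. c (k + Suc N))"
      unfolding eq Sym1 D1_def D2_def D3_def by (simp add: algebra_simps)
    \<comment> \<open>Up to the cutoff \<open>y \<le> 2N\<close> replaces \<open>y\<close> by \<open>N\<close> in the logarithm at the cost of \<open>ln 2\<close>.\<close>
    moreover have "\<bar>D1\<bar> \<le> (A + 4) * 42 * cutoff * (r / ln r)"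
    proof -
      have "\<bar>D1\<bar> \<le> (\<Sum>p | prime p \<and> p \<le> N. (A + 4) * (1 + ln (real N / real p)))"
        unfolding D1_def
      proof (intro order.trans[OF sum_abs] sum_mono)
        fix p assume "p \<in> {p. prime p \<and> p \<le> N}"
        then have p: "prime p" "p \<le> N" "real p > 0" "real p \<le> y"
          using N(3) prime_gt_0_nat by auto
        have "\<bar>ln (moment r p) - r * max_log \<sigma> m p\<bar> \<le> A + 4 * ln (y / real p)"
          unfolding A_def y_def using p r cutoff_ge by (intro moment_small_prime) (auto simp: y_def)
        also have "ln (y / real p) \<le> ln (2 * (real N / real p))"
          using p y r Nr by (subst ln_le_cancel_iff) (auto intro!: divide_right_mono)
        also have "\<dots> = ln 2 + ln (real N / real p)"
          using p Nr by (intro ln_mult_pos) auto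
        finally have "\<bar>ln (moment r p) - r * max_log \<sigma> m p\<bar> \<le> A + 4 * (ln 2 + ln (real N / real p))"
          by simp
        moreover have "ln 2 \<le> (1 :: real)" using ln_le_minus_one[of "2 :: real"] by simp
        moreover have "0 \<le> A * ln (real N / real p)"
          using A0 p by (intro mult_nonneg_nonneg ln_ge_zero) auto
        ultimately show "\<bar>ln (moment r p) - r * max_log \<sigma> m p\<bar> \<le> (A + 4) * (1 + ln (real N / real p))"
          by (simp add: algebra_simps)
      qed
      also have "\<dots> = (A + 4) * (\<Sum>p | prime p \<and> p \<le> N. 1 + ln (real N / real p))"
        by (simp only: sum_distrib_left)
      also have "\<dots> \<le> (A + 4) * (42 * real N / ln (real N))"
        using A0 by (intro mult_left_mono sum_primes_one_plus_ln_le Nr) auto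
      also have "\<dots> \<le> (A + 4) * (42 * y / ln r)"
        using A0 N lnr y r by (intro mult_left_mono frac_le) auto
      finally show ?thesis by (simp only: y_def times_divide_eq_right mult.assoc)
    qed
    moreover have "\<bar>r * S * D2\<bar> \<le> r * \<bar>S\<bar> * (C1 / ln y)"
    proof -
      have "{p. prime p \<and> real p \<le> y} = {p. prime p \<and> p \<le> N}" using N(3) by auto
      then have "\<bar>D2\<bar> \<le> C1 / ln y" using C1[of y] y r by (simp add: D2_def)
      then have "r * \<bar>S\<bar> * \<bar>D2\<bar> \<le> r * \<bar>S\<bar> * (C1 / ln y)"
        using r by (intro mult_left_mono) auto
      moreover have "\<bar>r * S * D2\<bar> = r * \<bar>S\<bar> * \<bar>D2\<bar>" using r by (simp add: abs_mult)
      ultimately show ?thesis by (simp only:)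
    qed
    moreover have "\<bar>r * S * D3\<bar> \<le> r * \<bar>S\<bar> * (ln cutoff / ln r)"
    proof -
      have lny: "ln y = ln cutoff + ln r"
        unfolding y_def using r cutoff_ge by (intro ln_mult_pos) auto
      have lc: "0 \<le> ln cutoff" using cutoff_ge by simp
      have "D3 = ln (ln y / ln r)" using lny lc lnr by (simp add: D3_def ln_divide_pos)
      also have "\<dots> \<le> ln y / ln r - 1" using lny lc lnr by (intro ln_le_minus_one) auto
      also have "\<dots> = ln cutoff / ln r" using lny lnr by (simp add: add_divide_distrib)
      finally have "D3 \<le> ln cutoff / ln r" .
      moreover have "D3 \<ge> 0" using lny lc lnr by (simp add: D3_def)
      ultimately have "r * \<bar>S\<bar> * \<bar>D3\<bar> \<le> r * \<bar>S\<bar> * (ln cutoff / ln r)"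
        using r by (intro mult_left_mono) auto
      moreover have "\<bar>r * S * D3\<bar> = r * \<bar>S\<bar> * \<bar>D3\<bar>" using r by (simp add: abs_mult)
      ultimately show ?thesis by (simp only:)
    qed
    ultimately show ?thesis
      using a_sum c_tail unfolding y_def by (simp only: simp_thms)
  qed
  show "summable (a r)" if "r \<ge> 2" for r using main[OF that] by simp
  define C where "C = (A + 4) * 42 * cutoff + \<bar>S\<bar> * \<bar>C1\<bar> + \<bar>S\<bar> * ln cutoff + 8 * B + C2 * 12"
  have "\<bar>(\<Sum>p. a r p) - (S * r * ln (ln r) + Sym1_const \<sigma> m * r)\<bar> \<le> C * (r / ln r)" if r: "r \<ge> 2" for r
  proof -
    have lnr: "0 < ln r" using r by simp
    have "1 * r \<le> cutoff * r" using r cutoff_ge by (intro mult_right_mono) auto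
    then have "ln r \<le> ln (cutoff * r)" using r by (subst ln_le_cancel_iff) auto
    then have "C1 / ln (cutoff * r) \<le> \<bar>C1\<bar> / ln r"
      using lnr by (intro frac_le) auto
    then have "r * \<bar>S\<bar> * (C1 / ln (cutoff * r)) \<le> r * \<bar>S\<bar> * (\<bar>C1\<bar> / ln r)"
      using r by (intro mult_left_mono) auto
    moreover have "4 * B * r / sqrt r \<le> 4 * B * r * (2 / ln r)"
    proof -
      have "1 / sqrt r \<le> 2 / ln r"
        using ln_le_two_sqrt[of r] lnr r by (simp add: field_simps)
      then have "4 * B * r * (1 / sqrt r) \<le> 4 * B * r * (2 / ln r)"
        using B_ge r by (intro mult_left_mono) auto
      then show ?thesis by simp
    qed
    ultimately have "\<bar>(\<Sum>p. a r p) - (S * r * ln (ln r) + Sym1_const \<sigma> m * r)\<bar>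
      \<le> (A + 4) * 42 * cutoff * (r / ln r) + r * \<bar>S\<bar> * (\<bar>C1\<bar> / ln r) + r * \<bar>S\<bar> * (ln cutoff / ln r)
        + (4 * B * r * (2 / ln r) + C2 * 12 * r / ln r)"
      using main[OF r] unfolding T_def by linarith
    also have "\<dots> = C * (r / ln r)"
      using lnr by (simp add: C_def field_simps)
    finally show ?thesis .
  qed
  then show "\<exists>C. \<forall>r\<ge>2. \<bar>(\<Sum>p. a r p) - (Sym_const \<sigma> m * r * ln (ln r) + Sym1_const \<sigma> m * r)\<bar> \<le> C * (r / ln r)"
    unfolding S_def by blast
qed

lemma Ln_euler_product_asymptotics:
  assumes L: "\<And>r. L r = prodinf (\<lambda>p. if prime p then complex_of_real (moment r p) else 1)"
  shows "(\<lambda>r. Ln (L r) - of_real (Sym_const \<sigma> m * r * ln (ln r) + Sym1_const \<sigma> m * r))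
          \<in> O[at_top](\<lambda>r::real. of_real (r / ln r))"
proof -
  let ?a = "\<lambda>r p. if prime p then ln (moment r p) else 0"
  obtain C where C: "\<And>r. r \<ge> 2 \<Longrightarrow>
      \<bar>(\<Sum>p. ?a r p) - (Sym_const \<sigma> m * r * ln (ln r) + Sym1_const \<sigma> m * r)\<bar> \<le> C * (r / ln r)"
    using euler_sum_asymptotics(2) by blast
  have LnL: "Ln (L r) = of_real (\<Sum>p. ?a r p)" if r: "r \<ge> 2" for r
  proof -
    have "(if prime p then complex_of_real (moment r p) else 1) = exp (complex_of_real (?a r p))" for p
      using moment_pos[of p r] r by (auto simp: exp_of_real)
    then have "L r = prodinf (\<lambda>p. exp (complex_of_real (?a r p)))"
      by (simp add: L)
    also have "\<dots> = exp (\<Sum>p. complex_of_real (?a r p))"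
      by (intro prodinf_exp summable_of_real euler_sum_asymptotics(1) r)
    also have "(\<Sum>p. complex_of_real (?a r p)) = of_real (\<Sum>p. ?a r p)"
      by (rule suminf_of_real[symmetric, OF euler_sum_asymptotics(1)[OF r]])
    finally show ?thesis by (simp add: exp_of_real Ln_of_real)
  qed
  show ?thesis
  proof (rule bigoI)
    show "\<forall>\<^sub>F r in at_top. norm (Ln (L r) - of_real (Sym_const \<sigma> m * r * ln (ln r) + Sym1_const \<sigma> m * r))
        \<le> C * norm (complex_of_real (r / ln r))"
      using eventually_ge_at_top[of 2]
    proof eventually_elim
      case (elim r)
      have "norm (Ln (L r) - of_real (Sym_const \<sigma> m * r * ln (ln r) + Sym1_const \<sigma> m * r))
          = \<bar>(\<Sum>p. ?a r p) - (Sym_const \<sigma> m * r * ln (ln r) + Sym1_const \<sigma> m * r)\<bar>"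
        unfolding LnL[OF elim] of_real_diff[symmetric] by (rule norm_of_real)
      moreover have "norm (complex_of_real (r / ln r)) = r / ln r"
        using elim by (subst norm_of_real) simp
      ultimately show ?case using C[OF elim] by (simp only:)
    qed
  qed
qed

end

section \<open>The two Euler products\<close>

lemma (in haar_SU2) L_moment_eq_prodinf:
  assumes F: "\<And>p g. prime p \<Longrightarrow> g \<in> SU2 \<Longrightarrow> D_fac (of_real (real p powr - s)) \<rho> g = of_real (W p g)"
  shows "L_moment \<mu> (of_real z) s 1 \<rho> (sym_rep m) = prodinf (\<lambda>p. if prime p
     then complex_of_real (LINT g|\<mu>. W p g * exp (z * sym_log m (1 / real p) (Re (g $ 1 $ 1)))) else 1)"
  unfolding L_moment_def
proof (rule arg_cong[of _ _ prodinf], rule ext)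
  fix p :: nat
  have "(LINT g|\<mu>. D_fac (of_real (real p powr - s)) \<rho> g * D_fac (of_real (real p powr - 1)) (sym_rep m) g powr of_real z)
      = complex_of_real (LINT g|\<mu>. W p g * exp (z * sym_log m (1 / real p) (Re (g $ 1 $ 1))))" if p: "prime p"
  proof -
    have "D_fac (of_real (real p powr - s)) \<rho> g * D_fac (of_real (real p powr - 1)) (sym_rep m) g powr of_real z
        = complex_of_real (W p g * exp (z * sym_log m (1 / real p) (Re (g $ 1 $ 1))))" if g: "g \<in> SU2" for g
    proof -
      have "real p powr - 1 = 1 / real p"
        using p prime_gt_0_nat by (simp add: powr_minus_divide)
      then have "D_fac (of_real (real p powr - 1)) (sym_rep m) g = of_real (exp (sym_log m (1 / real p) (Re (g $ 1 $ 1))))"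
        using inverse_prime_bounds[OF p] by (simp only:) (intro D_fac_sym_rep_SU2 g; simp)
      then have "D_fac (of_real (real p powr - 1)) (sym_rep m) g powr of_real z
          = of_real (exp (sym_log m (1 / real p) (Re (g $ 1 $ 1))) powr z)"
        by (simp only: powr_of_real exp_ge_zero)
      also have "exp (sym_log m (1 / real p) (Re (g $ 1 $ 1))) powr z = exp (z * sym_log m (1 / real p) (Re (g $ 1 $ 1)))"
        by (simp add: powr_def)
      finally show ?thesis by (simp only: F[OF p g] of_real_mult)
    qed
    then have "(LINT g|\<mu>. D_fac (of_real (real p powr - s)) \<rho> g * D_fac (of_real (real p powr - 1)) (sym_rep m) g powr of_real z)
        = (LINT g|\<mu>. complex_of_real (W p g * exp (z * sym_log m (1 / real p) (Re (g $ 1 $ 1)))))"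
      by (intro Bochner_Integration.integral_cong) auto
    then show ?thesis by (simp only: integral_complex_of_real)
  qed
  then show "(if prime p then LINT g|\<mu>. D_fac (of_real (real p powr - s)) \<rho> g
        * D_fac (of_real (real p powr - 1)) (sym_rep m) g powr of_real z else 1)
      = (if prime p then complex_of_real (LINT g|\<mu>. W p g * exp (z * sym_log m (1 / real p) (Re (g $ 1 $ 1)))) else 1)"
    by simp
qed

lemma sym_char_1: "\<bar>x\<bar> \<le> 1 \<Longrightarrow> sym_char (Suc 0) x = 2 * x"
  by (simp add: sym_char_def cos_arccos_abs)

lemma sym_char_2: "\<bar>x\<bar> \<le> 1 \<Longrightarrow> sym_char 2 x = 4 * x\<^sup>2 - 1"
  by (simp add: sym_char_def numeral_2_eq_2 cos_double_cos[of "arccos x", unfolded numeral_2_eq_2] cos_arccos_abs)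

lemma exp_sym_log_1:
  assumes "\<bar>x\<bar> \<le> 1" "0 \<le> Y" "Y < 1"
  shows "exp (sym_log 1 Y x) = 1 / (1 - 2 * Y * x + Y\<^sup>2)" "1 - 2 * Y * x + Y\<^sup>2 \<ge> (1 - Y)\<^sup>2"
proof -
  have "2 * Y * x \<le> 2 * Y * 1" using assms by (intro mult_left_mono) auto
  then show le: "1 - 2 * Y * x + Y\<^sup>2 \<ge> (1 - Y)\<^sup>2" by (simp add: power2_eq_square algebra_simps)
  moreover have "(1 - Y)\<^sup>2 > 0" using assms by simp
  ultimately have "1 - 2 * Y * x + Y\<^sup>2 > 0" by linarith
  then show "exp (sym_log 1 Y x) = 1 / (1 - 2 * Y * x + Y\<^sup>2)"
    using assms by (simp add: sym_log_def cos_arccos_abs exp_minus inverse_eq_divide)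
qed

lemma std_rep_eq_sym_rep: "std_rep = sym_rep 1"
proof (rule ext, rule eq_matI)
  fix g i j assume "i < dim_row (sym_rep 1 g)" "j < dim_col (sym_rep 1 g)"
  then have "i = 0 \<or> i = 1" "j = 0 \<or> j = 1" by auto
  then show "std_rep g $$ (i, j) = sym_rep 1 g $$ (i, j)"
    by (auto simp: std_rep_def sym_rep_index mat_of_rows_list_def)
qed (auto simp: std_rep_def mat_of_rows_list_def)

lemma prime_powr_half_bounds:
  assumes "prime p"
  shows "real p powr - (1 / 2) = 1 / sqrt (real p)" "0 < 1 / sqrt (real p)" "1 / sqrt (real p) \<le> 3 / 4"
proof -
  have p: "real p \<ge> 2" using prime_ge_2_nat[OF assms] by simp
  then show "real p powr - (1 / 2) = 1 / sqrt (real p)" "0 < 1 / sqrt (real p)"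
    by (auto simp: powr_minus_divide powr_half_sqrt)
  have "4 / 3 \<le> sqrt (real p)"
    using p by (intro real_le_rsqrt) (simp add: power2_eq_square)
  then have "1 / sqrt (real p) \<le> 1 / (4 / 3)" using p by (intro divide_left_mono) auto
  then show "1 / sqrt (real p) \<le> 3 / 4" by simp
qed

context haar_SU2
begin

text \<open>Here \<open>W = 1 / (1 - 2Yx + Y\<^sup>2)\<close> with \<open>Y = p\<^sup>-\<^sup>1\<^sup>/\<^sup>2\<close>, the generating function of the characters:
  \<open>W = 1 + Y \<chi>\<^sub>1 + Y\<^sup>2 \<chi>\<^sub>2 + O(Y\<^sup>3)\<close>, and both characters integrate to zero. The value \<open>Y\<close> exceeds \<open>1/2\<close>
  at \<open>p = 2, 3\<close>, so the estimates for \<^const>\<open>sym_log\<close> with \<open>X \<le> 1/2\<close> are replaced by this explicit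
  formula.\<close>

lemma weighted_moment_std:
  assumes "m \<ge> 1" "\<sigma> \<in> {1, -1}"
  shows "weighted_moment \<mu> m \<sigma> (\<lambda>p g. exp (sym_log 1 (1 / sqrt (real p)) (Re (g $ 1 $ 1)))) 200"
proof unfold_locales
  fix p :: nat assume p: "prime p"
  define Y where "Y = 1 / sqrt (real p)"
  have Y: "0 < Y" "Y \<le> 3 / 4" using prime_powr_half_bounds[OF p] by (auto simp: Y_def)
  let ?W = "\<lambda>g :: complex^2^2. exp (sym_log 1 Y (Re (g $ 1 $ 1)))"
  let ?u = "\<lambda>x. 1 - 2 * Y * x + Y\<^sup>2"
  have W: "?W g = 1 / ?u (Re (g $ 1 $ 1))" if "g \<in> SU2" for g
    using Y SU2_Re_bound[OF that] by (intro exp_sym_log_1) auto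
  have u_ge: "?u x \<ge> 1 / 16" if "\<bar>x\<bar> \<le> 1" for x
  proof -
    have "(1 / 4)\<^sup>2 \<le> (1 - Y)\<^sup>2" using Y by (intro power_mono) auto
    then show ?thesis using exp_sym_log_1(2)[OF that, of Y] Y by (simp add: power2_eq_square)
  qed
  have Y1: "Y * Y \<le> Y * 1" using Y by (intro mult_left_mono) auto
  have u_diff: "\<bar>1 - ?u x\<bar> \<le> 3 * Y" if "\<bar>x\<bar> \<le> 1" for x
  proof -
    have "Y * x \<le> Y * 1" "Y * (- 1) \<le> Y * x" using Y that by (intro mult_left_mono; force)+
    moreover have eq: "1 - ?u x = 2 * (Y * x) - Y * Y" by (simp add: power2_eq_square)
    moreover have "0 \<le> Y * Y" by simp
    ultimately show ?thesis unfolding eq using Y Y1 by linarith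
  qed
  have inv_le: "1 / ?u x \<le> 16" if "\<bar>x\<bar> \<le> 1" for x
    using u_ge[OF that] by (simp add: divide_le_eq)
  have near: "\<bar>1 / ?u x - 1\<bar> \<le> 48 * Y" if "\<bar>x\<bar> \<le> 1" for x
  proof -
    have "?u x > 0" using u_ge[OF that] by simp
    then have "1 / ?u x - 1 = (1 - ?u x) * (1 / ?u x)" by (simp add: field_simps)
    also have "\<bar>(1 - ?u x) * (1 / ?u x)\<bar> \<le> (3 * Y) * 16"
      unfolding abs_mult using u_diff[OF that] inv_le[OF that] u_ge[OF that] Y
      by (intro mult_mono) auto
    finally show ?thesis by simp
  qed
  have cont: "continuous_on SU2 ?W"
  proof -
    have "continuous_on {-1..1} (\<lambda>x. 1 / ?u x)"
      using u_ge by (intro continuous_intros) (force simp: abs_le_iff)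
    then have "continuous_on SU2 (\<lambda>g. 1 / ?u (Re (g $ 1 $ 1)))" by (rule continuous_on_Re_entry)
    then show ?thesis by (subst continuous_on_cong[OF refl W])
  qed
  then show "continuous_on SU2 (\<lambda>g. exp (sym_log 1 (1 / sqrt (real p)) (Re (g $ 1 $ 1))))"
    by (simp add: Y_def)
  show "\<bar>expectation (\<lambda>g. exp (sym_log 1 (1 / sqrt (real p)) (Re (g $ 1 $ 1)))) - 1\<bar> \<le> 200 / (real p * sqrt (real p))"
  proof -
    let ?c = "\<lambda>g :: complex^2^2. Y * sym_char 1 (Re (g $ 1 $ 1)) + Y\<^sup>2 * sym_char 2 (Re (g $ 1 $ 1))"
    have ci: "integrable \<mu> (\<lambda>g. sym_char k (Re (g $ 1 $ 1)))" for k
      by (intro integrable_continuous continuous_on_Re_entry continuous_on_sym_char)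
    have c: "integrable \<mu> ?c" "(LINT g|\<mu>. ?c g) = 0"
      using ci by (simp_all add: integral_sym_char_eq_0)
    have pt: "\<bar>?W g - 1 - ?c g\<bar> \<le> 176 * Y ^ 3" if g: "g \<in> SU2" for g
    proof -
      define x where "x = Re (g $ 1 $ 1)"
      have x: "\<bar>x\<bar> \<le> 1" using SU2_Re_bound[OF g] by (simp add: x_def)
      then have x2: "x\<^sup>2 \<le> 1" by (simp add: abs_square_le_1)
      \<comment> \<open>The Chebyshev recursion \<open>\<chi>\<^sub>1\<^sup>2 = \<chi>\<^sub>2 + 1\<close> cancels the first three orders in \<open>Y\<close>.\<close>
      have "1 - ?u x * (1 + Y * (2 * x) + Y\<^sup>2 * (4 * x\<^sup>2 - 1)) = Y ^ 3 * (2 * x * (4 * x\<^sup>2 - 2) - Y * (4 * x\<^sup>2 - 1))"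
        by (simp add: power2_eq_square power3_eq_cube algebra_simps)
      then have "1 / ?u x - 1 - (Y * (2 * x) + Y\<^sup>2 * (4 * x\<^sup>2 - 1))
          = Y ^ 3 * (2 * x * (4 * x\<^sup>2 - 2) - Y * (4 * x\<^sup>2 - 1)) * (1 / ?u x)"
        using u_ge[OF x] by (simp add: field_simps)
      moreover have "\<bar>Y ^ 3 * (2 * x * (4 * x\<^sup>2 - 2) - Y * (4 * x\<^sup>2 - 1)) * (1 / ?u x)\<bar> \<le> (Y ^ 3 * 11) * 16"
      proof -
        have "\<bar>2 * x * (4 * x\<^sup>2 - 2)\<bar> \<le> 2 * 2"
          unfolding abs_mult[of "2 * x"] using x x2 by (intro mult_mono) (auto simp: abs_le_iff)
        moreover have "\<bar>Y * (4 * x\<^sup>2 - 1)\<bar> \<le> 1 * 3"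
        proof -
          have "\<bar>4 * x\<^sup>2 - 1\<bar> \<le> 3" using x2 zero_le_power2[of x] by linarith
          then show ?thesis unfolding abs_mult using Y by (intro mult_mono) auto
        qed
        ultimately have "\<bar>2 * x * (4 * x\<^sup>2 - 2) - Y * (4 * x\<^sup>2 - 1)\<bar> \<le> 11" by linarith
        then show ?thesis
          unfolding abs_mult[of _ "1 / ?u x"] abs_mult[of "Y ^ 3"]
          using Y inv_le[OF x] u_ge[OF x] by (intro mult_mono) auto
      qed
      moreover have "?W g - 1 - ?c g = 1 / ?u x - 1 - (Y * (2 * x) + Y\<^sup>2 * (4 * x\<^sup>2 - 1))"
        using W[OF g] x by (simp add: sym_char_1 sym_char_2 x_def)
      ultimately show ?thesis by simp
    qed
    have "(LINT g|\<mu>. ?W g - 1 - ?c g) = (LINT g|\<mu>. ?W g) - 1"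
      using c integrable_continuous[OF cont] by (simp add: prob_space del: space_haar)
    then have "\<bar>(LINT g|\<mu>. ?W g) - 1\<bar> \<le> 176 * Y ^ 3"
      using abs_integral_le[of "\<lambda>g. ?W g - 1 - ?c g" "176 * Y ^ 3"] pt by simp
    also have "Y ^ 3 = 1 / (real p * sqrt (real p))"
      by (simp add: Y_def power3_eq_cube)
    finally show ?thesis
      unfolding Y_def by (rule order.trans) (simp add: divide_right_mono)
  qed
  fix g assume g: "g \<in> SU2"
  define x where "x = Re (g $ 1 $ 1)"
  have x: "\<bar>x\<bar> \<le> 1" using SU2_Re_bound[OF g] by (simp add: x_def)
  have Wg: "exp (sym_log 1 (1 / sqrt (real p)) (Re (g $ 1 $ 1))) = 1 / ?u x"
    using W[OF g] by (simp add: Y_def x_def)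
  have "?u x \<le> 4" using u_diff[OF x] Y by linarith
  then show "1 / 200 \<le> exp (sym_log 1 (1 / sqrt (real p)) (Re (g $ 1 $ 1)))"
    unfolding Wg using u_ge[OF x] by (intro divide_left_mono) auto
  show "exp (sym_log 1 (1 / sqrt (real p)) (Re (g $ 1 $ 1))) \<le> 200"
    unfolding Wg using inv_le[OF x] by linarith
  show "\<bar>exp (sym_log 1 (1 / sqrt (real p)) (Re (g $ 1 $ 1))) - 1\<bar> \<le> 200 / sqrt (real p)"
  proof -
    have "48 * Y \<le> 200 * Y" using Y by simp
    then show ?thesis unfolding Wg using near[OF x] by (simp add: Y_def)
  qed
qed (use assms in auto)

text \<open>Here \<open>W = 1 + p\<^sup>-\<^sup>1 \<chi>\<^sub>2 + O(p\<^sup>-\<^sup>2)\<close>, where \<open>\<chi>\<^sub>2\<close> integrates to zero. Since \<open>\<bar>sym_log 2 (1/p)\<bar> \<le> 23/p \<le> 12\<close>,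
  all constants are governed by \<open>e\<^sup>1\<^sup>2\<close>.\<close>

lemma weighted_moment_sym2:
  assumes "m \<ge> 1" "\<sigma> \<in> {1, -1}"
  shows "weighted_moment \<mu> m \<sigma> (\<lambda>p g. exp (sym_log 2 (1 / real p) (Re (g $ 1 $ 1)))) (600 * exp 12)"
proof unfold_locales
  have e12: "exp (12 :: real) \<ge> 1" by simp
  then show "1 \<le> 600 * exp (12 :: real)" by linarith
  fix p :: nat assume p: "prime p"
  define X where "X = 1 / real p"
  have X: "0 < X" "X \<le> 1 / 2" using inverse_prime_bounds[OF p] by (auto simp: X_def)
  let ?l = "\<lambda>g :: complex^2^2. sym_log 2 X (Re (g $ 1 $ 1))"
  let ?c = "\<lambda>g :: complex^2^2. sym_char 2 (Re (g $ 1 $ 1))"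
  have sq: "X * sqrt (real p) = 1 / sqrt (real p)"
    using prime_gt_0_nat[OF p] by (simp add: X_def eq_divide_eq)
  have p1: "1 \<le> sqrt (real p)" using prime_ge_2_nat[OF p] by simp
  have Xs: "X \<le> 1 / sqrt (real p)" using mult_left_mono[OF p1, of X] X by (simp add: sq)
  have approx: "\<bar>?l g - X * ?c g\<bar> \<le> 39 * X\<^sup>2" for g
    using sym_log_approx[of X 2 "Re (g $ 1 $ 1)"] X by simp
  have lb: "\<bar>?l g\<bar> \<le> 23 * X" for g
  proof -
    have "\<bar>X * ?c g\<bar> \<le> X * 3"
      unfolding abs_mult using X sym_char_bound[of 2] by (intro mult_mono) auto
    moreover have "X\<^sup>2 \<le> 1 / 2 * X" unfolding power2_eq_square using X by (intro mult_right_mono) auto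
    ultimately show ?thesis using approx[of g] by linarith
  qed
  have l12: "\<bar>?l g\<bar> \<le> 12" for g using lb[of g] X by linarith
  have eb: "\<bar>exp (?l g) - 1 - ?l g\<bar> \<le> 529 * exp 12 * X\<^sup>2" for g
  proof -
    have "(?l g)\<^sup>2 * exp \<bar>?l g\<bar> \<le> (23 * X)\<^sup>2 * exp 12"
    proof (intro mult_mono)
      show "(?l g)\<^sup>2 \<le> (23 * X)\<^sup>2"
        using lb[of g] by (metis abs_ge_zero power2_abs power_mono)
    qed (use l12[of g] in auto)
    then show ?thesis using abs_exp_minus_linear_le[of "?l g"] by (simp add: power_mult_distrib mult_ac)
  qed
  have cont: "continuous_on SU2 (\<lambda>g. exp (?l g))"
    using X by (intro continuous_intros continuous_on_Re_entry continuous_on_sym_log) auto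
  then show "continuous_on SU2 (\<lambda>g. exp (sym_log 2 (1 / real p) (Re (g $ 1 $ 1))))"
    by (simp add: X_def)
  show "\<bar>expectation (\<lambda>g. exp (sym_log 2 (1 / real p) (Re (g $ 1 $ 1)))) - 1\<bar> \<le> 600 * exp 12 / (real p * sqrt (real p))"
  proof -
    have ci: "integrable \<mu> ?c"
      by (intro integrable_continuous continuous_on_Re_entry continuous_on_sym_char)
    have pt: "\<bar>exp (?l g) - 1 - X * ?c g\<bar> \<le> 600 * exp 12 * X\<^sup>2" for g
    proof -
      have "39 * X\<^sup>2 \<le> 71 * (exp 12 * X\<^sup>2)"
        using mult_right_mono[OF e12, of "X\<^sup>2"] zero_le_power2[of X] by linarith
      then show ?thesis using eb[of g] approx[of g] by linarith
    qed
    have "(LINT g|\<mu>. exp (?l g) - 1 - X * ?c g) = (LINT g|\<mu>. exp (?l g)) - 1"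
      using ci integrable_continuous[OF cont] integral_sym_char_eq_0[of 2]
      by (simp add: prob_space del: space_haar)
    then have "\<bar>(LINT g|\<mu>. exp (?l g)) - 1\<bar> \<le> 600 * exp 12 * X\<^sup>2"
      using abs_integral_le[of "\<lambda>g. exp (?l g) - 1 - X * ?c g" "600 * exp 12 * X\<^sup>2"] pt by simp
    also have "\<dots> \<le> 600 * exp 12 * (X * (1 / sqrt (real p)))"
      unfolding power2_eq_square using X Xs by (intro mult_left_mono) auto
    finally show ?thesis by (simp add: X_def)
  qed
  fix g assume "g \<in> SU2"
  have l': "sym_log 2 (1 / real p) (Re (g $ 1 $ 1)) = ?l g" by (simp add: X_def)
  show "1 / (600 * exp 12) \<le> exp (sym_log 2 (1 / real p) (Re (g $ 1 $ 1)))"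
  proof -
    have "1 / (600 * exp 12) \<le> 1 / exp (12 :: real)" by (intro divide_left_mono) auto
    also have "\<dots> = exp (- 12)" by (simp add: exp_minus inverse_eq_divide)
    also have "\<dots> \<le> exp (?l g)" using l12[of g] by (simp add: abs_le_iff)
    finally show ?thesis unfolding l' .
  qed
  show "exp (sym_log 2 (1 / real p) (Re (g $ 1 $ 1))) \<le> 600 * exp 12"
  proof -
    have "exp (?l g) \<le> exp 12" using l12[of g] by (simp add: abs_le_iff)
    then show ?thesis unfolding l' using exp_ge_zero[of 12] by linarith
  qed
  show "\<bar>exp (sym_log 2 (1 / real p) (Re (g $ 1 $ 1))) - 1\<bar> \<le> 600 * exp 12 / sqrt (real p)"
  proof -
    have "X\<^sup>2 \<le> 1 / 2 * X" unfolding power2_eq_square using X by (intro mult_right_mono) auto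
    then have "529 * exp 12 * X\<^sup>2 \<le> 529 * exp 12 * (1 / 2 * X)" by (intro mult_left_mono) auto
    also have "\<dots> = 529 / 2 * (exp 12 * X)" by simp
    finally have "529 * exp 12 * X\<^sup>2 \<le> 529 / 2 * (exp 12 * X)" .
    moreover have "1 * X \<le> exp 12 * X" using e12 X by (intro mult_right_mono) auto
    ultimately have "\<bar>exp (?l g) - 1\<bar> \<le> 600 * exp 12 * X"
      using eb[of g] lb[of g] X by linarith
    also have "\<dots> \<le> 600 * exp 12 * (1 / sqrt (real p))"
      using Xs by (intro mult_left_mono) auto
    finally show ?thesis unfolding l' by simp
  qed
qed (use assms in auto)

end

theorem proposition6:
  fixes m :: nat and \<mu> :: "(complex^2^2) measure" and \<sigma> :: real
  assumes "m \<in> {1, 2, 4}"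
    and "is_haar_prob_SU2 \<mu>"
    and "\<sigma> \<in> {1, -1}"
  shows "(\<lambda>r. Ln (L_moment \<mu> (of_real (\<sigma> * r)) (1/2) 1 std_rep (sym_rep m))
            - of_real (Sym_const \<sigma> m * r * ln (ln r) + Sym1_const \<sigma> m * r))
          \<in> O[at_top](\<lambda>r::real. of_real (r / ln r))
       \<and> (\<lambda>r. Ln (L_moment \<mu> (of_real (\<sigma> * r)) 1 1 (sym_rep 2) (sym_rep m))
            - of_real (Sym_const \<sigma> m * r * ln (ln r) + Sym1_const \<sigma> m * r))
          \<in> O[at_top](\<lambda>r::real. of_real (r / ln r))"
proof
  interpret haar_SU2 \<mu> by unfold_locales (rule assms(2))
  have m: "m \<ge> 1" using assms(1) by auto
  interpret std: weighted_moment \<mu> m \<sigma> "\<lambda>p g. exp (sym_log 1 (1 / sqrt (real p)) (Re (g $ 1 $ 1)))" 200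
    by (rule weighted_moment_std[OF m assms(3)])
  interpret sym2: weighted_moment \<mu> m \<sigma> "\<lambda>p g. exp (sym_log 2 (1 / real p) (Re (g $ 1 $ 1)))" "600 * exp 12"
    by (rule weighted_moment_sym2[OF m assms(3)])
  show "(\<lambda>r. Ln (L_moment \<mu> (of_real (\<sigma> * r)) (1/2) 1 std_rep (sym_rep m))
            - of_real (Sym_const \<sigma> m * r * ln (ln r) + Sym1_const \<sigma> m * r))
          \<in> O[at_top](\<lambda>r::real. of_real (r / ln r))"
  proof (rule std.Ln_euler_product_asymptotics, unfold std.moment_def, rule L_moment_eq_prodinf)
    fix p :: nat and g assume p: "prime p" and g: "g \<in> SU2"
    show "D_fac (of_real (real p powr - (1/2))) std_rep g = of_real (exp (sym_log 1 (1 / sqrt (real p)) (Re (g $ 1 $ 1))))"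
      unfolding std_rep_eq_sym_rep prime_powr_half_bounds(1)[OF p]
      by (intro D_fac_sym_rep_SU2 g) (use prime_powr_half_bounds(2,3)[OF p] in linarith)+
  qed
  show "(\<lambda>r. Ln (L_moment \<mu> (of_real (\<sigma> * r)) 1 1 (sym_rep 2) (sym_rep m))
            - of_real (Sym_const \<sigma> m * r * ln (ln r) + Sym1_const \<sigma> m * r))
          \<in> O[at_top](\<lambda>r::real. of_real (r / ln r))"
  proof (rule sym2.Ln_euler_product_asymptotics, unfold sym2.moment_def, rule L_moment_eq_prodinf)
    fix p :: nat and g assume p: "prime p" and g: "g \<in> SU2"
    have e: "real p powr - 1 = 1 / real p"
      using prime_gt_0_nat[OF p] by (simp add: powr_minus_divide)
    show "D_fac (of_real (real p powr - 1)) (sym_rep 2) g = of_real (exp (sym_log 2 (1 / real p) (Re (g $ 1 $ 1))))"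
      unfolding e using inverse_prime_bounds[OF p] by (intro D_fac_sym_rep_SU2 g) simp_all
  qed
qed

end
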